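(* Let $X \in \mathbb{R}^{n \times d}$ and $Y \in \mathbb{R}^{n}$. Let $\varepsilon, \delta>0$ and let $a>1$. Then there is a distribution over sketching matrices $S\in \mathbb{R}^{r \times n}$ and a corresponding weight vector $w \in \mathbb{R}^r$ such that $X'=S[X,Y]\in\mathbb{R}^{r\times(d+1)}$ can be computed in time $T$ in a single pass over a turnstile data stream, and such that $(X', w)$ is a weak weighted $(\mathbb{R}^d, \alpha, \varepsilon)$-sketch for $\ell_1$-regression with failure probability at most $P$, where either \begin{enumerate} \item $r=O(d^{1+c}\ln(n)^{3+5c})$ for any constant $0<c\leq 1$, $T=O(d\ln(n)\,\mathrm{nnz}(X))$, and $\alpha=1+\frac{1}{c}$ and $P$ are constants; or \item $r = O\!\left(\frac{d^4 \ln(n)^5 }{\delta\varepsilon^7 }\right)+\frac{32 d \ln(n)^3}{\varepsilon^5}\cdot \left(\frac{64 d \ln(n)^5 }{\varepsilon^6 \delta }\right)^{1 + \varepsilon^{-1}}$, $T=O(\mathrm{nnz}(X))$, $\alpha=1+a\varepsilon$, and $P=\delta+\frac{1}{a}$. \end{enumerate}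
   Context: $\ell_1$-regression: given $X\in\mathbb{R}^{n\times d}$ and $Y\in\mathbb{R}^n$, minimize $\|X\beta-Y\|_1$ over $\beta\in\mathbb{R}^d$. For a sketch $X'=S[X,Y]$ with weights $w\in\mathbb{R}^r_{>0}$, the sketched objective is $g_w(\beta)=\sum_{j=1}^r w_j\,|x'_j(\beta,-1)^T|$, where $x'_j$ is the $j$-th row of $X'$. "$(X',w)$ is a weak weighted $(\mathbb{R}^d,\alpha,\varepsilon)$-sketch for $\ell_1$-regression" means: for all $\beta\in\mathbb{R}^d$, $g_w(\beta)\geq(1-\varepsilon)\|X\beta-Y\|_1$, and for a minimizer $\beta^*$ of $\|X\beta-Y\|_1$ it holds that $g_w(\beta^* )\leq \alpha\|X\beta^*-Y\|_1$. "Failure probability at most $P$" means these properties hold with probability at least $1-P$ over the random choice of $S$ (and $w$). $\mathrm{nnz}(X)$ denotes the number of nonzero entries of $X$. A turnstile data stream is a stream of additive (positive or negative) updates to entries of the input matrix.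
   Formalization: Time is bounded with nnz([X,Y]) plus redundant updates instead of nnz(X) (false for X=0, Y≠0), excluding preparation of S and the zero sketch; n≥2 and d≥1 are assumed (n=1 would force r=0); in item 1 the constants, including P<1, may depend on c and ε. *)

theory Defs
  imports "HOL-Probability.Probability_Mass_Function" "Jordan_Normal_Form.Matrix"
begin

no_notation Finite_Cartesian_Product.vec_nth (infixl \<open>$\<close> 90)
no_notation Inner_Product.real_inner_class.inner (infix \<open>\<bullet>\<close> 70)
hide_const (open) Finite_Cartesian_Product.vec Finite_Cartesian_Product.mat
  Finite_Cartesian_Product.row Determinants.det
hide_type (open) Finite_Cartesian_Product.vec

definition l1_norm :: "real vec \<Rightarrow> real" where
  "l1_norm v = (\<Sum>i<dim_vec v. \<bar>v $ i\<bar>)"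

definition l1_loss :: "real mat \<Rightarrow> real vec \<Rightarrow> real vec \<Rightarrow> real" where
  "l1_loss X Y \<beta> = l1_norm (X *\<^sub>v \<beta> - Y)"

definition l1_minimizer :: "real mat \<Rightarrow> real vec \<Rightarrow> real vec \<Rightarrow> bool" where
  "l1_minimizer X Y \<beta> \<longleftrightarrow> is_arg_min (l1_loss X Y) (\<lambda>\<beta>. \<beta> \<in> carrier_vec (dim_col X)) \<beta>"

definition append_col :: "real mat \<Rightarrow> real vec \<Rightarrow> real mat" where
  "append_col X Y = mat (dim_row X) (dim_col X + 1)
     (\<lambda>(i, j). if j < dim_col X then X $$ (i, j) else Y $ i)"

definition nnz :: "real mat \<Rightarrow> nat" where
  "nnz A = card {(i, j). i < dim_row A \<and> j < dim_col A \<and> A $$ (i, j) \<noteq> 0}"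

definition sketched_loss :: "real mat \<Rightarrow> real vec \<Rightarrow> real vec \<Rightarrow> real" where
  "sketched_loss X' w \<beta> =
     (\<Sum>j<dim_row X'. w $ j * \<bar>row X' j \<bullet> (\<beta> @\<^sub>v vec_of_list [-1])\<bar>)"

text \<open>The upper bound concerns one minimizer \<open>\<beta>opt\<close> of the original loss, which is a
  parameter of the notion: it is chosen independently of the random sketch.\<close>

definition weak_weighted_sketch ::
  "real mat \<Rightarrow> real vec \<Rightarrow> real vec \<Rightarrow> real \<Rightarrow> real \<Rightarrow> real mat \<Rightarrow> real vec \<Rightarrow> bool" where
  "weak_weighted_sketch X Y \<beta>opt \<alpha> \<epsilon> X' w \<longleftrightarrow>
     l1_minimizer X Y \<beta>opt \<and>
     (\<forall>\<beta>\<in>carrier_vec (dim_col X). sketched_loss X' w \<beta> \<ge> (1 - \<epsilon>) * l1_loss X Y \<beta>) \<and>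
     sketched_loss X' w \<beta>opt \<le> \<alpha> * l1_loss X Y \<beta>opt"

definition sketch_distribution :: "nat \<Rightarrow> nat \<Rightarrow> (real mat \<times> real vec) pmf \<Rightarrow> bool" where
  "sketch_distribution r n D \<longleftrightarrow>
     (\<forall>(S, w)\<in>set_pmf D. S \<in> carrier_mat r n \<and> w \<in> carrier_vec r \<and> (\<forall>j<r. w $ j > 0))"

text \<open>A unit-cost real RAM. A machine state consists of a memory of natural numbers (used for
  indices and addresses) and a memory of reals. The numerals in the instructions are addresses
  of registers, except for the second argument of \<open>NConst\<close>.\<close>

type_synonym state = "(nat \<Rightarrow> nat) \<times> (nat \<Rightarrow> real)"

datatype instr =
    NConst nat nat
  | NAdd nat nat nat | NSub nat nat nat | NMul nat nat nat
  | NLoad nat nat | NStore nat nat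
  | RAdd nat nat nat | RSub nat nat nat | RMul nat nat nat | RDiv nat nat nat
  | RLoad nat nat | RStore nat nat

fun exec_instr :: "instr \<Rightarrow> state \<Rightarrow> state" where
  "exec_instr (NConst x k) (N, R) = (N(x := k), R)"
| "exec_instr (NAdd x y z) (N, R) = (N(x := N y + N z), R)"
| "exec_instr (NSub x y z) (N, R) = (N(x := N y - N z), R)"
| "exec_instr (NMul x y z) (N, R) = (N(x := N y * N z), R)"
| "exec_instr (NLoad x y) (N, R) = (N(x := N (N y)), R)"
| "exec_instr (NStore x y) (N, R) = (N(N x := N y), R)"
| "exec_instr (RAdd x y z) (N, R) = (N, R(x := R y + R z))"
| "exec_instr (RSub x y z) (N, R) = (N, R(x := R y - R z))"
| "exec_instr (RMul x y z) (N, R) = (N, R(x := R y * R z))"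
| "exec_instr (RDiv x y z) (N, R) = (N, R(x := R y / R z))"
| "exec_instr (RLoad x y) (N, R) = (N, R(x := R (N y)))"
| "exec_instr (RStore x y) (N, R) = (N, R(N x := R y))"

datatype test = NLess nat nat | RLess nat nat

fun holds :: "test \<Rightarrow> state \<Rightarrow> bool" where
  "holds (NLess x y) (N, R) \<longleftrightarrow> N x < N y"
| "holds (RLess x y) (N, R) \<longleftrightarrow> R x < R y"

datatype com =
    Skip
  | Instr instr
  | Seq com com
  | Cond test com com
  | While test com

text \<open>\<open>exec c s t s'\<close>: from state \<open>s\<close>, program \<open>c\<close> terminates in state \<open>s'\<close> after \<open>t\<close> steps;
  each instruction and each evaluation of a test is one step.\<close>

inductive exec :: "com \<Rightarrow> state \<Rightarrow> nat \<Rightarrow> state \<Rightarrow> bool" where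
  Skip: "exec Skip s 0 s"
| Instr: "exec (Instr i) s 1 (exec_instr i s)"
| Seq: "exec c1 s1 t1 s2 \<Longrightarrow> exec c2 s2 t2 s3 \<Longrightarrow> exec (Seq c1 c2) s1 (t1 + t2) s3"
| CondTrue: "holds b s \<Longrightarrow> exec c1 s t s' \<Longrightarrow> exec (Cond b c1 c2) s (1 + t) s'"
| CondFalse: "\<not> holds b s \<Longrightarrow> exec c2 s t s' \<Longrightarrow> exec (Cond b c1 c2) s (1 + t) s'"
| WhileFalse: "\<not> holds b s \<Longrightarrow> exec (While b c) s 1 s"
| WhileTrue: "holds b s1 \<Longrightarrow> exec c s1 t1 s2 \<Longrightarrow> exec (While b c) s2 t2 s3 \<Longrightarrow>
    exec (While b c) s1 (1 + t1 + t2) s3"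

text \<open>The update \<open>(i, j, v)\<close> adds \<open>v\<close> to entry \<open>(i, j)\<close> of the matrix, which is initially zero.\<close>

type_synonym stream = "(nat \<times> nat \<times> real) list"

definition turnstile_stream :: "nat \<Rightarrow> nat \<Rightarrow> stream \<Rightarrow> bool" where
  "turnstile_stream n m us \<longleftrightarrow> (\<forall>(i, j, v)\<in>set us. i < n \<and> j < m)"

definition stream_mat :: "nat \<Rightarrow> nat \<Rightarrow> stream \<Rightarrow> real mat" where
  "stream_mat n m us = mat n m (\<lambda>(i, j). \<Sum>(i', j', v)\<leftarrow>us. if i' = i \<and> j' = j then v else 0)"

text \<open>The updates of a stream in excess of the necessary ones: producing a matrix \<open>A\<close> from zero
  takes at least \<open>nnz A\<close> updates.\<close>

definition excess_updates :: "nat \<Rightarrow> nat \<Rightarrow> stream \<Rightarrow> nat" where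
  "excess_updates n m us = length us - nnz (stream_mat n m us)"

fun read_update :: "nat \<times> nat \<times> real \<Rightarrow> state \<Rightarrow> state" where
  "read_update (i, j, v) (N, R) = (N(0 := i, 1 := j), R(0 := v))"

text \<open>One pass: the program is run once for each update, and only has access to that update (in
  the registers 0 and 1 for naturals and 0 for reals) and to its memory. Reading an update is
  one step.\<close>

inductive one_pass :: "com \<Rightarrow> stream \<Rightarrow> state \<Rightarrow> nat \<Rightarrow> state \<Rightarrow> bool" where
  Nil: "one_pass c [] s 0 s"
| Cons: "exec c (read_update u s) t s' \<Longrightarrow> one_pass c us s' t' s'' \<Longrightarrow>
    one_pass c (u # us) s (1 + t + t') s''"

definition stored_at :: "nat \<Rightarrow> real mat \<Rightarrow> state \<Rightarrow> bool" where
  "stored_at p A s \<longleftrightarrow>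
     (\<forall>i<dim_row A. \<forall>j<dim_col A. snd s (p + i * dim_col A + j) = A $$ (i, j))"

text \<open>\<open>c\<close> computes \<open>S * A\<close> for every \<open>n \<times> m\<close> matrix \<open>A\<close> given by a turnstile stream, in time
  \<open>\<tau> * nnz A\<close> if the stream has no excess updates; each of these costs another \<open>\<tau>\<close>.
  The initial state \<open>s0\<close> contains the sketching matrix in a suitable representation and the
  zero-initialized sketch. It does not depend on the stream, and its preparation is not charged,
  as the size of \<open>S\<close> and \<open>S * A\<close> is not bounded in terms of \<open>nnz A\<close>.\<close>

definition stream_computes :: "com \<Rightarrow> real mat \<Rightarrow> nat \<Rightarrow> real \<Rightarrow> bool" where
  "stream_computes c S m \<tau> \<longleftrightarrow>
     (\<exists>s0 p. \<forall>us. turnstile_stream (dim_col S) m us \<longrightarrow>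
       (let A = stream_mat (dim_col S) m us in
        \<exists>t s. one_pass c us s0 t s \<and> stored_at p (S * A) s \<and>
          real t \<le> \<tau> * real (nnz A + excess_updates (dim_col S) m us)))"

end

theory Submission
  imports Defs "HOL-Probability.Product_PMF" "Jordan_Normal_Form.Determinant"
begin

(* The additional imports bring back the names and notations that Defs hides. *)
no_notation Finite_Cartesian_Product.vec_nth (infixl \<open>$\<close> 90)
no_notation Inner_Product.real_inner_class.inner (infix \<open>\<bullet>\<close> 70)
hide_const (open) Finite_Cartesian_Product.vec Finite_Cartesian_Product.mat
  Finite_Cartesian_Product.row Determinants.det
hide_type (open) Finite_Cartesian_Product.vec

text \<open>Each entry of \<open>y = X \<beta> - Y\<close> is hashed twice. The first copy enters, with a random sign, a
  random one of \<open>J\<close> tables of geometrically growing sizes. The second one is sampled at a random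
  level \<open>t\<close> with probability \<open>1 / 2 ^ t\<close>, scaled by \<open>2 ^ t / J\<close>, and enters one further table. The weights
  are constant, so that the sketched loss is a norm, the sum of the absolute values of the buckets.

  An entry of the right size meets a bucket in which it does not cancel in about \<open>J\<close> of the
  tables and levels, so for fixed \<open>y\<close> the sketched norm is at least \<open>(1 - O(1 / J)) * l1_norm y\<close> except with
  exponentially small probability: revealing the entries one by one, the potential
  \<open>exp (- \<theta> F)\<close> of the clipped norm \<open>F\<close> is a supermartingale up to a small error. A union bound
  over a net of the column space of \<open>[X, Y]\<close>, in coordinates of an Auerbach basis, makes this uniform. The entries
  that are too large for this argument are few; in the first variant they are avoided by splitting
  each row into equal parts, and in the second one they hardly collide with each other.

  From above, only the expectation for one \<open>y\<close> is needed. The random signs make the small entries of a bucket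
  mostly cancel, so that an entry contributes in at most \<open>J + w\<close> of the tables and levels, where \<open>2 ^ w\<close> is
  polynomial in \<open>d\<close> and \<open>ln n\<close>. Hence the expectation is at most \<open>(1 + (w + 2) / J) * l1_norm y\<close> outside the event
  that one sampled entry dominates. As the sketched norm is never much below the norm, Markov's
  inequality applies to the small difference. Taking \<open>J\<close> about \<open>c * w\<close> gives the factor \<open>1 + 1 / c\<close> and
  taking it about \<open>w / \<epsilon>\<close> gives \<open>1 + a * \<epsilon>\<close>; the sizes grow like \<open>2 ^ J\<close>.\<close>

text \<open>One count governs both bounds. From below an entry is credited with \<open>J\<close>
  tables and levels, up to a loss of 6; from above it is charged for at most \<open>J + w\<close>.
  The surplus \<open>w\<close> is the logarithm of the gap between the scale from which an entry
  surely survives and the scale below which it surely cancels. It is fixed before \<open>J\<close>,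
  so a larger \<open>J\<close> brings the ratio \<open>(J + w) / J\<close> closer to 1 at the cost
  of \<open>2 ^ J\<close> buckets. This trade is the origin of the exponents \<open>1 + c\<close>
  and \<open>1 + 1 / \<epsilon>\<close>.

  The obstacle from below is that sampled entries are scaled up and have a huge variance. Only a
  lower tail has to be exponentially small, however, and clipping the second table can only decrease
  the norm.

  From above, Markov's inequality for the norm itself would be useless, as its mean is already about
  the target; the guaranteed lower bound has to be subtracted first. In the first variant even the
  remaining margin is small, hence a failure probability that is constant but close to 1.

  If \<open>n\<close> is below the admissible size, or a parameter is so large that the claim
  degenerates, the identity matrix or a matrix without rows is used.\<close>

section \<open>Sketching a stream in one pass\<close>

fun block :: "instr list \<Rightarrow> com" where
  "block [] = Skip"
| "block (i # is) = Seq (Instr i) (block is)"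

lemma exec_block: "exec (block is) s (length is) (fold exec_instr is s)"
proof (induction "is" arbitrary: s)
  case Nil
  then show ?case by (simp add: exec.Skip)
next
  case (Cons i "is")
  have "exec (Seq (Instr i) (block is)) s (1 + length is) (fold exec_instr is (exec_instr i s))"
    by (rule exec.Seq[OF exec.Instr Cons])
  then show ?case by simp
qed

text \<open>Register 7 is the cursor in both tables and register 9 its end; register 1 holds the
  column of the update and real register 0 its value. Register 5 holds the constant 1 for the
  increment. The eight instructions and the loop test make 9 steps per table entry.\<close>

definition add_entry :: com where
  "add_entry = block [NLoad 10 7, NAdd 10 10 1, RLoad 1 7, RMul 1 1 0, RLoad 2 10, RAdd 1 1 2,
     RStore 10 1, NAdd 7 7 5]"

definition sketch_update :: com where
  "sketch_update = Seq (block [NMul 6 0 2, NAdd 7 6 3, NAdd 9 7 2]) (While (NLess 7 9) add_entry)"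

text \<open>Register 2 holds the number \<open>q\<close> of nonzeros per column and register 3 the address 11 of two
  parallel tables. In the table of naturals, entry \<open>i * q + l\<close> is the address of the sketch row
  \<open>h i l\<close>; in the table of reals it is the coefficient \<open>c i l\<close>. The sketch is stored behind the
  tables and has the entries \<open>Z b k\<close>.\<close>

definition sketch_state ::
  "nat \<Rightarrow> nat \<Rightarrow> nat \<Rightarrow> nat \<Rightarrow> (nat \<Rightarrow> nat \<Rightarrow> nat) \<Rightarrow> (nat \<Rightarrow> nat \<Rightarrow> real) \<Rightarrow> (nat \<Rightarrow> nat \<Rightarrow> real) \<Rightarrow> state \<Rightarrow> bool"
  where
  "sketch_state n m q r h c Z s \<longleftrightarrow>
     fst s 2 = q \<and> fst s 3 = 11 \<and> fst s 5 = 1 \<and>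
     (\<forall>i<n. \<forall>l<q. fst s (11 + i * q + l) = 11 + n * q + h i l * m \<and> snd s (11 + i * q + l) = c i l) \<and>
     (\<forall>b<r. \<forall>k<m. snd s (11 + n * q + b * m + k) = Z b k)"

lemma table_index_less:
  assumes "(i::nat) < n" "l < q"
  shows "i * q + l < n * q"
proof -
  have "i * q + l < Suc i * q" using assms(2) by simp
  also have "\<dots> \<le> n * q" using assms(1) by (intro mult_le_mono1) simp
  finally show ?thesis .
qed

lemma table_index_inject:
  assumes "(k::nat) < m" "k' < m"
  shows "b * m + k = b' * m + k' \<longleftrightarrow> b = b' \<and> k = k'"
proof
  assume eq: "b * m + k = b' * m + k'"
  have "b = (b * m + k) div m" "b' = (b' * m + k') div m" using assms by auto
  then show "b = b' \<and> k = k'" using eq by simp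
qed auto

text \<open>\<open>k\<close> counts the table entries of the column that are still to be processed,
  so the sum over \<open>{q-k..<q}\<close> is what remains to be added. \<open>Z\<close> is
  generalized because each iteration changes the sketch.\<close>

lemma add_entry_loop:
  assumes "i < n" "j < m" "\<And>l. l < q \<Longrightarrow> h i l < r"
  shows "\<lbrakk> k \<le> q; sketch_state n m q r h c Z s; fst s 1 = j; snd s 0 = v;
      fst s 7 = 11 + i * q + (q - k); fst s 9 = 11 + i * q + q \<rbrakk> \<Longrightarrow>
    \<exists>s'. exec (While (NLess 7 9) add_entry) s (9 * k + 1) s' \<and>
      sketch_state n m q r h c
        (\<lambda>b j'. Z b j' + (if j' = j then (\<Sum>l\<in>{q-k..<q}. if h i l = b then c i l * v else 0) else 0)) s'"
proof (induction k arbitrary: s Z)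
  case 0
  have "\<not> holds (NLess 7 9) s"
    using 0 by (cases s) auto
  then have "exec (While (NLess 7 9) add_entry) s 1 s"
    by (rule exec.WhileFalse)
  moreover have "sketch_state n m q r h c (\<lambda>b j'. Z b j' + (if j' = j then (\<Sum>l\<in>{q-0..<q}. if h i l = b then c i l * v else 0) else 0)) s"
    using 0 by (simp add: atLeastLessThan_empty cong: if_cong)
  ultimately show ?case by (intro exI[of _ s]) simp
next
  case (Suc k)
  obtain N R where s: "s = (N, R)" by (cases s)
  define l where "l = q - Suc k"
  have l: "l < q" "Suc l = q - k" using Suc.prems(1) by (auto simp: l_def)
  define a where "a = 11 + i * q + l"
  define p where "p = 11 + n * q + h i l * m + j"
  have N7: "N 7 = a" using Suc.prems(5) by (simp add: s a_def l_def)
  have Na: "N a = 11 + n * q + h i l * m" and Ra: "R a = c i l"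
    using Suc.prems(2) assms(1) l(1) by (auto simp: sketch_state_def s a_def)
  have regs: "N 2 = q" "N 3 = 11" "N 5 = 1" "N 1 = j" "N 9 = 11 + i * q + q" "R 0 = v"
    using Suc.prems by (auto simp: sketch_state_def s)
  \<comment> \<open>Reals below address \<open>11 + n * q\<close> are coefficients and the sketch
    starts there; both lie above the scratch registers. Hence the store at \<open>p\<close> leaves
    the coefficients intact.\<close>
  have a11: "a \<ge> 11" "a < 11 + n * q" using table_index_less[OF assms(1) l(1)] by (auto simp: a_def)
  have p11: "p \<ge> 11 + n * q" by (simp add: p_def)
  define N' where "N' = N(10 := p, 7 := a + 1)"
  define R1 where "R1 = R(1 := c i l * v + R p, 2 := R p)"
  define R' where "R' = R1(p := c i l * v + R p)"
  have step: "fold exec_instr [NLoad 10 7, NAdd 10 10 1, RLoad 1 7, RMul 1 1 0, RLoad 2 10, RAdd 1 1 2,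
     RStore 10 1, NAdd 7 7 5] s = (N', R')"
    using a11 p11 regs N7 Na Ra
    by (auto simp: s N'_def R'_def R1_def p_def fun_eq_iff)
  have ex: "exec add_entry s 8 (N', R')"
    using exec_block[of "[NLoad 10 7, NAdd 10 10 1, RLoad 1 7, RMul 1 1 0, RLoad 2 10, RAdd 1 1 2,
     RStore 10 1, NAdd 7 7 5]" s] unfolding step add_entry_def
    by (simp del: block.simps add: numeral_eq_Suc)
  define Z1 where "Z1 = (\<lambda>b j'. Z b j' + (if j' = j \<and> h i l = b then c i l * v else 0))"
  have st': "sketch_state n m q r h c Z1 (N', R')"
    unfolding sketch_state_def
  proof (intro conjI allI impI)
    fix i' l' assume il: "i' < n" "l' < q"
    have lt: "11 + i' * q + l' < 11 + n * q" using table_index_less[OF il] by simp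
    show "fst (N', R') (11 + i' * q + l') = 11 + n * q + h i' l' * m"
      using Suc.prems(2) il by (simp add: N'_def sketch_state_def s)
    have ne: "11 + i' * q + l' \<noteq> p" using lt p11 by linarith
    show "snd (N', R') (11 + i' * q + l') = c i' l'"
      using Suc.prems(2) il ne by (simp add: R'_def R1_def sketch_state_def s)
  next
    fix b k' assume b: "b < r" "k' < m"
    have "11 + n * q + b * m + k' = p \<longleftrightarrow> b = h i l \<and> k' = j"
      using table_index_inject[OF b(2) assms(2), of b "h i l"] by (auto simp: p_def)
    moreover have "R p = Z (h i l) j"
      using Suc.prems(2) assms(2) assms(3)[OF l(1)] by (simp add: sketch_state_def s p_def)
    ultimately show "snd (N', R') (11 + n * q + b * m + k') = Z1 b k'"
      using Suc.prems(2) b by (auto simp: R'_def R1_def Z1_def sketch_state_def s)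
  qed (use regs in \<open>auto simp: N'_def\<close>)
  have "\<exists>s'. exec (While (NLess 7 9) add_entry) (N', R') (9 * k + 1) s' \<and>
      sketch_state n m q r h c
        (\<lambda>b j'. Z1 b j' + (if j' = j then (\<Sum>l\<in>{q-k..<q}. if h i l = b then c i l * v else 0) else 0)) s'"
    using Suc.prems(1) l(2) regs p11
    by (intro Suc.IH[OF _ st']) (auto simp: N'_def R'_def R1_def a_def)
  then obtain s' where s': "exec (While (NLess 7 9) add_entry) (N', R') (9 * k + 1) s'"
    and st: "sketch_state n m q r h c
        (\<lambda>b j'. Z1 b j' + (if j' = j then (\<Sum>l\<in>{q-k..<q}. if h i l = b then c i l * v else 0) else 0)) s'"
    by blast
  have "holds (NLess 7 9) s"
    using N7 regs l(1) by (simp add: s a_def)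
  from exec.WhileTrue[OF this ex s'] have "exec (While (NLess 7 9) add_entry) s (9 * Suc k + 1) s'"
    by (simp add: ac_simps)
  moreover have "{q - Suc k..<q} = insert l {q-k..<q}" "l \<notin> {q-k..<q}"
    using l by (auto simp: l_def)
  then have "(\<lambda>b j'. Z1 b j' + (if j' = j then (\<Sum>l\<in>{q-k..<q}. if h i l = b then c i l * v else 0) else 0)) =
     (\<lambda>b j'. Z b j' + (if j' = j then (\<Sum>l\<in>{q-Suc k..<q}. if h i l = b then c i l * v else 0) else 0))"
    by (auto simp: Z1_def fun_eq_iff)
  ultimately show ?case using st by (intro exI[of _ s'] conjI) (simp_all only:)
qed

lemma sketch_update_correct:
  assumes "i < n" "j < m" "\<And>l. l < q \<Longrightarrow> h i l < r" "sketch_state n m q r h c Z s"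
  shows "\<exists>s'. exec sketch_update (read_update (i, j, v) s) (9 * q + 4) s' \<and>
      sketch_state n m q r h c
        (\<lambda>b j'. Z b j' + (if j' = j then (\<Sum>l<q. if h i l = b then c i l * v else 0) else 0)) s'"
proof -
  obtain N R where s: "s = (N, R)" by (cases s)
  have regs: "N 2 = q" "N 3 = 11" "N 5 = 1"
    using assms(4) by (auto simp: sketch_state_def s)
  define s1 where "s1 = fold exec_instr [NMul 6 0 2, NAdd 7 6 3, NAdd 9 7 2] (read_update (i, j, v) s)"
  have s1: "s1 = (N(0 := i, 1 := j, 6 := i * q, 7 := i * q + 11, 9 := i * q + 11 + q), R(0 := v))"
    using regs by (simp add: s1_def s fun_eq_iff)
  have "sketch_state n m q r h c Z s1"
    using assms(4) by (auto simp: sketch_state_def s s1)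
  then have "\<exists>s'. exec (While (NLess 7 9) add_entry) s1 (9 * q + 1) s' \<and>
      sketch_state n m q r h c
        (\<lambda>b j'. Z b j' + (if j' = j then (\<Sum>l\<in>{q-q..<q}. if h i l = b then c i l * v else 0) else 0)) s'"
    by (intro add_entry_loop assms) (auto simp: s1)
  then obtain s' where s': "exec (While (NLess 7 9) add_entry) s1 (9 * q + 1) s'"
    "sketch_state n m q r h c
        (\<lambda>b j'. Z b j' + (if j' = j then (\<Sum>l<q. if h i l = b then c i l * v else 0) else 0)) s'"
    unfolding diff_self_eq_0 lessThan_atLeast0[symmetric] by blast
  have "exec (block [NMul 6 0 2, NAdd 7 6 3, NAdd 9 7 2]) (read_update (i, j, v) s) 3 s1"
    using exec_block[of "[NMul 6 0 2, NAdd 7 6 3, NAdd 9 7 2]" "read_update (i, j, v) s"]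
    unfolding s1_def[symmetric] by (simp del: block.simps add: numeral_eq_Suc)
  from exec.Seq[OF this s'(1)] have "exec sketch_update (read_update (i, j, v) s) (9 * q + 4) s'"
    by (simp del: block.simps add: sketch_update_def ac_simps)
  with s'(2) show ?thesis by blast
qed

lemma one_pass_sketch_update:
  assumes "turnstile_stream n m us" "\<And>i l. i < n \<Longrightarrow> l < q \<Longrightarrow> h i l < r"
    "sketch_state n m q r h c Z s"
  shows "\<exists>s'. one_pass sketch_update us s (length us * (9 * q + 5)) s' \<and>
      sketch_state n m q r h c
        (\<lambda>b k. Z b k + (\<Sum>(i, j, v)\<leftarrow>us. if j = k then (\<Sum>l<q. if h i l = b then c i l * v else 0) else 0)) s'"
  using assms(1,3)
proof (induction us arbitrary: s Z)
  case Nil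
  then show ?case by (intro exI[of _ s]) (simp add: one_pass.Nil)
next
  case (Cons u us)
  obtain i j v where u: "u = (i, j, v)" by (cases u)
  have ij: "i < n" "j < m" and us: "turnstile_stream n m us"
    using Cons.prems by (auto simp: turnstile_stream_def u)
  obtain s1 where s1: "exec sketch_update (read_update u s) (9 * q + 4) s1"
    "sketch_state n m q r h c
        (\<lambda>b j'. Z b j' + (if j' = j then (\<Sum>l<q. if h i l = b then c i l * v else 0) else 0)) s1"
    using sketch_update_correct[OF ij assms(2)[OF ij(1)] Cons.prems(2), of v] unfolding u by blast
  obtain s2 where s2: "one_pass sketch_update us s1 (length us * (9 * q + 5)) s2"
   "sketch_state n m q r h c
        (\<lambda>b k. (Z b k + (if k = j then (\<Sum>l<q. if h i l = b then c i l * v else 0) else 0)) +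
          (\<Sum>(i, j, v)\<leftarrow>us. if j = k then (\<Sum>l<q. if h i l = b then c i l * v else 0) else 0)) s2"
    using Cons.IH[OF us s1(2)] by blast
  have "one_pass sketch_update (u # us) s (1 + (9 * q + 4) + length us * (9 * q + 5)) s2"
    by (rule one_pass.Cons[OF s1(1) s2(1)])
  moreover have "(\<lambda>b k. (Z b k + (if k = j then (\<Sum>l<q. if h i l = b then c i l * v else 0) else 0)) +
          (\<Sum>(i, j, v)\<leftarrow>us. if j = k then (\<Sum>l<q. if h i l = b then c i l * v else 0) else 0)) =
       (\<lambda>b k. Z b k + (\<Sum>(i, j, v)\<leftarrow>(u # us). if j = k then (\<Sum>l<q. if h i l = b then c i l * v else 0) else 0))"
    by (auto simp: u fun_eq_iff)
  ultimately show ?case using s2(2) by (intro exI[of _ s2]) (auto simp: algebra_simps)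
qed

text \<open>The sum matters when several of the \<open>q\<close> rows chosen for a column coincide:
  their coefficients add up, just as the contributions of the program do.\<close>

definition column_matrix :: "nat \<Rightarrow> nat \<Rightarrow> nat \<Rightarrow> (nat \<Rightarrow> nat \<Rightarrow> nat) \<Rightarrow> (nat \<Rightarrow> nat \<Rightarrow> real) \<Rightarrow> real mat" where
  "column_matrix r n q h c = mat r n (\<lambda>(b, i). \<Sum>l<q. if h i l = b then c i l else 0)"

lemma column_matrix_times_stream:
  assumes "turnstile_stream n m us" "b < r" "k < m"
  shows "(column_matrix r n q h c * stream_mat n m us) $$ (b, k) =
    (\<Sum>(i, j, v)\<leftarrow>us. if j = k then (\<Sum>l<q. if h i l = b then c i l * v else 0) else 0)"
proof -
  let ?S = "\<lambda>i. \<Sum>l<q. if h i l = b then c i l else 0"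
  have "(column_matrix r n q h c * stream_mat n m us) $$ (b, k) =
     (\<Sum>i<n. ?S i * (\<Sum>(i', j', v)\<leftarrow>us. if i' = i \<and> j' = k then v else 0))"
    using assms by (simp add: column_matrix_def stream_mat_def scalar_prod_def lessThan_atLeast0)
  also have "\<dots> = (\<Sum>(i, j, v)\<leftarrow>us. if j = k then ?S i * v else 0)"
    using assms(1)
  proof (induction us)
    case Nil
    then show ?case by simp
  next
    case (Cons u us)
    obtain i' j' v where u: "u = (i', j', v)" by (cases u)
    have i': "i' < n" and us: "turnstile_stream n m us"
      using Cons.prems by (auto simp: turnstile_stream_def u)
    have "(\<Sum>i<n. ?S i * (if i' = i \<and> j' = k then v else 0)) = (\<Sum>i<n. if i' = i then (if j' = k then ?S i * v else 0) else 0)"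
      by (intro sum.cong) auto
    also have "\<dots> = (if j' = k then ?S i' * v else 0)"
      using i' by (simp add: sum.delta)
    finally show ?case
      using Cons.IH[OF us] by (simp add: u algebra_simps sum.distrib)
  qed
  also have "\<dots> = (\<Sum>(i, j, v)\<leftarrow>us. if j = k then (\<Sum>l<q. if h i l = b then c i l * v else 0) else 0)"
    by (intro arg_cong[of _ _ sum_list] map_cong)
       (auto simp: sum_distrib_right intro!: sum.cong)
  finally show ?thesis .
qed

lemma stream_computes_column_matrix:
  assumes "\<And>i l. i < n \<Longrightarrow> l < q \<Longrightarrow> h i l < r" "9 * real q + 5 \<le> \<tau>"
  shows "stream_computes sketch_update (column_matrix r n q h c) m \<tau>"
proof -
  let ?S = "column_matrix r n q h c"
  have dim: "dim_col ?S = n" by (simp add: column_matrix_def)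
  \<comment> \<open>Division and remainder by \<open>q\<close> invert the table index
    \<open>i * q + l\<close>, which gives the initial memory in closed form.\<close>
  define N :: "nat \<Rightarrow> nat" where
    "N = (\<lambda>a. if a = 2 then q else if a = 3 then 11 else if a = 5 then 1
        else 11 + n * q + h ((a - 11) div q) ((a - 11) mod q) * m)"
  define R where
    "R = (\<lambda>a. if a < 11 + n * q then c ((a - 11) div q) ((a - 11) mod q) else 0)"
  have init: "sketch_state n m q r h c (\<lambda>_ _. 0) (N, R)"
    unfolding sketch_state_def N_def R_def
    by (auto dest: table_index_less)
  show ?thesis
    unfolding stream_computes_def
  proof (rule exI[of _ "(N, R)"], rule exI[of _ "11 + n * q"], intro allI impI)
    fix us assume "turnstile_stream (dim_col ?S) m us"
    then have us: "turnstile_stream n m us" by (simp add: column_matrix_def)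
    obtain s where s: "one_pass sketch_update us (N, R) (length us * (9 * q + 5)) s"
      "sketch_state n m q r h c
        (\<lambda>b k. 0 + (\<Sum>(i, j, v)\<leftarrow>us. if j = k then (\<Sum>l<q. if h i l = b then c i l * v else 0) else 0)) s"
      using one_pass_sketch_update[OF us assms(1) init] by blast
    have "stored_at (11 + n * q) (?S * stream_mat n m us) s"
      unfolding stored_at_def
    proof (intro allI impI)
      fix i j assume "i < dim_row (?S * stream_mat n m us)" "j < dim_col (?S * stream_mat n m us)"
      then have ij: "i < r" "j < m" by (auto simp: column_matrix_def stream_mat_def)
      show "snd s (11 + n * q + i * dim_col (?S * stream_mat n m us) + j) = (?S * stream_mat n m us) $$ (i, j)"
        unfolding column_matrix_times_stream[OF us ij]
        using s(2) ij by (auto simp: sketch_state_def stream_mat_def)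
    qed
    moreover have "real (length us * (9 * q + 5)) \<le> \<tau> * real (nnz (stream_mat n m us) + excess_updates n m us)"
    proof -
      have "real (length us * (9 * q + 5)) = (9 * real q + 5) * real (length us)" by simp
      \<comment> \<open>\<open>excess_updates\<close> is a truncated difference, so together with
        \<open>nnz\<close> it is at least \<open>length us\<close> in every case.\<close>
      also have "\<dots> \<le> \<tau> * real (nnz (stream_mat n m us) + excess_updates n m us)"
        using assms(2) by (intro mult_mono) (auto simp: excess_updates_def)
      finally show ?thesis .
    qed
    ultimately show "let A = stream_mat (dim_col ?S) m us in
        \<exists>t s. one_pass sketch_update us (N, R) t s \<and> stored_at (11 + n * q) (?S * A) s \<and>
          real t \<le> \<tau> * real (nnz A + excess_updates (dim_col ?S) m us)"
      using s(1) unfolding Let_def dim by (intro exI[of _ "length us * (9 * q + 5)"] exI[of _ s] conjI)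
  qed
qed

section \<open>Bases of bounded coordinates\<close>

text \<open>Gaussian elimination with points of \<open>I\<close> as pivots. At a node the value of a
  combination is one of its coefficients, so the norm of a combination bounds its coefficients; this
  makes the unit ball bounded in these coordinates.\<close>

lemma interpolation_basis:
  fixes f :: "nat \<Rightarrow> 'i \<Rightarrow> real"
  shows "\<exists>m\<le>k. \<exists>h pts. (\<forall>a<m. pts a \<in> I) \<and>
    (\<forall>a<m. \<forall>b<m. h a (pts b) = (if a = b then 1 else 0 :: real)) \<and>
    (\<forall>c. \<exists>e. \<forall>i\<in>I. (\<Sum>a<k. c a * f a i) = (\<Sum>a<m. e a * h a i))"
proof (induction k)
  case 0
  then show ?case by (auto intro!: exI[of _ 0])
next
  case (Suc k)
  then obtain m h pts where m: "m \<le> k" and pts: "\<forall>a<m. pts a \<in> I"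
    and dual: "\<forall>a<m. \<forall>b<m. h a (pts b) = (if a = b then 1 else 0 :: real)"
    and span: "\<forall>c. \<exists>e. \<forall>i\<in>I. (\<Sum>a<k. c a * f a i) = (\<Sum>a<m. e a * h a i)"
    by blast
  \<comment> \<open>The residual of interpolating \<open>f k\<close> at the nodes. If it vanishes on
    \<open>I\<close>, then \<open>f k\<close> is dependent; otherwise a point where it does not
    vanish is the next node.\<close>
  define g where "g i = f k i - (\<Sum>a<m. f k (pts a) * h a i)" for i
  have g0: "g (pts b) = 0" if "b < m" for b
  proof -
    have "(\<Sum>a<m. f k (pts a) * h a (pts b)) = (\<Sum>a<m. if a = b then f k (pts a) else 0)"
      using dual that by (intro sum.cong) auto
    then show ?thesis using that by (simp add: g_def)
  qed
  show ?case
  proof (cases "\<forall>i\<in>I. g i = 0")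
    case True
    have "\<exists>e. \<forall>i\<in>I. (\<Sum>a<Suc k. c a * f a i) = (\<Sum>a<m. e a * h a i)" for c
    proof -
      obtain e where e: "\<forall>i\<in>I. (\<Sum>a<k. c a * f a i) = (\<Sum>a<m. e a * h a i)" using span by blast
      have "\<forall>i\<in>I. (\<Sum>a<Suc k. c a * f a i) = (\<Sum>a<m. (e a + c k * f k (pts a)) * h a i)"
      proof
        fix i assume i: "i \<in> I"
        have "f k i = (\<Sum>a<m. f k (pts a) * h a i)" using True i by (simp add: g_def)
        then show "(\<Sum>a<Suc k. c a * f a i) = (\<Sum>a<m. (e a + c k * f k (pts a)) * h a i)"
          using e i by (simp add: algebra_simps sum.distrib sum_distrib_left)
      qed
      then show ?thesis by (rule exI[of _ "\<lambda>a. e a + c k * f k (pts a)"])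
    qed
    then show ?thesis using m pts dual by (intro exI[of _ m] conjI exI[of _ h] exI[of _ pts]) (auto intro: le_SucI)
  next
    case False
    then obtain p where p: "p \<in> I" "g p \<noteq> 0" by blast
    define w where "w i = g i / g p" for i
    define h' where "h' a i = (if a < m then h a i - h a p * w i else w i)" for a i
    define pts' where "pts' = pts(m := p)"
    have w: "w p = 1" "\<And>b. b < m \<Longrightarrow> w (pts b) = 0" using p g0 by (auto simp: w_def)
    have dual': "\<forall>a<Suc m. \<forall>b<Suc m. h' a (pts' b) = (if a = b then 1 else 0 :: real)"
      using dual w by (auto simp: h'_def pts'_def less_Suc_eq)
    have span': "\<exists>e. \<forall>i\<in>I. (\<Sum>a<Suc k. c a * f a i) = (\<Sum>a<Suc m. e a * h' a i)" for c
    proof -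
      obtain e where e: "\<forall>i\<in>I. (\<Sum>a<k. c a * f a i) = (\<Sum>a<m. e a * h a i)" using span by blast
      define e1 where "e1 a = e a + c k * f k (pts a)" for a
      define e' where "e' a = (if a < m then e1 a else (\<Sum>a<m. e1 a * h a p) + c k * g p)" for a
      have "\<forall>i\<in>I. (\<Sum>a<Suc k. c a * f a i) = (\<Sum>a<Suc m. e' a * h' a i)"
      proof
        fix i assume i: "i \<in> I"
        have "f k i = (\<Sum>a<m. f k (pts a) * h a i) + g p * w i" using p by (simp add: g_def w_def)
        then have 1: "(\<Sum>a<Suc k. c a * f a i) = (\<Sum>a<m. e1 a * h a i) + c k * g p * w i"
          using e i by (simp add: e1_def algebra_simps sum.distrib sum_distrib_left)
        have "(\<Sum>a<Suc m. e' a * h' a i) = (\<Sum>a<m. e1 a * (h a i - h a p * w i)) +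
            ((\<Sum>a<m. e1 a * h a p) + c k * g p) * w i"
          by (simp add: e'_def h'_def)
        also have "\<dots> = (\<Sum>a<m. e1 a * h a i) + c k * g p * w i"
          by (simp add: algebra_simps sum_subtractf sum_distrib_left)
        finally show "(\<Sum>a<Suc k. c a * f a i) = (\<Sum>a<Suc m. e' a * h' a i)" using 1 by simp
      qed
      then show ?thesis by blast
    qed
    have "\<forall>a<Suc m. pts' a \<in> I" using pts p by (auto simp: pts'_def)
    then show ?thesis using m dual' span' by (intro exI[of _ "Suc m"] conjI exI[of _ h'] exI[of _ pts']) auto
  qed
qed

text \<open>Only the finiteness of the bound matters: it makes the supremum of the volumes
  exist.\<close>

lemma abs_det_le_fact:
  assumes "A \<in> carrier_mat m m" "\<And>i j. i < m \<Longrightarrow> j < m \<Longrightarrow> \<bar>A $$ (i, j) :: real\<bar> \<le> 1"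
  shows "\<bar>det A\<bar> \<le> fact m"
proof -
  have "\<bar>det A\<bar> \<le> (\<Sum>p | p permutes {0..<m}. \<bar>signof p * (\<Prod>i = 0..<m. A $$ (i, p i))\<bar>)"
    using assms(1) by (simp add: det_def sum_abs)
  also have "\<dots> \<le> (\<Sum>p | p permutes {0..<m}. 1)"
  proof (intro sum_mono)
    fix p assume "p \<in> {p. p permutes {0..<m}}"
    then have p: "p i < m" if "i < m" for i using that permutes_in_image[of p "{0..<m}" i] by auto
    have "\<bar>signof p * (\<Prod>i = 0..<m. A $$ (i, p i))\<bar> = (\<Prod>i = 0..<m. \<bar>A $$ (i, p i)\<bar>)"
      by (simp add: abs_mult abs_prod sign_def)
    also have "\<dots> \<le> 1" using assms(2) p by (intro prod_le_1) auto
    finally show "\<bar>signof p * (\<Prod>i = 0..<m. A $$ (i, p i))\<bar> \<le> 1" .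
  qed
  also have "\<dots> = fact m" by (simp add: card_permutations)
  finally show ?thesis .
qed

text \<open>An Auerbach basis up to a factor of 2. It nearly maximizes the volume of the parallelepiped
  spanned by \<open>m\<close> vectors of the unit ball, so that no coefficient can be larger than 2 by
  Cramer's rule.\<close>

lemma near_auerbach_basis:
  fixes f :: "nat \<Rightarrow> 'i \<Rightarrow> real"
  assumes "finite I"
  shows "\<exists>m\<le>k. \<exists>u. (\<forall>a<m. (\<Sum>i\<in>I. \<bar>u a i\<bar>) \<le> 1) \<and>
    (\<forall>e. \<forall>a<m. \<bar>e a\<bar> \<le> 2 * (\<Sum>i\<in>I. \<bar>\<Sum>b<m. e b * u b i\<bar>)) \<and>
    (\<forall>c. \<exists>e. \<forall>i\<in>I. (\<Sum>a<k. c a * f a i) = (\<Sum>a<m. e a * u a i))"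
proof -
  obtain m h pts where m: "m \<le> k" and pts: "\<forall>a<m. pts a \<in> I"
    and dual: "\<forall>a<m. \<forall>b<m. h a (pts b) = (if a = b then 1 else 0 :: real)"
    and span: "\<forall>c. \<exists>e. \<forall>i\<in>I. (\<Sum>a<k. c a * f a i) = (\<Sum>a<m. e a * h a i)"
    using interpolation_basis[of k I f] by blast
  define N where "N v = (\<Sum>i\<in>I. \<bar>\<Sum>b<m. v b * h b i\<bar>)" for v
  have N_ge: "\<bar>v b\<bar> \<le> N v" if "b < m" for v b
  proof -
    have "(\<Sum>a<m. v a * h a (pts b)) = (\<Sum>a<m. if a = b then v a else 0)"
      using dual that by (intro sum.cong) auto
    then have "v b = (\<Sum>a<m. v a * h a (pts b))" using that by simp
    also have "\<bar>\<dots>\<bar> \<le> N v"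
      unfolding N_def using assms pts that by (intro member_le_sum) auto
    finally show ?thesis .
  qed
  have N_scale: "N (\<lambda>b. t * v b) = \<bar>t\<bar> * N v" for t v
    by (simp add: N_def sum_distrib_left mult.assoc flip: abs_mult)
  have N_nonneg: "N v \<ge> 0" for v by (simp add: N_def sum_nonneg)
  have N_cong: "N v = N w" if "\<And>b. b < m \<Longrightarrow> v b = w b" for v w
    using that by (simp add: N_def)
  define A where "A G = mat m m (\<lambda>(i, j). G j i)" for G :: "nat \<Rightarrow> nat \<Rightarrow> real"
  define S where "S = (\<lambda>G. \<bar>det (A G)\<bar>) ` {G. \<forall>a<m. N (G a) \<le> 1}"
  have bdd: "bdd_above S"
  proof (rule bdd_aboveI)
    fix x assume "x \<in> S"
    then obtain G where G: "\<forall>a<m. N (G a) \<le> 1" "x = \<bar>det (A G)\<bar>" by (auto simp: S_def)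
    have "\<bar>G j i\<bar> \<le> 1" if "i < m" "j < m" for i j
      using N_ge[OF that(1), of "G j"] G(1) that by force
    then show "x \<le> fact m" unfolding G(2) by (intro abs_det_le_fact) (auto simp: A_def)
  qed
  define \<delta> where "\<delta> a b = (if a = b then 1 else 0 :: real)" for a b :: nat
  \<comment> \<open>Scaling the coordinate vectors by \<open>t\<close> brings them into the unit
    ball, so that \<open>Sup S\<close> is positive. The summand 1 keeps the denominator positive for
    \<open>m = 0\<close>.\<close>
  define t where "t = 1 / (1 + (\<Sum>a<m. N (\<delta> a)))"
  have t: "t > 0" using N_nonneg by (auto simp: t_def add_pos_nonneg sum_nonneg)
  have "N (\<lambda>b. t * \<delta> a b) \<le> 1" if "a < m" for a
  proof -
    have "N (\<delta> a) \<le> (\<Sum>a<m. N (\<delta> a))" using that N_nonneg by (intro member_le_sum) auto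
    moreover have "(\<Sum>a<m. N (\<delta> a)) \<ge> 0" using N_nonneg by (simp add: sum_nonneg)
    ultimately show ?thesis using t unfolding N_scale by (simp add: t_def field_simps)
  qed
  then have "\<bar>det (A (\<lambda>a b. t * \<delta> a b))\<bar> \<in> S" by (auto simp: S_def)
  moreover have "A (\<lambda>a b. t * \<delta> a b) = t \<cdot>\<^sub>m 1\<^sub>m m"
    by (auto simp: A_def \<delta>_def)
  then have "\<bar>det (A (\<lambda>a b. t * \<delta> a b))\<bar> > 0" using t by (simp add: det_smult)
  ultimately have "Sup S > 0" using bdd cSup_upper[OF _ bdd] by fastforce
  then have "Sup S / 2 < Sup S" by simp
  \<comment> \<open>A volume above half of the supremum replaces an exact maximizer. This avoids a
    compactness argument and costs the factor 2.\<close>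
  then obtain x where x: "x \<in> S" "Sup S / 2 < x"
    using less_cSupD[of S] \<open>\<bar>det (A (\<lambda>a b. t * \<delta> a b))\<bar> \<in> S\<close> by blast
  then obtain G where G: "\<forall>a<m. N (G a) \<le> 1" "x = \<bar>det (A G)\<bar>" by (auto simp: S_def)
  have detG: "\<bar>det (A G)\<bar> > 0" "Sup S \<le> 2 * \<bar>det (A G)\<bar>"
    using x G(2) \<open>Sup S > 0\<close> by auto
  have coeff_le: "\<bar>e a\<bar> \<le> 2 * N (\<lambda>b. \<Sum>a<m. e a * G a b)" if a: "a < m" for e a
  proof (rule field_le_epsilon)
    \<comment> \<open>As \<open>N v\<close> may be 0, the combination \<open>v\<close> is divided by
      slightly more than its norm.\<close>
    fix \<epsilon> :: real assume "\<epsilon> > 0"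
    define v where "v b = (\<Sum>a<m. e a * G a b)" for b
    define t where "t = N v + \<epsilon> / 2"
    have t: "t > 0" "N v \<le> t" using \<open>\<epsilon> > 0\<close> N_nonneg[of v] by (auto simp: t_def add_nonneg_pos)
    define G' where "G' = G(a := (\<lambda>b. (1 / t) * v b))"
    have "N (G' c) \<le> 1" if "c < m" for c
    proof (cases "c = a")
      case True
      then have "N (G' c) = 1 / t * N v" using t by (simp add: G'_def N_scale del: times_divide_eq_left mult_1_left)
      also have "\<dots> \<le> 1" using t by simp
      finally show ?thesis .
    next
      case False
      then show ?thesis using G(1) that by (simp add: G'_def)
    qed
    then have "\<bar>det (A G')\<bar> \<in> S" by (auto simp: S_def)
    then have le: "\<bar>det (A G')\<bar> \<le> 2 * \<bar>det (A G)\<bar>" using cSup_upper[OF _ bdd] detG(2) by fastforce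
    have "A G *\<^sub>v vec m (\<lambda>j. e j / t) = vec m (\<lambda>b. v b / t)"
      by (intro eq_vecI) (auto simp: A_def scalar_prod_def v_def sum_divide_distrib lessThan_atLeast0 mult.commute intro!: sum.cong)
    \<comment> \<open>Replacing \<open>G a\<close> by the normalized combination multiplies the
      determinant by \<open>e a / t\<close>. This factor is at most 2 in absolute value, as the new
      vectors still lie in the unit ball.\<close>
    then have "A G' = replace_col (A G) (A G *\<^sub>v vec m (\<lambda>j. e j / t)) a"
      by (auto simp: A_def G'_def replace_col_def)
    then have "det (A G') = (e a / t) * det (A G)"
      using cramer_lemma_mat[of "A G" m "vec m (\<lambda>j. e j / t)" a] a by (simp add: A_def)
    then have "\<bar>e a\<bar> / t * \<bar>det (A G)\<bar> \<le> 2 * \<bar>det (A G)\<bar>" using le t by (simp add: abs_mult)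
    then have "\<bar>e a\<bar> / t \<le> 2" using detG(1) mult_le_cancel_right_pos by blast
    then show "\<bar>e a\<bar> \<le> 2 * N (\<lambda>b. \<Sum>a<m. e a * G a b) + \<epsilon>"
      using t unfolding v_def[symmetric] by (simp add: field_simps t_def)
  qed
  define u where "u a i = (\<Sum>b<m. G a b * h b i)" for a i
  have comb: "(\<Sum>a<m. e a * u a i) = (\<Sum>b<m. (\<Sum>a<m. e a * G a b) * h b i)" for e i
    unfolding u_def sum_distrib_left sum_distrib_right
    by (subst sum.swap) (simp add: mult.assoc)
  have "(\<Sum>i\<in>I. \<bar>u a i\<bar>) \<le> 1" if "a < m" for a using G(1) that by (simp add: N_def u_def)
  moreover have "\<bar>e a\<bar> \<le> 2 * (\<Sum>i\<in>I. \<bar>\<Sum>b<m. e b * u b i\<bar>)" if "a < m" for e a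
    using coeff_le[OF that, of e] unfolding N_def comb .
  moreover have "\<exists>e. \<forall>i\<in>I. (\<Sum>a<k. c a * f a i) = (\<Sum>a<m. e a * u a i)" for c
  proof -
    obtain c' where c': "\<forall>i\<in>I. (\<Sum>a<k. c a * f a i) = (\<Sum>a<m. c' a * h a i)" using span by blast
    have AG: "A G \<in> carrier_mat m m" by (simp add: A_def)
    \<comment> \<open>The adjugate solves for the coordinates with respect to \<open>G\<close>,
      whose determinant is nonzero.\<close>
    define x where "x = (1 / det (A G)) \<cdot>\<^sub>v (adj_mat (A G) *\<^sub>v vec m c')"
    have x: "x \<in> carrier_vec m" using adj_mat(1)[OF AG] by (simp add: x_def)
    have "A G *\<^sub>v x = (1 / det (A G)) \<cdot>\<^sub>v (A G *\<^sub>v (adj_mat (A G) *\<^sub>v vec m c'))"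
      unfolding x_def using adj_mat(1)[OF AG] AG by (intro mult_mat_vec) auto
    also have "A G *\<^sub>v (adj_mat (A G) *\<^sub>v vec m c') = (A G * adj_mat (A G)) *\<^sub>v vec m c'"
      using adj_mat(1)[OF AG] AG by (simp add: assoc_mult_mat_vec[of _ m m _ m])
    also have "\<dots> = det (A G) \<cdot>\<^sub>v vec m c'"
      using adj_mat(2)[OF AG] by auto
    finally have "A G *\<^sub>v x = vec m c'" using detG(1) by auto
    then have "c' b = (\<Sum>a<m. x $ a * G a b)" if "b < m" for b
    proof -
      have "c' b = (A G *\<^sub>v x) $ b" using \<open>A G *\<^sub>v x = vec m c'\<close> that by simp
      also have "\<dots> = (\<Sum>a<m. x $ a * G a b)"
        using that x by (auto simp: A_def scalar_prod_def lessThan_atLeast0 mult.commute intro!: sum.cong)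
      finally show ?thesis .
    qed
    then have "\<forall>i\<in>I. (\<Sum>a<k. c a * f a i) = (\<Sum>a<m. (x $ a) * u a i)"
      using c' by (simp add: comb)
    then show ?thesis by blast
  qed
  ultimately show ?thesis using m by blast
qed

section \<open>Random moves\<close>

lemma expectation_mono:
  fixes f g :: "'a \<Rightarrow> real"
  assumes "finite (set_pmf p)" "\<And>x. x \<in> set_pmf p \<Longrightarrow> f x \<le> g x"
  shows "measure_pmf.expectation p f \<le> measure_pmf.expectation p g"
  using assms by (intro integral_mono_AE integrable_measure_pmf_finite) (auto simp: AE_measure_pmf_iff)

lemma expectation_bind:
  fixes f :: "'a \<Rightarrow> real"
  assumes "finite (set_pmf p)" "\<And>x. x \<in> set_pmf p \<Longrightarrow> finite (set_pmf (q x))"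
  shows "measure_pmf.expectation (bind_pmf p q) f = measure_pmf.expectation p (\<lambda>x. measure_pmf.expectation (q x) f)"
proof -
  have "measure_pmf.expectation p (\<lambda>x. measure_pmf.expectation (q x) f) =
      (\<Sum>a\<in>set_pmf p. pmf p a *\<^sub>R measure_pmf.expectation (q a) f)"
    using assms(1) by (intro integral_measure_pmf) auto
  then show ?thesis using pmf_expectation_bind[of "set_pmf p" q p f] assms by simp
qed

lemma expectation_cong:
  fixes f g :: "'a \<Rightarrow> real"
  assumes "\<And>x. x \<in> set_pmf p \<Longrightarrow> f x = g x"
  shows "measure_pmf.expectation p f = measure_pmf.expectation p g"
  using assms by (intro integral_cong_AE) (auto simp: AE_measure_pmf_iff)

lemma expectation_linear:
  fixes f g :: "'a \<Rightarrow> real"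
  assumes "finite (set_pmf p)"
  shows "measure_pmf.expectation p (\<lambda>x. c * f x + d * g x) =
    c * measure_pmf.expectation p f + d * measure_pmf.expectation p g"
  by (subst Bochner_Integration.integral_add) (auto intro: integrable_measure_pmf_finite assms)

lemma expectation_sum:
  fixes f :: "'b \<Rightarrow> 'a \<Rightarrow> real"
  assumes "finite (set_pmf p)"
  shows "measure_pmf.expectation p (\<lambda>x. \<Sum>i\<in>A. f i x) = (\<Sum>i\<in>A. measure_pmf.expectation p (f i))"
  by (subst Bochner_Integration.integral_sum) (auto intro: integrable_measure_pmf_finite assms)

lemma prob_le_expectation:
  assumes "finite (set_pmf p)" "\<And>x. x \<in> set_pmf p \<Longrightarrow> 0 \<le> f x"
    "\<And>x. x \<in> set_pmf p \<Longrightarrow> x \<in> A \<Longrightarrow> 1 \<le> f x"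
  shows "measure_pmf.prob p A \<le> measure_pmf.expectation p f"
proof -
  have "measure_pmf.prob p A = measure_pmf.expectation p (indicator A)" by simp
  also have "\<dots> \<le> measure_pmf.expectation p f"
    using assms by (intro expectation_mono) (auto simp: indicator_def)
  finally show ?thesis .
qed

lemma prob_Markov:
  assumes "finite (set_pmf p)" "\<And>x. x \<in> set_pmf p \<Longrightarrow> 0 \<le> f x" "0 < c"
    "\<And>x. x \<in> set_pmf p \<Longrightarrow> x \<in> A \<Longrightarrow> c \<le> f x"
  shows "measure_pmf.prob p A \<le> measure_pmf.expectation p f / c"
proof -
  have "measure_pmf.prob p A \<le> measure_pmf.expectation p (\<lambda>x. f x / c)"
    using assms by (intro prob_le_expectation) auto
  then show ?thesis by simp
qed

lemma prob_Un_le: "measure_pmf.prob p (A \<union> B) \<le> measure_pmf.prob p A + measure_pmf.prob p B"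
  by (intro measure_subadditive) auto

lemma prob_UN_le:
  "finite I \<Longrightarrow> measure_pmf.prob p (\<Union>i\<in>I. A i) \<le> (\<Sum>i\<in>I. measure_pmf.prob p (A i))"
  by (intro measure_pmf.finite_measure_subadditive_finite) auto

lemma finite_set_Pi_pmf:
  assumes "finite A" "\<And>i. i \<in> A \<Longrightarrow> finite (set_pmf (p i))"
  shows "finite (set_pmf (Pi_pmf A d p))"
  using assms by (subst set_Pi_pmf) auto

text \<open>Independence in the form used by the inductions over entries: coordinate
  \<open>j\<close> is revealed last, with all others fixed.\<close>

lemma expectation_Pi_insert:
  fixes f :: "('a \<Rightarrow> 'b) \<Rightarrow> real"
  assumes "finite A" "j \<notin> A" "\<And>i. i \<in> insert j A \<Longrightarrow> finite (set_pmf (p i))"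
  shows "measure_pmf.expectation (Pi_pmf (insert j A) d p) f =
    measure_pmf.expectation (Pi_pmf A d p) (\<lambda>\<psi>. measure_pmf.expectation (p j) (\<lambda>v. f (\<psi>(j := v))))"
proof -
  have fin: "finite (set_pmf (Pi_pmf A d p))" using assms by (intro finite_set_Pi_pmf) auto
  have "Pi_pmf (insert j A) d p =
      bind_pmf (Pi_pmf A d p) (\<lambda>\<psi>. bind_pmf (p j) (\<lambda>v. return_pmf (\<psi>(j := v))))"
    unfolding Pi_pmf_insert'[OF assms(1,2)] by (rule bind_commute_pmf)
  then show ?thesis
    using fin assms(3) by (simp add: expectation_bind)
qed

lemma expectation_Pi_component:
  fixes f :: "'b \<Rightarrow> real"
  assumes "finite A" "j \<in> A"
  shows "measure_pmf.expectation (Pi_pmf A d p) (\<lambda>\<psi>. f (\<psi> j)) = measure_pmf.expectation (p j) f"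
proof -
  have "map_pmf (\<lambda>\<psi>. \<psi> j) (Pi_pmf A d p) = p j" using Pi_pmf_component[OF assms(1), of j d p] assms(2) by simp
  then show ?thesis by (metis integral_map_pmf)
qed

text \<open>The common form of both kinds of moves: \<open>c\<close> is the index of a subtable in
  the first table and a sampling level in the second one.\<close>

definition move :: "'c pmf \<Rightarrow> ('c \<Rightarrow> nat set) \<Rightarrow> ('c \<Rightarrow> real) \<Rightarrow> (nat \<times> real) pmf" where
  "move \<kappa> B a = do {
     c \<leftarrow> \<kappa>;
     b \<leftarrow> pmf_of_set (B c);
     s \<leftarrow> pmf_of_set {1, -1};
     return_pmf (b, s * a c)}"

lemma
  assumes "finite (set_pmf \<kappa>)" "\<And>c. c \<in> set_pmf \<kappa> \<Longrightarrow> finite (B c) \<and> B c \<noteq> {}"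
  shows finite_set_move: "finite (set_pmf (move \<kappa> B a))"
    and set_moveD: "v \<in> set_pmf (move \<kappa> B a) \<Longrightarrow> \<exists>c\<in>set_pmf \<kappa>. fst v \<in> B c \<and> \<bar>snd v\<bar> = \<bar>a c\<bar>"
    and expectation_move: "measure_pmf.expectation (move \<kappa> B a) f =
      measure_pmf.expectation \<kappa> (\<lambda>c. (\<Sum>b\<in>B c. (f (b, a c) + f (b, - a c)) / 2) / real (card (B c)))"
proof -
  show 1: "finite (set_pmf (move \<kappa> B a))"
    unfolding move_def using assms by (auto simp: set_pmf_of_set)
  show "\<exists>c\<in>set_pmf \<kappa>. fst v \<in> B c \<and> \<bar>snd v\<bar> = \<bar>a c\<bar>" if "v \<in> set_pmf (move \<kappa> B a)"
    using that assms unfolding move_def by (auto simp: set_pmf_of_set)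
  have "measure_pmf.expectation (move \<kappa> B a) f = measure_pmf.expectation \<kappa> (\<lambda>c.
     measure_pmf.expectation (bind_pmf (pmf_of_set (B c)) (\<lambda>b. bind_pmf (pmf_of_set {1, -1}) (\<lambda>s. return_pmf (b, s * a c)))) f)"
    unfolding move_def using assms by (intro expectation_bind) (auto simp: set_pmf_of_set)
  also have "\<dots> = measure_pmf.expectation \<kappa> (\<lambda>c. (\<Sum>b\<in>B c. (f (b, a c) + f (b, - a c)) / 2) / real (card (B c)))"
  proof (rule expectation_cong)
    fix c assume c: "c \<in> set_pmf \<kappa>"
    have "measure_pmf.expectation (bind_pmf (pmf_of_set (B c)) (\<lambda>b. bind_pmf (pmf_of_set {1, -1}) (\<lambda>s. return_pmf (b, s * a c)))) f =
      measure_pmf.expectation (pmf_of_set (B c)) (\<lambda>b. measure_pmf.expectation (pmf_of_set {1, -1}) (\<lambda>s. f (b, s * a c)))"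
      using assms(2)[OF c] by (simp add: expectation_bind set_pmf_of_set)
    also have "\<dots> = (\<Sum>b\<in>B c. (f (b, a c) + f (b, - a c)) / 2) / real (card (B c))"
      using assms(2)[OF c] by (simp add: integral_pmf_of_set add_divide_distrib)
    finally show "measure_pmf.expectation (bind_pmf (pmf_of_set (B c)) (\<lambda>b. bind_pmf (pmf_of_set {1, -1}) (\<lambda>s. return_pmf (b, s * a c)))) f
      = (\<Sum>b\<in>B c. (f (b, a c) + f (b, - a c)) / 2) / real (card (B c))" .
  qed
  finally show "measure_pmf.expectation (move \<kappa> B a) f =
      measure_pmf.expectation \<kappa> (\<lambda>c. (\<Sum>b\<in>B c. (f (b, a c) + f (b, - a c)) / 2) / real (card (B c)))" .
qed

section \<open>The clipped norm of a sketch and its exponential potential\<close>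

definition sketch :: "'m set \<Rightarrow> ('m \<Rightarrow> real) \<Rightarrow> ('m \<Rightarrow> nat \<times> real) \<Rightarrow> nat \<Rightarrow> real" where
  "sketch A y \<psi> b = (\<Sum>j\<in>A. if fst (\<psi> j) = b then snd (\<psi> j) * y j else 0)"

lemma sketch_insert:
  assumes "finite A" "j \<notin> A"
  shows "sketch (insert j A) y (\<psi>(j := v)) =
    (sketch A y \<psi>)(fst v := sketch A y \<psi> (fst v) + snd v * y j)"
proof -
  have "(\<Sum>i\<in>A. if fst ((\<psi>(j := v)) i) = b then snd ((\<psi>(j := v)) i) * y i else 0) = sketch A y \<psi> b" for b
    unfolding sketch_def using assms by (intro sum.cong) auto
  then show ?thesis using assms by (auto simp: sketch_def fun_eq_iff)
qed

text \<open>The contribution of bucket \<open>b\<close> to the sketched norm. In the second table it is clipped at \<open>K\<close>,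
  so that a single heavy entry has a bounded effect.\<close>

definition bucket_val :: "nat \<Rightarrow> real \<Rightarrow> nat \<Rightarrow> real \<Rightarrow> real" where
  "bucket_val N0 K b x = (if b < N0 then \<bar>x\<bar> else min \<bar>x\<bar> K)"

definition clipped_norm :: "nat \<Rightarrow> real \<Rightarrow> nat \<Rightarrow> (nat \<Rightarrow> real) \<Rightarrow> real" where
  "clipped_norm N0 K r x = (\<Sum>b<r. bucket_val N0 K b (x b))"

lemma bucket_val_add_le: "K > 0 \<Longrightarrow> bucket_val N0 K b (x + y) \<le> bucket_val N0 K b x + bucket_val N0 K b y"
  by (auto simp: bucket_val_def min_def)

lemma bucket_val_uminus [simp]: "bucket_val N0 K b (- x) = bucket_val N0 K b x"
  by (simp add: bucket_val_def)

text \<open>The third bound is useful for a nearly empty bucket, in which little can cancel. The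
  fourth one holds because a random sign does not decrease an absolute value on average; clipping
  spoils this only if the bucket is filled beyond \<open>K / 2\<close>, and then the loss of at most
  \<open>m\<close> is charged to its content.\<close>

lemma bucket_val_step:
  assumes "K > 0" "0 \<le> \<xi>" "b < N0 \<Longrightarrow> \<xi> \<le> K"
  defines "m \<equiv> min \<xi> K" and "\<phi> \<equiv> bucket_val N0 K b"
  shows "\<bar>\<phi> (x + \<xi>) - \<phi> x\<bar> \<le> m" "\<bar>\<phi> (x - \<xi>) - \<phi> x\<bar> \<le> m"
    "m - 2 * \<phi> x \<le> (\<phi> (x + \<xi>) + \<phi> (x - \<xi>)) / 2 - \<phi> x"
    "- 2 * m * \<phi> x / K \<le> (\<phi> (x + \<xi>) + \<phi> (x - \<xi>)) / 2 - \<phi> x"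
proof -
  have \<phi>\<xi>: "\<phi> \<xi> = m" using assms(1-3) by (auto simp: m_def \<phi>_def bucket_val_def)
  have tri: "\<phi> (u + v) \<le> \<phi> u + \<phi> v" and neg: "\<phi> (- u) = \<phi> u" for u v
    using bucket_val_add_le[OF assms(1)] by (auto simp: \<phi>_def)
  show 1: "\<bar>\<phi> (x + \<xi>) - \<phi> x\<bar> \<le> m" and 2: "\<bar>\<phi> (x - \<xi>) - \<phi> x\<bar> \<le> m"
    using tri[of x \<xi>] tri[of "x + \<xi>" "- \<xi>"] tri[of x "- \<xi>"] tri[of "x - \<xi>" \<xi>] neg[of \<xi>] \<phi>\<xi>
    by (auto simp: abs_le_iff)
  have 3: "m \<le> \<phi> (x + \<xi>) + \<phi> x" "m \<le> \<phi> (x - \<xi>) + \<phi> x"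
    using tri[of "x + \<xi>" "- x"] tri[of "\<xi> - x" x] neg[of x] neg[of "x - \<xi>"] \<phi>\<xi> by auto
  then show "m - 2 * \<phi> x \<le> (\<phi> (x + \<xi>) + \<phi> (x - \<xi>)) / 2 - \<phi> x" by argo
  show "- 2 * m * \<phi> x / K \<le> (\<phi> (x + \<xi>) + \<phi> (x - \<xi>)) / 2 - \<phi> x"
  proof (cases "\<phi> x \<le> K / 2 \<or> b < N0")
    case True
    then have "0 \<le> (\<phi> (x + \<xi>) + \<phi> (x - \<xi>)) / 2 - \<phi> x"
      using assms(1-3) by (auto simp: \<phi>_def bucket_val_def min_def split: if_splits)
    moreover have "0 \<le> m * \<phi> x / K" using assms(1-3) by (auto simp: m_def \<phi>_def bucket_val_def)
    moreover have "- 2 * m * \<phi> x / K = - 2 * (m * \<phi> x / K)" by simp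
    ultimately show ?thesis by linarith
  next
    case False
    then have "m * K \<le> m * (2 * \<phi> x)"
      using assms(1,2) by (intro mult_left_mono) (auto simp: m_def)
    then have "m \<le> 2 * m * \<phi> x / K" using assms(1) by (simp add: field_simps)
    then show ?thesis using 1 2 by (simp add: abs_le_iff field_simps) argo
  qed
qed

lemma bucket_val_nonneg: "K > 0 \<Longrightarrow> bucket_val N0 K b x \<ge> 0"
  by (auto simp: bucket_val_def)

lemma clipped_norm_update:
  assumes "b < r"
  shows "clipped_norm N0 K r (x(b := x')) = clipped_norm N0 K r x + (bucket_val N0 K b x' - bucket_val N0 K b (x b))"
proof -
  have "(\<Sum>c\<in>{..<r} - {b}. bucket_val N0 K c ((x(b := x')) c)) = (\<Sum>c\<in>{..<r} - {b}. bucket_val N0 K c (x c))"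
    by (intro sum.cong) auto
  then show ?thesis
    using assms sum.remove[of "{..<r}" b "\<lambda>c. bucket_val N0 K c ((x(b := x')) c)"]
      sum.remove[of "{..<r}" b "\<lambda>c. bucket_val N0 K c (x c)"]
    unfolding clipped_norm_def by simp
qed

lemma exp_minus_le_quadratic:
  assumes "\<bar>t\<bar> \<le> (1::real)"
  shows "exp (- t) \<le> 1 - t + t\<^sup>2"
proof (cases "t \<le> 0")
  case True
  then show ?thesis using exp_bound[of "- t"] assms by simp
next
  case False
  have "exp (- t) \<le> 1 / (1 + t)"
    using exp_ge_add_one_self[of t] False by (simp add: exp_minus field_simps)
  also have "\<dots> \<le> 1 - t + t\<^sup>2"
  proof -
    have "1 \<le> (1 - t + t\<^sup>2) * (1 + t)"
      using False by (simp add: algebra_simps power2_eq_square)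
    then show ?thesis using False by (simp add: divide_le_eq)
  qed
  finally show ?thesis .
qed

text \<open>The two lower bounds of \<open>bucket_val_step\<close>, averaged over \<open>N\<close>
  buckets whose total content is at most 2: the content enters with the factor 2, whence the
  4.\<close>

definition gain_bound :: "real \<Rightarrow> real \<Rightarrow> real \<Rightarrow> real" where
  "gain_bound K N \<xi> = max (min \<xi> K - 4 / N) (- 4 * min \<xi> K / (K * N))"

text \<open>\<open>h b\<close> is the factor by which the potential changes if bucket
  \<open>b\<close> is hit. Clipping bounds the change of the norm by \<open>K\<close> and
  \<open>\<theta> * K\<close> is at most 1/4, so the exponential may be replaced by a quadratic.
  Without control of the content, only the crude factor 2 remains.\<close>

lemma bucket_average:
  fixes B :: "nat set" and x :: "nat \<Rightarrow> real"
  assumes B: "finite B" "B \<noteq> {}" "B \<subseteq> {..<r}" and K: "K > 0" and \<theta>: "0 \<le> \<theta>" "\<theta> * K \<le> 1 / 4"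
    and \<xi>: "0 \<le> \<xi>" "\<And>b. b \<in> B \<Longrightarrow> b < N0 \<Longrightarrow> \<xi> \<le> K"
  defines "h \<equiv> (\<lambda>b. (exp (- \<theta> * (bucket_val N0 K b (x b + \<xi>) - bucket_val N0 K b (x b))) +
      exp (- \<theta> * (bucket_val N0 K b (x b - \<xi>) - bucket_val N0 K b (x b)))) / 2)"
  shows "(\<Sum>b\<in>B. h b) / card B \<le> 2"
    "clipped_norm N0 K r x \<le> 2 \<Longrightarrow>
      (\<Sum>b\<in>B. h b) / card B \<le> 1 - \<theta> * gain_bound K (card B) \<xi> + \<theta>\<^sup>2 * (min \<xi> K)\<^sup>2"
proof -
  define m where "m = min \<xi> K"
  define \<phi> where "\<phi> b = bucket_val N0 K b" for b
  define \<Delta> where "\<Delta> b = \<phi> b (x b + \<xi>) - \<phi> b (x b)" for b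
  define \<Delta>' where "\<Delta>' b = \<phi> b (x b - \<xi>) - \<phi> b (x b)" for b
  have card: "real (card B) > 0" using B by (simp add: card_gt_0_iff)
  have h: "h b = (exp (- \<theta> * \<Delta> b) + exp (- \<theta> * \<Delta>' b)) / 2" for b
    by (simp add: h_def \<Delta>_def \<Delta>'_def \<phi>_def)
  have m: "0 \<le> m" "m \<le> K" using K \<xi>(1) by (auto simp: m_def)
  have \<theta>m: "\<theta> * m \<le> 1 / 4" using m \<theta> by (meson mult_left_mono order_trans)
  have step: "\<bar>\<Delta> b\<bar> \<le> m" "\<bar>\<Delta>' b\<bar> \<le> m" "m - 2 * \<phi> b (x b) \<le> (\<Delta> b + \<Delta>' b) / 2"
     "- 2 * m * \<phi> b (x b) / K \<le> (\<Delta> b + \<Delta>' b) / 2" if "b \<in> B" for b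
  proof -
    have avg: "(\<Delta> b + \<Delta>' b) / 2 = (\<phi> b (x b + \<xi>) + \<phi> b (x b - \<xi>)) / 2 - \<phi> b (x b)"
      by (simp add: \<Delta>_def \<Delta>'_def field_simps)
    show "\<bar>\<Delta> b\<bar> \<le> m" "\<bar>\<Delta>' b\<bar> \<le> m" "m - 2 * \<phi> b (x b) \<le> (\<Delta> b + \<Delta>' b) / 2"
     "- 2 * m * \<phi> b (x b) / K \<le> (\<Delta> b + \<Delta>' b) / 2"
      unfolding avg unfolding \<Delta>_def \<Delta>'_def m_def \<phi>_def
      using bucket_val_step[OF K \<xi>(1) \<xi>(2)[OF that], where x = "x b"] by auto
  qed
  have small: "\<bar>\<theta> * d\<bar> \<le> 1 / 4" if "\<bar>d\<bar> \<le> m" for d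
    using mult_left_mono[OF that \<theta>(1)] \<theta>m \<theta>(1) by (simp add: abs_mult)
  have quad: "exp (- \<theta> * d) \<le> 1 - \<theta> * d + \<theta>\<^sup>2 * m\<^sup>2" if "\<bar>d\<bar> \<le> m" for d
  proof -
    have "exp (- (\<theta> * d)) \<le> 1 - \<theta> * d + (\<theta> * d)\<^sup>2"
      using small[OF that] by (intro exp_minus_le_quadratic) simp
    also have "(\<theta> * d)\<^sup>2 \<le> \<theta>\<^sup>2 * m\<^sup>2"
      unfolding power_mult_distrib using that by (intro mult_left_mono) (auto simp: abs_le_square_iff[symmetric])
    finally show ?thesis by simp
  qed
  have exp_le_2: "exp (- \<theta> * d) \<le> 2" if "\<bar>d\<bar> \<le> m" for d
  proof -
    have "exp (- (\<theta> * d)) \<le> 1 - \<theta> * d + (\<theta> * d)\<^sup>2"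
      using small[OF that] by (intro exp_minus_le_quadratic) simp
    moreover have "(\<theta> * d)\<^sup>2 \<le> (1/4)\<^sup>2" using small[OF that] by (simp add: abs_le_square_iff[symmetric])
    ultimately show ?thesis using small[OF that] by (simp add: abs_le_iff power2_eq_square)
  qed
  then have "h b \<le> 2" if "b \<in> B" for b
  proof -
    note exp_le_2[OF step(1)[OF that]] exp_le_2[OF step(2)[OF that]]
    then show ?thesis unfolding h by simp
  qed
  then have "(\<Sum>b\<in>B. h b) \<le> (\<Sum>b\<in>B. 2)" by (intro sum_mono) auto
  then show "(\<Sum>b\<in>B. h b) / card B \<le> 2" using card by (simp add: field_simps)
  assume F: "clipped_norm N0 K r x \<le> 2"
  have \<phi>0: "\<phi> b z \<ge> 0" for b z using K by (simp add: \<phi>_def bucket_val_nonneg)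
  have "(\<Sum>b\<in>B. \<phi> b (x b)) \<le> clipped_norm N0 K r x"
    unfolding clipped_norm_def \<phi>_def[symmetric] using B \<phi>0 by (intro sum_mono2) auto
  then have sum\<phi>: "(\<Sum>b\<in>B. \<phi> b (x b)) \<le> 2" using F by simp
  have hb: "h b \<le> 1 - \<theta> * ((\<Delta> b + \<Delta>' b) / 2) + \<theta>\<^sup>2 * m\<^sup>2" if "b \<in> B" for b
    using quad[OF step(1)[OF that]] quad[OF step(2)[OF that]] unfolding h by (simp add: field_simps)
  have avg1: "card B * m - 4 \<le> (\<Sum>b\<in>B. (\<Delta> b + \<Delta>' b) / 2)"
  proof -
    have "card B * m - 4 \<le> card B * m - 2 * (\<Sum>b\<in>B. \<phi> b (x b))" using sum\<phi> by simp
    also have "\<dots> = (\<Sum>b\<in>B. m - 2 * \<phi> b (x b))" by (simp add: sum_subtractf sum_distrib_left)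
    also have "\<dots> \<le> (\<Sum>b\<in>B. (\<Delta> b + \<Delta>' b) / 2)" using step(3) by (intro sum_mono) auto
    finally show ?thesis .
  qed
  have avg2: "- 4 * m / K \<le> (\<Sum>b\<in>B. (\<Delta> b + \<Delta>' b) / 2)"
  proof -
    have "(2 * m / K) * (\<Sum>b\<in>B. \<phi> b (x b)) \<le> (2 * m / K) * 2"
      using sum\<phi> m K by (intro mult_left_mono) auto
    then have "- 4 * m / K \<le> - (2 * m / K) * (\<Sum>b\<in>B. \<phi> b (x b))" by simp
    also have "\<dots> = (\<Sum>b\<in>B. - 2 * m * \<phi> b (x b) / K)" by (simp add: sum_distrib_left sum_negf)
    also have "\<dots> \<le> (\<Sum>b\<in>B. (\<Delta> b + \<Delta>' b) / 2)" using step(4) by (intro sum_mono) auto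
    finally show ?thesis .
  qed
  have "gain_bound K (card B) \<xi> \<le> (\<Sum>b\<in>B. (\<Delta> b + \<Delta>' b) / 2) / card B"
  proof -
    have "m - 4 / card B = (card B * m - 4) / card B" "- 4 * m / (K * card B) = (- 4 * m / K) / card B"
      using card by (auto simp: field_simps)
    moreover have "(card B * m - 4) / card B \<le> (\<Sum>b\<in>B. (\<Delta> b + \<Delta>' b) / 2) / card B"
      "(- 4 * m / K) / card B \<le> (\<Sum>b\<in>B. (\<Delta> b + \<Delta>' b) / 2) / card B"
      by (rule divide_right_mono[OF avg1 of_nat_0_le_iff], rule divide_right_mono[OF avg2 of_nat_0_le_iff])
    ultimately show ?thesis
      unfolding gain_bound_def m_def[symmetric] by (simp only: max.bounded_iff)
  qed
  then have gain: "\<theta> * gain_bound K (card B) \<xi> \<le> \<theta> * ((\<Sum>b\<in>B. (\<Delta> b + \<Delta>' b) / 2) / card B)"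
    using \<theta>(1) by (intro mult_left_mono)
  have "(\<Sum>b\<in>B. h b) \<le> (\<Sum>b\<in>B. 1 - \<theta> * ((\<Delta> b + \<Delta>' b) / 2) + \<theta>\<^sup>2 * m\<^sup>2)"
    using hb by (intro sum_mono)
  also have "\<dots> = card B * (1 + \<theta>\<^sup>2 * m\<^sup>2) - \<theta> * (\<Sum>b\<in>B. (\<Delta> b + \<Delta>' b) / 2)"
    by (simp add: sum.distrib sum_subtractf sum_distrib_left algebra_simps)
  finally have "(\<Sum>b\<in>B. h b) / card B \<le> (card B * (1 + \<theta>\<^sup>2 * m\<^sup>2) - \<theta> * (\<Sum>b\<in>B. (\<Delta> b + \<Delta>' b) / 2)) / card B"
    using card by (intro divide_right_mono) auto
  also have "\<dots> = 1 + \<theta>\<^sup>2 * m\<^sup>2 - \<theta> * ((\<Sum>b\<in>B. (\<Delta> b + \<Delta>' b) / 2) / card B)"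
    using card by (simp add: diff_divide_distrib)
  also have "\<dots> \<le> 1 - \<theta> * gain_bound K (card B) \<xi> + \<theta>\<^sup>2 * m\<^sup>2" using gain by simp
  finally show "(\<Sum>b\<in>B. h b) / card B \<le> 1 - \<theta> * gain_bound K (card B) \<xi> + \<theta>\<^sup>2 * (min \<xi> K)\<^sup>2"
    by (simp add: m_def)
qed

text \<open>The supermartingale step. While the norm is at most 2, the potential shrinks by
  \<open>exp (- \<theta> * \<gamma>)\<close> on average. Above 2 there is no drift, but there the
  potential is below \<open>exp (- 2 * \<theta>)\<close>, so that its possible doubling fits into
  the additive term.\<close>

lemma move_step:
  assumes \<kappa>: "finite (set_pmf \<kappa>)"
    and B: "\<And>c. c \<in> set_pmf \<kappa> \<Longrightarrow> finite (B c) \<and> B c \<noteq> {} \<and> B c \<subseteq> {..<r}"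
    and a: "\<And>c. c \<in> set_pmf \<kappa> \<Longrightarrow> 0 \<le> a c"
    and K: "K > 0" and \<theta>: "0 \<le> \<theta>" "\<theta> * K \<le> 1 / 4"
    and small: "\<And>c b. c \<in> set_pmf \<kappa> \<Longrightarrow> b \<in> B c \<Longrightarrow> b < N0 \<Longrightarrow> a c * \<bar>y\<bar> \<le> K"
    and \<gamma>: "\<gamma> \<le> measure_pmf.expectation \<kappa> (\<lambda>c. gain_bound K (card (B c)) (a c * \<bar>y\<bar>))
      - \<theta> * measure_pmf.expectation \<kappa> (\<lambda>c. (min (a c * \<bar>y\<bar>) K)\<^sup>2)"
  shows "measure_pmf.expectation (move \<kappa> B a)
      (\<lambda>v. exp (- \<theta> * clipped_norm N0 K r (x(fst v := x (fst v) + snd v * y)))) \<le>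
    exp (- \<theta> * \<gamma>) * exp (- \<theta> * clipped_norm N0 K r x) + 2 * exp (- 2 * \<theta>)"
proof -
  let ?F = "clipped_norm N0 K r"
  define h where "h c b = (exp (- \<theta> * (bucket_val N0 K b (x b + a c * \<bar>y\<bar>) - bucket_val N0 K b (x b))) +
      exp (- \<theta> * (bucket_val N0 K b (x b - a c * \<bar>y\<bar>) - bucket_val N0 K b (x b)))) / 2" for c b
  define H where "H c = (\<Sum>b\<in>B c. h c b) / card (B c)" for c
  have upd: "exp (- \<theta> * ?F (x(b := x'))) =
      exp (- \<theta> * ?F x) * exp (- \<theta> * (bucket_val N0 K b x' - bucket_val N0 K b (x b)))" if "b < r" for b x'
    unfolding clipped_norm_update[OF that] by (simp add: algebra_simps flip: exp_add)
  have "measure_pmf.expectation (move \<kappa> B a) (\<lambda>v. exp (- \<theta> * ?F (x(fst v := x (fst v) + snd v * y)))) =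
     measure_pmf.expectation \<kappa> (\<lambda>c. (\<Sum>b\<in>B c. (exp (- \<theta> * ?F (x(b := x b + a c * y))) +
        exp (- \<theta> * ?F (x(b := x b + (- a c) * y)))) / 2) / card (B c))"
    using \<kappa> B by (subst expectation_move) auto
  also have "\<dots> = measure_pmf.expectation \<kappa> (\<lambda>c. exp (- \<theta> * ?F x) * H c)"
  proof (rule expectation_cong)
    fix c assume c: "c \<in> set_pmf \<kappa>"
    have "(exp (- \<theta> * ?F (x(b := x b + a c * y))) + exp (- \<theta> * ?F (x(b := x b + (- a c) * y)))) / 2
       = exp (- \<theta> * ?F x) * h c b" if "b \<in> B c" for b
    proof -
      have b: "b < r" using B[OF c] that by auto
      show ?thesis
      proof (cases "y \<ge> 0")
        case True
        then show ?thesis unfolding upd[OF b] h_def by (simp add: algebra_simps)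
      next
        case False
        then show ?thesis unfolding upd[OF b] h_def by (simp add: algebra_simps)
      qed
    qed
    then show "(\<Sum>b\<in>B c. (exp (- \<theta> * ?F (x(b := x b + a c * y))) + exp (- \<theta> * ?F (x(b := x b + (- a c) * y)))) / 2) / card (B c)
      = exp (- \<theta> * ?F x) * H c"
      by (simp add: H_def sum_distrib_left)
  qed
  also have "\<dots> = exp (- \<theta> * ?F x) * measure_pmf.expectation \<kappa> H" by simp
  finally have eq: "measure_pmf.expectation (move \<kappa> B a) (\<lambda>v. exp (- \<theta> * ?F (x(fst v := x (fst v) + snd v * y)))) =
    exp (- \<theta> * ?F x) * measure_pmf.expectation \<kappa> H" .
  note avg = bucket_average[OF _ _ _ K \<theta>, of "B c" r "a c * \<bar>y\<bar>" N0 x for c]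
  have H2: "H c \<le> 2" if "c \<in> set_pmf \<kappa>" for c
    unfolding H_def h_def using avg(1)[of c] B[OF that] a[OF that] small[OF that] by simp
  show ?thesis
  proof (cases "?F x \<le> 2")
    case True
    have "measure_pmf.expectation \<kappa> H \<le> measure_pmf.expectation \<kappa> (\<lambda>c. 1 - \<theta> * gain_bound K (card (B c)) (a c * \<bar>y\<bar>) + \<theta>\<^sup>2 * (min (a c * \<bar>y\<bar>) K)\<^sup>2)"
    proof (intro expectation_mono \<kappa>)
      fix c assume c: "c \<in> set_pmf \<kappa>"
      show "H c \<le> 1 - \<theta> * gain_bound K (card (B c)) (a c * \<bar>y\<bar>) + \<theta>\<^sup>2 * (min (a c * \<bar>y\<bar>) K)\<^sup>2"
        unfolding H_def h_def using avg(2)[of c] B[OF c] a[OF c] small[OF c] True by simp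
    qed
    also have "\<dots> = measure_pmf.expectation \<kappa> (\<lambda>c. 1 * 1 + 1 * ((- \<theta>) * gain_bound K (card (B c)) (a c * \<bar>y\<bar>) + \<theta>\<^sup>2 * (min (a c * \<bar>y\<bar>) K)\<^sup>2))"
      by (simp add: algebra_simps)
    also have "\<dots> = 1 - \<theta> * (measure_pmf.expectation \<kappa> (\<lambda>c. gain_bound K (card (B c)) (a c * \<bar>y\<bar>))
      - \<theta> * measure_pmf.expectation \<kappa> (\<lambda>c. (min (a c * \<bar>y\<bar>) K)\<^sup>2))"
      unfolding expectation_linear[OF \<kappa>] by (simp add: algebra_simps power2_eq_square)
    also have "\<dots> \<le> 1 - \<theta> * \<gamma>" using mult_left_mono[OF \<gamma> \<theta>(1)] by simp
    also have "\<dots> \<le> exp (- \<theta> * \<gamma>)" using exp_ge_add_one_self[of "- \<theta> * \<gamma>"] by simp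
    finally have "exp (- \<theta> * ?F x) * measure_pmf.expectation \<kappa> H \<le> exp (- \<theta> * ?F x) * exp (- \<theta> * \<gamma>)"
      by (intro mult_left_mono) auto
    then show ?thesis unfolding eq by (simp add: mult.commute add_increasing2)
  next
    case False
    have "measure_pmf.expectation \<kappa> H \<le> measure_pmf.expectation \<kappa> (\<lambda>_. 2)"
      using H2 by (intro expectation_mono \<kappa>)
    then have "exp (- \<theta> * ?F x) * measure_pmf.expectation \<kappa> H \<le> exp (- \<theta> * ?F x) * 2"
      by (intro mult_left_mono) auto
    also have "exp (- \<theta> * ?F x) \<le> exp (- 2 * \<theta>)"
      using mult_left_mono[of 2 "?F x" \<theta>] False \<theta>(1) by simp
    finally show ?thesis unfolding eq by (simp add: add_increasing mult.commute)
  qed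
qed

text \<open>The coordinates in \<open>H\<close> come first and those in \<open>B\<close> are
  revealed one by one. The event \<open>G\<close> may only depend on the former, so that it can be
  carried through the induction. Some \<open>\<gamma> j\<close> may be negative and then amplify
  earlier additive errors; \<open>\<eta>\<close> bounds this amplification.\<close>

lemma sketch_recursion:
  fixes y \<gamma> \<eta> :: "'m \<Rightarrow> real" and p :: "'m \<Rightarrow> (nat \<times> real) pmf"
  assumes "finite H" "finite B" "H \<inter> B = {}" and \<theta>: "0 \<le> \<theta>"
    and fin: "\<And>j. j \<in> H \<union> B \<Longrightarrow> finite (set_pmf (p j))"
    and step: "\<And>j x. j \<in> B \<Longrightarrow> measure_pmf.expectation (p j)
      (\<lambda>v. exp (- \<theta> * F (x(fst v := x (fst v) + snd v * y j)))) \<le>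
        exp (- \<theta> * \<gamma> j) * exp (- \<theta> * F x) + 2 * exp (- 2 * \<theta>)"
    and \<eta>: "\<And>j. j \<in> B \<Longrightarrow> - \<eta> j \<le> \<gamma> j" "\<And>j. j \<in> B \<Longrightarrow> 0 \<le> \<eta> j"
    and G: "\<And>\<psi> j v. j \<in> B \<Longrightarrow> \<psi>(j := v) \<in> G \<longleftrightarrow> \<psi> \<in> G"
  shows "measure_pmf.expectation (Pi_pmf (H \<union> B) d p) (\<lambda>\<psi>. indicator G \<psi> * exp (- \<theta> * F (sketch (H \<union> B) y \<psi>)))
    \<le> exp (- \<theta> * sum \<gamma> B) * measure_pmf.expectation (Pi_pmf H d p) (\<lambda>\<psi>. indicator G \<psi> * exp (- \<theta> * F (sketch H y \<psi>)))
      + 2 * card B * exp (\<theta> * sum \<eta> B - 2 * \<theta>)"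
  using assms(2,3) fin step \<eta> G
proof (induction B rule: finite_induct)
  case empty
  then show ?case by simp
next
  case (insert j B)
  let ?E = measure_pmf.expectation
  let ?P = "Pi_pmf (H \<union> B) d p"
  let ?f = "\<lambda>\<psi>. indicator G \<psi> * exp (- \<theta> * F (sketch (H \<union> B) y \<psi>))"
  let ?a0 = "?E (Pi_pmf H d p) (\<lambda>\<psi>. indicator G \<psi> * exp (- \<theta> * F (sketch H y \<psi>)))"
  have IH: "?E ?P ?f \<le> exp (- \<theta> * sum \<gamma> B) * ?a0 + 2 * card B * exp (\<theta> * sum \<eta> B - 2 * \<theta>)"
    using insert.prems by (intro insert.IH) auto
  have j: "j \<notin> H \<union> B" "finite (H \<union> B)" using insert.hyps insert.prems(1) assms(1) by auto
  have fin: "finite (set_pmf ?P)" using insert.prems(2) j(2) by (intro finite_set_Pi_pmf) auto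
  have indG: "indicator G (\<psi>(j := v)) = (indicator G \<psi> :: real)" for \<psi> v
    using insert.prems(6)[of j \<psi> v] by (simp add: indicator_def del: fun_upd_apply)
  have "?E (Pi_pmf (insert j (H \<union> B)) d p) (\<lambda>\<psi>. indicator G \<psi> * exp (- \<theta> * F (sketch (insert j (H \<union> B)) y \<psi>))) =
    ?E ?P (\<lambda>\<psi>. ?E (p j) (\<lambda>v. indicator G \<psi> * exp (- \<theta> * F ((sketch (H \<union> B) y \<psi>)(fst v := sketch (H \<union> B) y \<psi> (fst v) + snd v * y j)))))"
    using insert.prems(2) by (subst expectation_Pi_insert[OF j(2,1)]) (auto simp only: sketch_insert[OF j(2,1)] indG)
  also have "\<dots> = ?E ?P (\<lambda>\<psi>. indicator G \<psi> * ?E (p j) (\<lambda>v. exp (- \<theta> * F ((sketch (H \<union> B) y \<psi>)(fst v := sketch (H \<union> B) y \<psi> (fst v) + snd v * y j)))))"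
    by simp
  also have "\<dots> \<le> ?E ?P (\<lambda>\<psi>. exp (- \<theta> * \<gamma> j) * ?f \<psi> + (2 * exp (- 2 * \<theta>)) * 1)"
  proof (intro expectation_mono fin)
    fix \<psi>
    have "indicator G \<psi> * ?E (p j) (\<lambda>v. exp (- \<theta> * F ((sketch (H \<union> B) y \<psi>)(fst v := sketch (H \<union> B) y \<psi> (fst v) + snd v * y j))))
      \<le> indicator G \<psi> * (exp (- \<theta> * \<gamma> j) * exp (- \<theta> * F (sketch (H \<union> B) y \<psi>)) + 2 * exp (- 2 * \<theta>))"
      by (intro mult_left_mono insert.prems(3)) auto
    also have "\<dots> \<le> exp (- \<theta> * \<gamma> j) * ?f \<psi> + (2 * exp (- 2 * \<theta>)) * 1"
      by (auto simp: indicator_def)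
    finally show "indicator G \<psi> * ?E (p j) (\<lambda>v. exp (- \<theta> * F ((sketch (H \<union> B) y \<psi>)(fst v := sketch (H \<union> B) y \<psi> (fst v) + snd v * y j))))
      \<le> exp (- \<theta> * \<gamma> j) * ?f \<psi> + (2 * exp (- 2 * \<theta>)) * 1" .
  qed
  also have "\<dots> = exp (- \<theta> * \<gamma> j) * ?E ?P ?f + 2 * exp (- 2 * \<theta>)"
    by (subst expectation_linear[OF fin]) simp
  also have "exp (- \<theta> * \<gamma> j) * ?E ?P ?f \<le> exp (- \<theta> * \<gamma> j) * (exp (- \<theta> * sum \<gamma> B) * ?a0 + 2 * card B * exp (\<theta> * sum \<eta> B - 2 * \<theta>))"
    using IH by (intro mult_left_mono) auto
  also have "\<dots> = exp (- \<theta> * sum \<gamma> (insert j B)) * ?a0 + 2 * card B * (exp (- \<theta> * \<gamma> j) * exp (\<theta> * sum \<eta> B - 2 * \<theta>))"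
    using insert.hyps by (simp add: algebra_simps exp_diff exp_add exp_minus divide_inverse)
  also have "exp (- \<theta> * \<gamma> j) * exp (\<theta> * sum \<eta> B - 2 * \<theta>) \<le> exp (\<theta> * \<eta> j) * exp (\<theta> * sum \<eta> B - 2 * \<theta>)"
    using mult_left_mono[OF insert.prems(4)[of j] \<theta>] by (intro mult_right_mono) auto
  also have "\<dots> = exp (\<theta> * sum \<eta> (insert j B) - 2 * \<theta>)"
    using insert.hyps by (simp add: algebra_simps flip: exp_add)
  finally have "?E (Pi_pmf (insert j (H \<union> B)) d p) (\<lambda>\<psi>. indicator G \<psi> * exp (- \<theta> * F (sketch (insert j (H \<union> B)) y \<psi>)))
    \<le> exp (- \<theta> * sum \<gamma> (insert j B)) * ?a0 + 2 * card B * exp (\<theta> * sum \<eta> (insert j B) - 2 * \<theta>) + 2 * exp (- 2 * \<theta>)"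
    by (simp add: mult_left_mono)
  also have "exp (- 2 * \<theta>) \<le> exp (\<theta> * sum \<eta> (insert j B) - 2 * \<theta>)"
    using mult_nonneg_nonneg[OF \<theta> sum_nonneg[of "insert j B" \<eta>]] insert.prems(5) by simp
  finally show ?case using insert.hyps by (simp add: algebra_simps)
qed

section \<open>The lower tail for one vector\<close>

text \<open>The sum is at most twice its largest term, the one at \<open>Min U\<close>. Summing
  losses in this way keeps the number of tables or levels out of the bounds.\<close>

lemma sum_inverse_powers_le:
  fixes q y :: real
  assumes "finite U" "0 \<le> q" "0 \<le> y" "\<And>u. u \<in> U \<Longrightarrow> q / 2 ^ u \<le> y"
  shows "(\<Sum>u\<in>U. q / 2 ^ u) \<le> 2 * y"
proof (cases "U = {}")
  case True
  then show ?thesis using assms(3) by simp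
next
  case False
  define a where "a = Min U"
  have a: "a \<in> U" "\<And>u. u \<in> U \<Longrightarrow> a \<le> u" using assms(1) False by (auto simp: a_def)
  have geom: "(\<Sum>u\<in>{a..<b}. (1/2) ^ u) \<le> 2 * (1/2 :: real) ^ a" for b
  proof (cases "a \<le> b")
    case True
    then have "(\<Sum>u\<in>{a..<b}. (1/2) ^ u) = 2 * (1/2 :: real) ^ a - 2 * (1/2) ^ b"
      by (induction b rule: dec_induct) auto
    then show ?thesis by simp
  qed auto
  have "(\<Sum>u\<in>U. q / 2 ^ u) = q * (\<Sum>u\<in>U. (1/2) ^ u)"
    by (simp add: sum_distrib_left power_divide)
  also have "(\<Sum>u\<in>U. (1/2) ^ u) \<le> (\<Sum>u\<in>{a..<Suc (Max U)}. (1/2 :: real) ^ u)"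
    using a(2) assms(1) by (intro sum_mono2) (auto simp: less_Suc_eq_le)
  also have "\<dots> \<le> 2 * (1/2) ^ a" by (rule geom)
  finally have "(\<Sum>u\<in>U. q / 2 ^ u) \<le> q * (2 * (1/2) ^ a)" using assms(2) by (simp add: mult_left_mono)
  also have "\<dots> = 2 * (q / 2 ^ a)" by (simp add: power_divide)
  also have "\<dots> \<le> 2 * y" using assms(4)[OF a(1)] by simp
  finally show ?thesis .
qed

lemma sum_powers_le:
  fixes q y :: real
  assumes "finite U" "0 \<le> q" "0 \<le> y" "\<And>u. u \<in> U \<Longrightarrow> q * 2 ^ u \<le> y"
  shows "(\<Sum>u\<in>U. q * 2 ^ u) \<le> 2 * y"
proof (cases "U = {}")
  case True
  then show ?thesis using assms(3) by simp
next
  case False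
  define b where "b = Max U"
  have b: "b \<in> U" "\<And>u. u \<in> U \<Longrightarrow> u \<le> b" using assms(1) False by (auto simp: b_def)
  have geom: "(\<Sum>u\<in>{..b}. 2 ^ u) \<le> 2 * (2 :: real) ^ b"
  proof -
    have "(\<Sum>u\<in>{..b}. 2 ^ u) = 2 * (2 :: real) ^ b - 1" by (induction b) auto
    then show ?thesis by simp
  qed
  have "(\<Sum>u\<in>U. q * 2 ^ u) = q * (\<Sum>u\<in>U. 2 ^ u)" by (simp add: sum_distrib_left)
  also have "(\<Sum>u\<in>U. 2 ^ u) \<le> (\<Sum>u\<in>{..b}. (2 :: real) ^ u)"
    using b(2) by (intro sum_mono2) auto
  also note geom
  finally have "(\<Sum>u\<in>U. q * 2 ^ u) \<le> q * (2 * 2 ^ b)" using assms(2) by (simp add: mult_left_mono)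
  then show ?thesis using assms(4)[OF b(1)] by simp
qed

text \<open>The scheme has two tables. In the first one, an entry enters a random subtable \<open>u < J\<close> with
  \<open>n0 * 2 ^ u\<close> buckets unscaled. In the second one with \<open>N1\<close> buckets, it is sampled at level \<open>t\<close>
  with probability \<open>2 ^ -t\<close> and scaled by \<open>2 ^ t / J\<close>; level 0 stands for not being sampled.\<close>

locale sketching_scheme =
  fixes J n0 N1 x0 x1 :: nat
  assumes J: "J > 0" and n0: "n0 > 0" and N1: "N1 > 0" and x0: "x0 \<ge> 1"
begin

definition "N0 = n0 * (2 ^ J - 1)"

definition subtable :: "nat \<Rightarrow> nat set" where
  "subtable u = {n0 * (2 ^ u - 1)..<n0 * (2 ^ Suc u - 1)}"

text \<open>As \<open>x0 \<ge> 1\<close>, the proper levels have total probability at most 1 and the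
  index 0 is free for the rest.\<close>

definition level_weight :: "nat \<Rightarrow> real" where
  "level_weight t = (if t \<in> {x0..x1} then 1 / 2 ^ t else if t = 0 then 1 - (\<Sum>t\<in>{x0..x1}. 1 / 2 ^ t) else 0)"

definition "level_pmf = embed_pmf level_weight"

definition level_scale :: "nat \<Rightarrow> real" where
  "level_scale t = (if t = 0 then 0 else 2 ^ t / real J)"

definition "low_move = move (pmf_of_set {..<J}) subtable (\<lambda>_. 1)"

definition "high_move = move level_pmf (\<lambda>_. {N0..<N0 + N1}) level_scale"

text \<open>Indexing the two copies of an entry by a Boolean makes both tables together one sketch
  of the doubled vector \<open>y \<circ> fst\<close>.\<close>

definition entry_move :: "'i \<times> bool \<Rightarrow> (nat \<times> real) pmf" where
  "entry_move j = (if snd j then high_move else low_move)"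

lemma card_subtable [simp]: "card (subtable u) = n0 * 2 ^ u"
proof -
  have "n0 * (2 ^ Suc u - 1) - n0 * (2 ^ u - 1) = n0 * ((2 ^ Suc u - 1) - (2 ^ u - 1))"
    by (simp add: diff_mult_distrib2)
  also have "(2 ^ Suc u - 1) - (2 ^ u - 1) = (2 ^ u :: nat)" by simp
  finally show ?thesis by (simp add: subtable_def)
qed

lemma subtable_subset: "u < J \<Longrightarrow> subtable u \<subseteq> {..<N0}"
proof -
  assume "u < J"
  then have "(2::nat) ^ Suc u \<le> 2 ^ J" by (intro power_increasing) auto
  then have "n0 * (2 ^ Suc u - 1) \<le> N0" unfolding N0_def by (intro mult_le_mono2 diff_le_mono)
  then show ?thesis by (auto simp: subtable_def)
qed

lemma subtable_finite: "finite (subtable u)" "subtable u \<noteq> {}"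
proof -
  show "finite (subtable u)" by (simp add: subtable_def)
  have "card (subtable u) > 0" using n0 by simp
  then show "subtable u \<noteq> {}" by (metis card.empty less_irrefl)
qed

lemma sum_levels_le: "(\<Sum>t\<in>{x0..x1}. 1 / 2 ^ t) \<le> (1 :: real)"
proof -
  have "(1::real) / 2 ^ t \<le> 1 / 2" if "t \<in> {x0..x1}" for t
    using x0 that power_increasing[of 1 t "2::real"] by (simp add: field_simps)
  then have "(\<Sum>t\<in>{x0..x1}. 1 / 2 ^ t) \<le> 2 * (1 / 2 :: real)"
    by (intro sum_inverse_powers_le) auto
  then show ?thesis by simp
qed

lemma pmf_level: "pmf level_pmf t = level_weight t"
proof -
  have nonneg: "level_weight t \<ge> 0" for t using sum_levels_le by (simp add: level_weight_def)
  have "(\<integral>\<^sup>+t. ennreal (level_weight t) \<partial>count_space UNIV) = (\<Sum>t\<in>insert 0 {x0..x1}. ennreal (level_weight t))"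
    by (intro nn_integral_count_space') (auto simp: level_weight_def)
  also have "\<dots> = ennreal (\<Sum>t\<in>insert 0 {x0..x1}. level_weight t)"
    using nonneg by (intro sum_ennreal)
  also have "(\<Sum>t\<in>insert 0 {x0..x1}. level_weight t) = level_weight 0 + (\<Sum>t\<in>{x0..x1}. 1 / 2 ^ t)"
    using x0 by (subst sum.insert) (auto simp: level_weight_def intro!: sum.cong)
  also have "\<dots> = 1" using x0 by (simp add: level_weight_def)
  finally show ?thesis unfolding level_pmf_def using nonneg by (intro pmf_embed_pmf) auto
qed

lemma set_level: "set_pmf level_pmf \<subseteq> insert 0 {x0..x1}"
  by (auto simp: set_pmf_eq pmf_level level_weight_def split: if_splits)

lemma finite_level: "finite (set_pmf level_pmf)"
  using set_level by (rule finite_subset) auto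

lemma expectation_level:
  fixes f :: "nat \<Rightarrow> real"
  assumes "f 0 = 0"
  shows "measure_pmf.expectation level_pmf f = (\<Sum>t\<in>{x0..x1}. f t / 2 ^ t)"
proof -
  have "measure_pmf.expectation level_pmf f = (\<Sum>t\<in>insert 0 {x0..x1}. level_weight t * f t)"
    using set_level by (subst integral_measure_pmf[of "insert 0 {x0..x1}"]) (auto simp: pmf_level)
  also have "\<dots> = (\<Sum>t\<in>{x0..x1}. level_weight t * f t)"
    using x0 assms by (subst sum.insert) auto
  finally show ?thesis by (simp add: level_weight_def)
qed

lemma expectation_low: "measure_pmf.expectation (pmf_of_set {..<J}) f = (\<Sum>u<J. f u) / J"
  using J by (subst integral_pmf_of_set) auto

text \<open>The 3 consists of 2 for the terms \<open>4 / N\<close> of the subtables that count, a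
  geometric sum with terms at most \<open>y\<close>, and of 1 for the losses in the remaining
  subtables, a geometric sum that starts with \<open>y / 2\<close>.\<close>

lemma low_gain:
  fixes K y :: real
  assumes K: "K > 0" "real n0 * K \<ge> 8" and y: "0 \<le> y" "y \<le> K"
  shows "y / J * (real (card {u\<in>{..<J}. 4 \<le> real n0 * 2 ^ u * y}) - 3)
    \<le> measure_pmf.expectation (pmf_of_set {..<J}) (\<lambda>u. gain_bound K (card (subtable u)) (1 * y))"
proof -
  define U where "U = {u\<in>{..<J}. 4 \<le> real n0 * 2 ^ u * y}"
  have Usub: "U \<subseteq> {..<J}" by (auto simp: U_def)
  have gU: "y - (4 / n0) / 2 ^ u \<le> gain_bound K (card (subtable u)) y" for u
    using y by (simp add: gain_bound_def field_simps)
  have gV: "- (y / 2) / 2 ^ u \<le> gain_bound K (card (subtable u)) y" for u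
  proof -
    have "- (y / 2) / 2 ^ u \<le> - 4 * y / (K * (n0 * 2 ^ u))"
    proof -
      have "8 * y \<le> (n0 * K) * y"
        using K(2) y by (intro mult_right_mono) auto
      then show ?thesis using K n0 by (simp add: field_simps)
    qed
    also have "\<dots> \<le> gain_bound K (card (subtable u)) y" using y by (simp add: gain_bound_def)
    finally show ?thesis .
  qed
  have s1: "(\<Sum>u\<in>U. (4 / n0) / 2 ^ u) \<le> 2 * y"
    using y n0 by (intro sum_inverse_powers_le) (auto simp: U_def field_simps)
  have s2: "(\<Sum>u\<in>{..<J} - U. (y / 2) / 2 ^ u) \<le> 2 * (y / 2)"
  proof (intro sum_inverse_powers_le)
    show "y / 2 / 2 ^ u \<le> y / 2" for u
      using divide_left_mono[of 1 "2 ^ u" "y / 2"] y by simp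
  qed (use y in auto)
  have "y * (real (card U) - 3) \<le> (card U * y - (\<Sum>u\<in>U. (4 / n0) / 2 ^ u)) - (\<Sum>u\<in>{..<J} - U. (y / 2) / 2 ^ u)"
    using s1 s2 by (simp add: algebra_simps)
  also have "\<dots> = (\<Sum>u\<in>U. y - (4 / n0) / 2 ^ u) + (\<Sum>u\<in>{..<J} - U. - (y / 2) / 2 ^ u)"
    by (simp add: sum_subtractf sum_negf)
  also have "\<dots> \<le> (\<Sum>u\<in>U. gain_bound K (card (subtable u)) y) + (\<Sum>u\<in>{..<J} - U. gain_bound K (card (subtable u)) y)"
    using gU gV by (intro add_mono sum_mono) auto
  also have "\<dots> = (\<Sum>u<J. gain_bound K (card (subtable u)) y)"
    by (simp add: sum.subset_diff[OF Usub])
  finally have "y * (real (card U) - 3) / J \<le> (\<Sum>u<J. gain_bound K (card (subtable u)) y) / J"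
    by (intro divide_right_mono) auto
  then show ?thesis unfolding expectation_low by (simp add: U_def)
qed

text \<open>Again 2 is the geometric sum of the terms \<open>4 / N1\<close> over the levels that
  count. The other levels lose at most \<open>4 * y / (J * K * N1)\<close> each, and
  \<open>N1 * K\<close> is at least 4 times their number; this is the remaining 1. A clipped entry
  loses nothing, since \<open>N1 * K \<ge> 4\<close>.\<close>

lemma high_gain:
  fixes K y :: real
  assumes K: "K > 0" "real N1 * K \<ge> 4 * real (Suc x1 - x0)" "real N1 * K \<ge> 4" and y: "0 \<le> y"
  shows "y / J * (real (card {t\<in>{x0..x1}. 4 * real J \<le> real N1 * 2 ^ t * y \<and> 2 ^ t * y \<le> K * J}) - 3)
    \<le> measure_pmf.expectation level_pmf (\<lambda>t. gain_bound K (card {N0..<N0 + N1}) (level_scale t * y))"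
proof -
  define X where "X = Suc x1 - x0"
  define T where "T = {t\<in>{x0..x1}. 4 * real J \<le> real N1 * 2 ^ t * y \<and> 2 ^ t * y \<le> K * J}"
  have Tsub: "T \<subseteq> {x0..x1}" by (auto simp: T_def)
  define g where "g t = gain_bound K N1 (2 ^ t * y / J) / 2 ^ t" for t
  have gT: "y / J - (4 / N1) / 2 ^ t \<le> g t" if "t \<in> T" for t
  proof -
    have "2 ^ t * y / J \<le> K" using that J by (simp add: T_def field_simps)
    then have "2 ^ t * y / J - 4 / N1 \<le> gain_bound K N1 (2 ^ t * y / J)" by (simp add: gain_bound_def)
    then have "(2 ^ t * y / J - 4 / N1) / 2 ^ t \<le> g t" unfolding g_def by (intro divide_right_mono) auto
    then show ?thesis by (simp add: diff_divide_distrib)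
  qed
  have gV: "- (4 * y / (J * K * N1)) \<le> g t" for t
  proof (cases "2 ^ t * y / J \<le> K")
    case True
    then have "- 4 * (2 ^ t * y / J) / (K * N1) \<le> gain_bound K N1 (2 ^ t * y / J)" by (simp add: gain_bound_def)
    then have "- 4 * (2 ^ t * y / J) / (K * N1) / 2 ^ t \<le> g t" unfolding g_def by (intro divide_right_mono) auto
    moreover have "- 4 * (2 ^ t * y / J) / (K * N1) / 2 ^ t = - (4 * y / (J * K * N1))" by simp
    ultimately show ?thesis by simp
  next
    case False
    then have "K - 4 / N1 \<le> gain_bound K N1 (2 ^ t * y / J)" by (simp add: gain_bound_def)
    moreover have "0 \<le> K - 4 / N1" using K N1 by (simp add: field_simps)
    ultimately have "0 \<le> g t" by (simp add: g_def)
    moreover have "0 \<le> 4 * y / (J * K * N1)" using y K by simp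
    ultimately show ?thesis by linarith
  qed
  have s1: "(\<Sum>t\<in>T. (4 / N1) / 2 ^ t) \<le> 2 * (y / J)"
    using y N1 J by (intro sum_inverse_powers_le) (auto simp: T_def field_simps)
  have s2: "real (card ({x0..x1} - T)) * (4 * y / (J * K * N1)) \<le> y / J"
  proof -
    have "card ({x0..x1} - T) \<le> card {x0..x1}" by (intro card_mono) auto
    then have "real (card ({x0..x1} - T)) \<le> X" by (simp add: X_def)
    then have "real (card ({x0..x1} - T)) * (4 * y / (J * K * N1)) \<le> X * (4 * y / (J * K * N1))"
      using y K by (intro mult_right_mono) auto
    also have "\<dots> = (4 * X) / (N1 * K) * (y / J)" by (simp add: mult_ac)
    also have "\<dots> \<le> 1 * (y / J)" using K y N1 by (intro mult_right_mono) (auto simp: X_def field_simps)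
    finally show ?thesis by simp
  qed
  have "y / J * (real (card T) - 3) \<le> (card T * (y / J) - (\<Sum>t\<in>T. (4 / N1) / 2 ^ t)) - real (card ({x0..x1} - T)) * (4 * y / (J * K * N1))"
  proof -
    have "y / J * (real (card T) - 3) = card T * (y / J) - 3 * (y / J)"
      by (simp add: algebra_simps diff_divide_distrib)
    moreover define v where "v = y / J"
    ultimately show ?thesis using s1 s2 unfolding v_def[symmetric] by linarith
  qed
  also have "\<dots> = (\<Sum>t\<in>T. y / J - (4 / N1) / 2 ^ t) + (\<Sum>t\<in>{x0..x1} - T. - (4 * y / (J * K * N1)))"
    by (simp add: sum_subtractf)
  also have "\<dots> \<le> (\<Sum>t\<in>T. g t) + (\<Sum>t\<in>{x0..x1} - T. g t)"
    using gT gV by (intro add_mono sum_mono) auto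
  also have "\<dots> = (\<Sum>t\<in>{x0..x1}. g t)"
    by (simp add: sum.subset_diff[OF Tsub])
  also have "\<dots> = measure_pmf.expectation level_pmf (\<lambda>t. gain_bound K (card {N0..<N0 + N1}) (level_scale t * y))"
    using x0 K by (subst expectation_level) (auto simp: level_scale_def gain_bound_def g_def intro!: sum.cong)
  finally show ?thesis by (simp add: T_def)
qed

text \<open>Without clipping, the rarest level would dominate. With it, the terms grow geometrically
  until \<open>2 ^ t * y\<close> reaches \<open>K * J\<close> and decay afterwards, and either side
  sums to at most twice \<open>K * y / J\<close>.\<close>

lemma high_second_moment:
  fixes K y :: real
  assumes K: "K > 0" and y: "0 \<le> y"
  shows "measure_pmf.expectation level_pmf (\<lambda>t. (min (level_scale t * y) K)\<^sup>2) \<le> 4 * K * y / J"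
proof -
  define T where "T = {t\<in>{x0..x1}. 2 ^ t * y \<le> K * J}"
  define g where "g t = (min (2 ^ t * y / J) K)\<^sup>2 / 2 ^ t" for t
  have "(\<Sum>t\<in>T. g t) = (\<Sum>t\<in>T. ((y / J)\<^sup>2) * 2 ^ t)"
  proof (intro sum.cong refl)
    fix t assume "t \<in> T"
    then have "2 ^ t * y / J \<le> K" using J by (simp add: T_def field_simps)
    then have "g t = (2 ^ t * y / J)\<^sup>2 / 2 ^ t" by (simp add: g_def)
    then show "g t = ((y / J)\<^sup>2) * 2 ^ t" by (simp add: power2_eq_square)
  qed
  also have "\<dots> \<le> 2 * (K * y / J)"
  proof (intro sum_powers_le)
    fix t assume t: "t \<in> T"
    then have "2 ^ t * y / J \<le> K" using J by (simp add: T_def field_simps)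
    then have "(2 ^ t * y / J) * (y / J) \<le> K * (y / J)" using y by (intro mult_right_mono) auto
    then show "(y / J)\<^sup>2 * 2 ^ t \<le> K * y / J" by (simp add: power2_eq_square mult_ac)
  qed (use K y in \<open>auto simp: T_def\<close>)
  finally have 1: "(\<Sum>t\<in>T. g t) \<le> 2 * (K * y / J)" .
  have "(\<Sum>t\<in>{x0..x1} - T. g t) \<le> (\<Sum>t\<in>{x0..x1} - T. K\<^sup>2 / 2 ^ t)"
  proof (intro sum_mono)
    fix t
    have "min (2 ^ t * y / J) K \<le> K" "0 \<le> min (2 ^ t * y / J) K" using K y by auto
    then show "g t \<le> K\<^sup>2 / 2 ^ t" unfolding g_def by (intro divide_right_mono power_mono) auto
  qed
  also have "\<dots> \<le> 2 * (K * y / J)"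
  proof (intro sum_inverse_powers_le)
    fix t assume t: "t \<in> {x0..x1} - T"
    then have "K * J \<le> 2 ^ t * y" by (auto simp: T_def)
    then have "K * (K * J) \<le> K * (2 ^ t * y)" using K by (intro mult_left_mono) auto
    then show "K\<^sup>2 / 2 ^ t \<le> K * y / J" using J by (simp add: field_simps power2_eq_square)
  qed (use K y in auto)
  finally have 2: "(\<Sum>t\<in>{x0..x1} - T. g t) \<le> 2 * (K * y / J)" .
  have "measure_pmf.expectation level_pmf (\<lambda>t. (min (level_scale t * y) K)\<^sup>2) = (\<Sum>t\<in>{x0..x1}. g t)"
    using x0 K by (subst expectation_level) (auto simp: level_scale_def g_def intro!: sum.cong)
  also have "\<dots> = (\<Sum>t\<in>{x0..x1} - T. g t) + (\<Sum>t\<in>T. g t)"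
    by (intro sum.subset_diff) (auto simp: T_def)
  finally show ?thesis using 1 2 by simp
qed

text \<open>The subtables cover the scales of \<open>y\<close> that the levels of the second table miss.\<close>

lemma coverage:
  fixes K y :: real
  assumes y: "y > 0" and K: "K > 0" "real n0 * K \<ge> 8"
    and N1K: "real N1 * K \<ge> 4 * 2 ^ J" and x0K: "4 * 2 ^ x0 \<le> K * J * n0" and x1: "K * J < 2 ^ Suc x1 * y"
  shows "J \<le> card {u\<in>{..<J}. 4 \<le> real n0 * 2 ^ u * y} +
    card {t\<in>{x0..x1}. 4 * real J \<le> real N1 * 2 ^ t * y \<and> 2 ^ t * y \<le> K * J}" (is "J \<le> card ?U + card ?T")
proof -
  have J1: "real J \<ge> 1" using J by simp
  have U_all: "J \<le> card ?U" if "4 \<le> real n0 * y"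
  proof -
    have "4 \<le> real n0 * 2 ^ u * y" for u
    proof -
      have "4 \<le> (real n0 * y) * 1" using that by simp
      also have "\<dots> \<le> (real n0 * y) * 2 ^ u" using y by (intro mult_left_mono) auto
      finally show ?thesis by (simp add: mult_ac)
    qed
    then show ?thesis by simp
  qed
  show ?thesis
  proof (cases "y \<le> K * J")
    case False
    have "8 * 1 \<le> (real n0 * K) * real J" using K J1 by (intro mult_mono) auto
    also have "\<dots> \<le> real n0 * y" using False by (simp add: mult.assoc mult_left_mono)
    finally show ?thesis using U_all by simp
  next
    case True
    \<comment> \<open>\<open>g\<close> is the last level at which the scaled entry is not clipped.
      By \<open>N1K\<close>, the entry is still large enough to count at each of the
      \<open>J\<close> levels that end with \<open>g\<close>.\<close>
    define g where "g = (GREATEST t. 2 ^ t * y \<le> K * J)"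
    have bound: "t \<le> x1" if "2 ^ t * y \<le> K * J" for t
    proof (rule ccontr)
      assume "\<not> t \<le> x1"
      then have "(2::real) ^ Suc x1 \<le> 2 ^ t" by (intro power_increasing) auto
      then have "2 ^ Suc x1 * y \<le> 2 ^ t * y" using y by (intro mult_right_mono) auto
      then show False using that x1 by linarith
    qed
    have g: "2 ^ g * y \<le> K * J"
      unfolding g_def by (rule GreatestI_nat[of _ 0 x1]) (use True bound in auto)
    have gmax: "t \<le> g" if "2 ^ t * y \<le> K * J" for t
      unfolding g_def using that bound by (intro Greatest_le_nat[of _ _ x1]) auto
    have g': "K * J < 2 ^ Suc g * y" using gmax[of "Suc g"] by force
    have T: "t \<in> ?T" if "x0 \<le> t" "t \<le> g" "Suc g \<le> t + J" for t
    proof -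
      have le: "2 ^ t * y \<le> K * J"
      proof -
        have "2 ^ t * y \<le> 2 ^ g * y" using that y by (intro mult_right_mono power_increasing) auto
        then show ?thesis using g by simp
      qed
      have "4 * 2 ^ J * real J \<le> (real N1 * K) * J" using N1K by (intro mult_right_mono) auto
      also have "\<dots> \<le> real N1 * (2 ^ Suc g * y)" using g' by (simp add: mult.assoc mult_left_mono)
      also have "\<dots> \<le> real N1 * (2 ^ (t + J) * y)"
        using that y by (intro mult_left_mono mult_right_mono power_increasing) auto
      finally have "4 * real J * 2 ^ J \<le> (real N1 * 2 ^ t * y) * 2 ^ J" by (simp add: power_add mult_ac)
      then have "4 * real J \<le> real N1 * 2 ^ t * y" by simp
      then show ?thesis using that le bound[OF le] by simp
    qed
    show ?thesis
    proof (cases "x0 + J \<le> Suc g")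
      case True
      have "{Suc g - J..g} \<subseteq> ?T" using True by (intro subsetI T) auto
      from card_mono[OF _ this] True show ?thesis by simp
    next
      case False
      have key: "4 * (2 ^ x0 / 2 ^ Suc g) < real n0 * y"
      proof -
        have "4 * 2 ^ x0 \<le> K * J * n0" by (rule x0K)
        also have "\<dots> < 2 ^ Suc g * y * n0" using g' n0 by (intro mult_strict_right_mono) auto
        finally show ?thesis by (simp add: field_simps)
      qed
      show ?thesis
      proof (cases "x0 \<le> Suc g")
        case True
        \<comment> \<open>Only \<open>k\<close> of these levels are at least \<open>x0\<close>. The
          \<open>J - k\<close> largest subtables replace the others; they have enough buckets
          because \<open>x0K\<close> ties \<open>x0\<close> to \<open>n0\<close>.\<close>
        define k where "k = Suc g - x0"
        have k: "k \<le> J" using False by (simp add: k_def)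
        have "{x0..g} \<subseteq> ?T" using False by (intro subsetI T) auto
        from card_mono[OF _ this] True have cT: "k \<le> card ?T" by (simp add: k_def)
        have U: "u \<in> ?U" if "k \<le> u" "u < J" for u
        proof -
          have "(2::real) ^ Suc g = 2 ^ x0 * 2 ^ k" using True by (simp add: k_def flip: power_add)
          then have "4 / 2 ^ k < real n0 * y" using key by simp
          then have "4 \<le> real n0 * y * 2 ^ k" by (simp add: field_simps)
          also have "\<dots> \<le> real n0 * y * 2 ^ u" using that y by (intro mult_left_mono power_increasing) auto
          finally show ?thesis using that by (simp add: mult_ac)
        qed
        have "{k..<J} \<subseteq> ?U" by (intro subsetI U) auto
        from card_mono[OF _ this] have "J - k \<le> card ?U" by simp
        then show ?thesis using cT k by simp
      next
        case False
        then have "(1::real) \<le> 2 ^ x0 / 2 ^ Suc g"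
          using power_increasing[of "Suc g" x0 "2::real"] by (simp add: field_simps)
        then have "4 \<le> real n0 * y" using key by linarith
        then show ?thesis using U_all by simp
      qed
    qed
  qed
qed

section \<open>Range of the moves and collisions in the first table\<close>

lemma finite_low_move: "finite (set_pmf low_move)"
  unfolding low_move_def using J subtable_finite by (intro finite_set_move) (auto simp: set_pmf_of_set lessThan_empty_iff)

lemma finite_high_move: "finite (set_pmf high_move)"
  unfolding high_move_def using N1 finite_level by (intro finite_set_move) auto

lemma finite_entry_move: "finite (set_pmf (entry_move j))"
  by (simp add: entry_move_def finite_low_move finite_high_move)

lemma low_moveD:
  assumes "v \<in> set_pmf low_move"
  shows "fst v < N0" "\<bar>snd v\<bar> = 1"
proof -
  obtain u where "u < J" "fst v \<in> subtable u" "\<bar>snd v\<bar> = 1"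
    using set_moveD[of "pmf_of_set {..<J}" subtable v "\<lambda>_. 1"] assms J subtable_finite
    by (auto simp: low_move_def set_pmf_of_set lessThan_empty_iff)
  then show "fst v < N0" "\<bar>snd v\<bar> = 1" using subtable_subset by auto
qed

lemma high_moveD:
  assumes "v \<in> set_pmf high_move"
  obtains t where "t \<in> insert 0 {x0..x1}" "fst v \<in> {N0..<N0 + N1}" "\<bar>snd v\<bar> = level_scale t"
proof -
  obtain t where "t \<in> set_pmf level_pmf" "fst v \<in> {N0..<N0 + N1}" "\<bar>snd v\<bar> = \<bar>level_scale t\<bar>"
    using set_moveD[of level_pmf "\<lambda>_. {N0..<N0 + N1}" v level_scale] assms N1 finite_level
    by (auto simp: high_move_def)
  then show thesis using set_level by (intro that[of t]) (auto simp: level_scale_def)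
qed

lemma low_move_bucket: "measure_pmf.expectation low_move (\<lambda>v. of_bool (b = fst v)) \<le> 1 / real n0"
proof -
  have "measure_pmf.expectation low_move (\<lambda>v. of_bool (b = fst v)) =
    measure_pmf.expectation (pmf_of_set {..<J}) (\<lambda>u. (\<Sum>b'\<in>subtable u. of_bool (b = b')) / card (subtable u))"
    unfolding low_move_def using J subtable_finite
    by (subst expectation_move) (auto simp: set_pmf_of_set lessThan_empty_iff)
  also have "\<dots> \<le> measure_pmf.expectation (pmf_of_set {..<J}) (\<lambda>u. 1 / real n0)"
  proof (intro expectation_mono)
    fix u
    have "(\<Sum>b'\<in>subtable u. of_bool (b = b')) \<le> (1 :: real)"
      using subtable_finite(1)[of u] by (simp add: of_bool_def)
    then have "(\<Sum>b'\<in>subtable u. of_bool (b = b')) / card (subtable u) \<le> 1 / (real n0 * 2 ^ u)"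
      using n0 by (simp add: divide_right_mono)
    also have "\<dots> \<le> 1 / real n0" using n0 by (simp add: field_simps)
    finally show "(\<Sum>b'\<in>subtable u. of_bool (b = b')) / card (subtable u) \<le> 1 / real n0" .
  qed (use J in \<open>auto simp: set_pmf_of_set lessThan_empty_iff\<close>)
  finally show ?thesis by simp
qed

text \<open>The loss is measured by the bounds \<open>l i\<close> instead of the entries of a
  vector, so that one event serves all vectors of the subspace.\<close>

definition collision_loss :: "'i set \<Rightarrow> ('i \<Rightarrow> real) \<Rightarrow> ('i \<times> bool \<Rightarrow> nat \<times> real) \<Rightarrow> real" where
  "collision_loss H l \<psi> =
     (\<Sum>i\<in>H. if \<exists>i'\<in>H. i' \<noteq> i \<and> fst (\<psi> (i', False)) = fst (\<psi> (i, False)) then l i else 0)"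

text \<open>Two entries meet with probability at most \<open>1 / n0\<close>, as the smallest
  subtable has \<open>n0\<close> buckets; the rest is a sum over pairs.\<close>

lemma expectation_collision_loss:
  fixes l :: "'i \<Rightarrow> real"
  assumes I: "finite I" "H \<subseteq> I" and l: "\<And>i. i \<in> H \<Longrightarrow> 0 \<le> l i"
  shows "measure_pmf.expectation (Pi_pmf (I \<times> UNIV) d entry_move) (collision_loss H l) \<le> sum l H * card H / n0"
proof -
  let ?P = "Pi_pmf (I \<times> UNIV) d entry_move"
  have finI: "finite (I \<times> (UNIV :: bool set))" using I by simp
  have finP: "finite (set_pmf ?P)" by (intro finite_set_Pi_pmf finI finite_entry_move)
  have finH: "finite H" using I finite_subset by blast
  have pair: "measure_pmf.expectation ?P (\<lambda>\<psi>. of_bool (fst (\<psi> (i', False)) = fst (\<psi> (i, False)))) \<le> 1 / n0"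
    if ii: "i \<in> H" "i' \<in> H" "i' \<noteq> i" for i i'
  proof -
    define A where "A = I \<times> UNIV - {(i, False)}"
    have A: "I \<times> UNIV = insert (i, False) A" "(i, False) \<notin> A" "finite A"
      using ii I finI by (auto simp: A_def)
    have finA: "finite (set_pmf (Pi_pmf A d entry_move))"
      by (intro finite_set_Pi_pmf finite_entry_move A)
    have "measure_pmf.expectation ?P (\<lambda>\<psi>. of_bool (fst (\<psi> (i', False)) = fst (\<psi> (i, False))) :: real) =
      measure_pmf.expectation (Pi_pmf A d entry_move) (\<lambda>\<psi>. measure_pmf.expectation low_move (\<lambda>v. of_bool (fst (\<psi> (i', False)) = fst v)))"
    proof -
      have "measure_pmf.expectation (Pi_pmf (insert (i, False) A) d entry_move) (\<lambda>\<psi>. of_bool (fst (\<psi> (i', False)) = fst (\<psi> (i, False))) :: real) =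
        measure_pmf.expectation (Pi_pmf A d entry_move) (\<lambda>\<psi>. measure_pmf.expectation (entry_move (i, False))
          (\<lambda>v. of_bool (fst ((\<psi>((i, False) := v)) (i', False)) = fst ((\<psi>((i, False) := v)) (i, False)))))"
        by (rule expectation_Pi_insert[OF A(3,2)]) (rule finite_entry_move)
      then show ?thesis unfolding A(1) using ii(3) by (simp add: entry_move_def)
    qed
    also have "\<dots> \<le> measure_pmf.expectation (Pi_pmf A d entry_move) (\<lambda>_. 1 / n0)"
      by (intro expectation_mono finA low_move_bucket)
    finally show ?thesis by simp
  qed
  have "measure_pmf.expectation ?P (collision_loss H l) \<le>
     measure_pmf.expectation ?P (\<lambda>\<psi>. \<Sum>i\<in>H. \<Sum>i'\<in>H - {i}. l i * of_bool (fst (\<psi> (i', False)) = fst (\<psi> (i, False))))"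
  proof (intro expectation_mono finP)
    fix \<psi>
    show "collision_loss H l \<psi> \<le> (\<Sum>i\<in>H. \<Sum>i'\<in>H - {i}. l i * of_bool (fst (\<psi> (i', False)) = fst (\<psi> (i, False))))"
      unfolding collision_loss_def
    proof (intro sum_mono)
      fix i assume i: "i \<in> H"
      show "(if \<exists>i'\<in>H. i' \<noteq> i \<and> fst (\<psi> (i', False)) = fst (\<psi> (i, False)) then l i else 0)
        \<le> (\<Sum>i'\<in>H - {i}. l i * of_bool (fst (\<psi> (i', False)) = fst (\<psi> (i, False))))"
      proof (cases "\<exists>i'\<in>H. i' \<noteq> i \<and> fst (\<psi> (i', False)) = fst (\<psi> (i, False))")
        case True
        then obtain i' where i': "i' \<in> H - {i}" "fst (\<psi> (i', False)) = fst (\<psi> (i, False))" by blast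
        have "l i = l i * of_bool (fst (\<psi> (i', False)) = fst (\<psi> (i, False)))" using i' by simp
        also have "\<dots> \<le> (\<Sum>i'\<in>H - {i}. l i * of_bool (fst (\<psi> (i', False)) = fst (\<psi> (i, False))))"
          using i' l[OF i] finH by (intro member_le_sum) auto
        finally show ?thesis using True by simp
      next
        case False
        then show ?thesis using l[OF i] by (simp only: if_False) (intro sum_nonneg, simp)
      qed
    qed
  qed
  also have "\<dots> = (\<Sum>i\<in>H. \<Sum>i'\<in>H - {i}. l i * measure_pmf.expectation ?P (\<lambda>\<psi>. of_bool (fst (\<psi> (i', False)) = fst (\<psi> (i, False)))))"
    by (simp add: expectation_sum[OF finP])
  also have "\<dots> \<le> (\<Sum>i\<in>H. \<Sum>i'\<in>H - {i}. l i * (1 / n0))"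
    using pair l by (intro sum_mono mult_left_mono) auto
  also have "\<dots> \<le> (\<Sum>i\<in>H. card H * (l i * (1 / n0)))"
  proof (intro sum_mono)
    fix i assume i: "i \<in> H"
    have "card (H - {i}) \<le> card H" using finH by (intro card_mono) auto
    then show "(\<Sum>i'\<in>H - {i}. l i * (1 / n0)) \<le> card H * (l i * (1 / n0))"
      using l[OF i] by (simp add: divide_right_mono mult_right_mono)
  qed
  also have "\<dots> = sum l H * card H / n0"
    by (simp add: sum_distrib_left sum_distrib_right sum_divide_distrib mult_ac)
  finally show ?thesis .
qed

end

text \<open>The entries in \<open>H\<close> are those that can be so large that the sampling arguments do not apply to
  them. They are only required not to collide with each other much in the first table.\<close>

locale sketching_lower = sketching_scheme +
  fixes I H :: "'i set" and l :: "'i \<Rightarrow> real" and K0 s K :: real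
  assumes I: "finite I" "I \<noteq> {}" and H: "H \<subseteq> I"
    and s: "0 < s" "1 / s \<le> real J" "6 / J + 2 * s \<le> 1"
    and K0: "0 < K0" and K: "K = K0 / s"
    and n0K: "real n0 * K \<ge> 8" and N1K: "real N1 * K \<ge> 4 * 2 ^ J" "real N1 * K \<ge> 4 * real (Suc x1 - x0)"
    and x0K: "4 * 2 ^ x0 \<le> K * J * n0" and x1K: "K * J < 2 ^ Suc x1 * (s / card I)"
begin

abbreviation (input) "M \<equiv> I \<times> (UNIV :: bool set)"
abbreviation (input) "P d \<equiv> Pi_pmf M d entry_move"

text \<open>The largest value with \<open>\<theta> * K \<le> 1 / 4\<close>. A deficit of
  \<open>s\<close> in the norm then has the exponent
  \<open>\<theta> * s = s^2 / (4 * K0)\<close>.\<close>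

definition "\<theta> = 1 / (4 * K)"

lemma K_pos: "K > 0" using K0 s by (simp add: K)

lemma s_le: "s \<le> 1/2"
proof -
  have "6 / real J \<ge> 0" by simp
  then show ?thesis using s(3) by linarith
qed

lemma K0_le: "K0 \<le> K" using K0 s s_le by (simp add: K field_simps)

lemma \<theta>K0: "\<theta> * K0 = s / 4"
  unfolding \<theta>_def unfolding K using K0 s by simp

lemma \<theta>K0z: "4 * \<theta> * K0 * z = s * z" "\<theta> * K0 * z = s * z / 4"
proof -
  have "4 * \<theta> * K0 * z = 4 * (\<theta> * K0) * z" by simp
  then show "4 * \<theta> * K0 * z = s * z" unfolding \<theta>K0 by simp
  show "\<theta> * K0 * z = s * z / 4" unfolding \<theta>K0 by simp
qed

lemma \<theta>_pos: "0 < \<theta>" using K_pos by (simp add: \<theta>_def)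

lemma KJ: "K / J \<le> K0"
proof -
  have "1 \<le> s * J" using s(1,2) by (simp add: field_simps)
  then have "K0 * 1 \<le> K0 * (s * J)" using K0 by (intro mult_left_mono) auto
  then show ?thesis using s(1) J by (simp add: K field_simps)
qed

lemma finite_M: "finite M" using I by simp

lemma finite_P: "finite (set_pmf (P d))"
  by (intro finite_set_Pi_pmf finite_M finite_entry_move)

definition "low_count y = card {u\<in>{..<J}. 4 \<le> real n0 * 2 ^ u * y}"
definition "high_count y = card {t\<in>{x0..x1}. 4 * real J \<le> real N1 * 2 ^ t * y \<and> 2 ^ t * y \<le> K * J}"

text \<open>The \<open>\<gamma>\<close> of \<open>move_step\<close>: expected growth minus quadratic
  correction. The second moment is bounded linearly in \<open>z\<close>, by
  \<open>4 * K0 * z\<close> in the second table because \<open>K / J \<le> K0\<close>, and by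
  \<open>K0 * z\<close> for light entries in the first one.\<close>

definition gain :: "('i \<Rightarrow> real) \<Rightarrow> 'i \<times> bool \<Rightarrow> real" where
  "gain y j = (let z = \<bar>y (fst j)\<bar> in
     if snd j then z / J * (real (high_count z) - 3) - 4 * \<theta> * K0 * z
     else z / J * (real (low_count z) - 3) - \<theta> * K0 * z)"

lemma entry_move_step:
  assumes "snd j \<or> \<bar>y (fst j)\<bar> \<le> K0"
  shows "measure_pmf.expectation (entry_move j)
      (\<lambda>v. exp (- \<theta> * clipped_norm N0 K (N0 + N1) (x(fst v := x (fst v) + snd v * y (fst j))))) \<le>
    exp (- \<theta> * gain y j) * exp (- \<theta> * clipped_norm N0 K (N0 + N1) x) + 2 * exp (- 2 * \<theta>)"
proof (cases "snd j")
  case True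
  let ?z = "\<bar>y (fst j)\<bar>"
  have "gain y j = ?z / J * (real (high_count ?z) - 3) - \<theta> * (4 * K0 * ?z)"
    using True by (simp add: gain_def Let_def)
  also have "\<dots> \<le> measure_pmf.expectation level_pmf (\<lambda>t. gain_bound K (card {N0..<N0 + N1}) (level_scale t * ?z))
      - \<theta> * measure_pmf.expectation level_pmf (\<lambda>t. (min (level_scale t * ?z) K)\<^sup>2)"
  proof -
    have "real N1 * K \<ge> 4" using N1K(1) one_le_power[of "2::real" J] by linarith
    then have 1: "?z / J * (real (high_count ?z) - 3) \<le> measure_pmf.expectation level_pmf (\<lambda>t. gain_bound K (card {N0..<N0 + N1}) (level_scale t * ?z))"
      unfolding high_count_def using K_pos N1K by (intro high_gain) auto
    have "measure_pmf.expectation level_pmf (\<lambda>t. (min (level_scale t * ?z) K)\<^sup>2) \<le> 4 * K * ?z / J"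
      using K_pos by (intro high_second_moment) auto
    also have "\<dots> = 4 * ?z * (K / J)" by simp
    also have "\<dots> \<le> 4 * ?z * K0" using KJ by (intro mult_left_mono) auto
    finally have "\<theta> * measure_pmf.expectation level_pmf (\<lambda>t. (min (level_scale t * ?z) K)\<^sup>2) \<le> \<theta> * (4 * K0 * ?z)"
      using \<theta>_pos by (intro mult_left_mono) (auto simp: mult_ac)
    then show ?thesis using 1 by linarith
  qed
  finally have \<gamma>: "gain y j \<le> \<dots>" .
  show ?thesis
    unfolding entry_move_def if_P[OF True] high_move_def
    by (rule move_step[OF finite_level _ _ K_pos _ _ _ \<gamma>])
       (use N1 \<theta>_pos K_pos in \<open>auto simp: level_scale_def \<theta>_def\<close>)
next
  case False
  let ?z = "\<bar>y (fst j)\<bar>"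
  have z: "?z \<le> K0" using assms False by auto
  have fin: "finite (set_pmf (pmf_of_set {..<J}))" using J by (auto simp: set_pmf_of_set lessThan_empty_iff)
  have setJ: "set_pmf (pmf_of_set {..<J}) = {..<J}" using J by (intro set_pmf_of_set) auto
  have "gain y j = ?z / J * (real (low_count ?z) - 3) - \<theta> * (K0 * ?z)"
    using False by (simp add: gain_def Let_def)
  also have "\<dots> \<le> measure_pmf.expectation (pmf_of_set {..<J}) (\<lambda>u. gain_bound K (card (subtable u)) (1 * ?z))
      - \<theta> * measure_pmf.expectation (pmf_of_set {..<J}) (\<lambda>u. (min (1 * ?z) K)\<^sup>2)"
  proof -
    have 1: "?z / J * (real (low_count ?z) - 3) \<le> measure_pmf.expectation (pmf_of_set {..<J}) (\<lambda>u. gain_bound K (card (subtable u)) (1 * ?z))"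
      unfolding low_count_def using K_pos n0K z K0_le by (intro low_gain) auto
    have "(min (1 * ?z) K)\<^sup>2 \<le> K0 * ?z"
    proof -
      have "?z * ?z \<le> K0 * ?z" using z by (intro mult_right_mono) auto
      then show ?thesis using z K0_le by (simp add: power2_eq_square)
    qed
    then have "\<theta> * (min (1 * ?z) K)\<^sup>2 \<le> \<theta> * (K0 * ?z)"
      using \<theta>_pos by (intro mult_left_mono) auto
    then show ?thesis using 1 by simp
  qed
  finally have \<gamma>: "gain y j \<le> \<dots>" .
  show ?thesis
    unfolding entry_move_def if_not_P[OF False] low_move_def
  proof (rule move_step[OF fin _ _ K_pos _ _ _ \<gamma>])
    show "finite (subtable c) \<and> subtable c \<noteq> {} \<and> subtable c \<subseteq> {..<N0 + N1}" if "c \<in> set_pmf (pmf_of_set {..<J})" for c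
      using that subtable_finite[of c] subtable_subset[of c] unfolding setJ by auto
  qed (use \<theta>_pos K_pos z K0_le in \<open>auto simp: \<theta>_def\<close>)
qed

lemma gain_lower: "- \<bar>y (fst j)\<bar> * (3 / J + s) \<le> gain y j"
proof -
  define z where "z = \<bar>y (fst j)\<bar>"
  have z: "0 \<le> s * z" using s(1) by (simp add: z_def)
  have c: "- z * (3 / J) \<le> z / J * (real c - 3)" for c
    by (simp add: z_def algebra_simps diff_divide_distrib)
  show ?thesis
    using c[of "high_count z"] c[of "low_count z"] z
    unfolding gain_def Let_def \<theta>K0z z_def[symmetric] by (auto simp: algebra_simps)
qed

text \<open>By \<open>coverage\<close> both copies together count in at least \<open>J\<close>
  tables and levels, and each copy loses 3 of them. The lower bound on the entry ensures that the
  levels up to \<open>x1\<close> suffice. The quadratic corrections of the two copies are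
  \<open>s / 4\<close> and \<open>s\<close>.\<close>

lemma gain_pair:
  assumes "s / card I \<le> \<bar>y i\<bar>"
  shows "\<bar>y i\<bar> * (1 - 6 / J - 5 / 4 * s) \<le> gain y (i, False) + gain y (i, True)"
proof -
  let ?z = "\<bar>y i\<bar>"
  have "s / card I > 0" using s I by (simp add: card_gt_0_iff)
  then have z: "?z > 0" using assms by linarith
  have "2 ^ Suc x1 * (s / card I) \<le> 2 ^ Suc x1 * ?z" using assms by (intro mult_left_mono) auto
  then have "K * J < 2 ^ Suc x1 * ?z" using x1K by linarith
  from coverage[OF z K_pos n0K N1K(1) x0K this] have "J \<le> low_count ?z + high_count ?z"
    by (simp add: low_count_def high_count_def)
  then have "real J \<le> real (low_count ?z) + real (high_count ?z)" by linarith
  then have "?z / J * (real J - 6) \<le> ?z / J * (real (low_count ?z) - 3 + (real (high_count ?z) - 3))"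
    by (intro mult_left_mono) auto
  moreover have "?z / J * (real J - 6) = ?z * (1 - 6 / J)" using J by (simp add: field_simps)
  ultimately show ?thesis unfolding gain_def Let_def \<theta>K0z by (simp add: algebra_simps)
qed

text \<open>A heavy entry that shares its bucket with no other heavy one contributes its full size,
  as the first table is not clipped; the others are charged to
  \<open>collision_loss\<close>.\<close>

lemma heavy_sketch:
  assumes "\<psi> \<in> set_pmf (Pi_pmf (H \<times> {False}) d entry_move)" and l: "\<And>i. i \<in> H \<Longrightarrow> \<bar>y i\<bar> \<le> l i"
  shows "(\<Sum>i\<in>H. \<bar>y i\<bar>) - collision_loss H l \<psi> \<le> clipped_norm N0 K (N0 + N1) (sketch (H \<times> {False}) (y \<circ> fst) \<psi>)"
proof -
  let ?x = "sketch (H \<times> {False}) (y \<circ> fst) \<psi>"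
  have finH: "finite H" using I H finite_subset by blast
  have \<psi>: "\<psi> (i, False) \<in> set_pmf low_move" if "i \<in> H" for i
    using assms(1) that finH by (subst (asm) set_Pi_pmf) (auto simp: PiE_dflt_def entry_move_def)
  define b where "b i = fst (\<psi> (i, False))" for i
  define S where "S = {i\<in>H. \<not> (\<exists>i'\<in>H. i' \<noteq> i \<and> b i' = b i)}"
  have S: "S \<subseteq> H" "inj_on b S" by (auto simp: S_def inj_on_def)
  have xb: "\<bar>?x (b i)\<bar> = \<bar>y i\<bar>" if "i \<in> S" for i
  proof -
    have "?x (b i) = (\<Sum>j\<in>H \<times> {False}. if j = (i, False) then snd (\<psi> j) * y (fst j) else 0)"
      unfolding sketch_def using that by (intro sum.cong) (auto simp: S_def b_def)
    also have "\<dots> = snd (\<psi> (i, False)) * y i"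
      using that S(1) finH by (subst sum.delta) auto
    finally show ?thesis using low_moveD(2)[OF \<psi>] that S(1) by (simp add: abs_mult subset_iff)
  qed
  have "(\<Sum>i\<in>H. \<bar>y i\<bar>) = (\<Sum>i\<in>S. \<bar>y i\<bar>) + (\<Sum>i\<in>H - S. \<bar>y i\<bar>)"
    using sum.subset_diff[OF S(1) finH, of "\<lambda>i. \<bar>y i\<bar>"] by simp
  also have "(\<Sum>i\<in>H - S. \<bar>y i\<bar>) \<le> (\<Sum>i\<in>H - S. l i)" using l by (intro sum_mono) auto
  also have "(\<Sum>i\<in>H - S. l i) = collision_loss H l \<psi>"
    unfolding collision_loss_def b_def[symmetric] using finH
    by (intro sum.mono_neutral_cong_left) (auto simp: S_def)
  also have "(\<Sum>i\<in>S. \<bar>y i\<bar>) = (\<Sum>c\<in>b ` S. bucket_val N0 K c (?x c))"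
  proof -
    have "(\<Sum>c\<in>b ` S. bucket_val N0 K c (?x c)) = (\<Sum>i\<in>S. bucket_val N0 K (b i) (?x (b i)))"
      using S(2) by (simp add: sum.reindex)
    also have "\<dots> = (\<Sum>i\<in>S. \<bar>y i\<bar>)"
      using xb low_moveD(1)[OF \<psi>] S(1) by (intro sum.cong refl) (auto simp: bucket_val_def b_def)
    finally show ?thesis by simp
  qed
  also have "\<dots> \<le> clipped_norm N0 K (N0 + N1) ?x"
    unfolding clipped_norm_def using low_moveD(1)[OF \<psi>] S(1) bucket_val_nonneg[OF K_pos]
    by (intro sum_mono2) (auto simp: b_def trans_less_add1)
  finally show ?thesis by simp
qed

text \<open>Chernoff's method for the potential. The heavy entries are placed in the first table at
  once and give the start value; all other copies are revealed one by one. Restricting to few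
  collisions is possible because this event depends on the copies placed first only.\<close>

lemma clipped_norm_lower_tail:
  assumes y: "(\<Sum>i\<in>I. \<bar>y i\<bar>) = 1" and light: "\<And>i. i \<in> I - H \<Longrightarrow> \<bar>y i\<bar> \<le> K0"
    and l: "\<And>i. i \<in> H \<Longrightarrow> \<bar>y i\<bar> \<le> l i"
  shows "measure_pmf.prob (P d) {\<psi>. collision_loss H l \<psi> \<le> s \<and>
      clipped_norm N0 K (N0 + N1) (sketch M (y \<circ> fst) \<psi>) \<le> 1 - 6 / J - 5 * s}
    \<le> (1 + 4 * card I) * exp (- (s\<^sup>2 / (4 * K0)))"
proof -
  let ?F = "clipped_norm N0 K (N0 + N1)"
  let ?E = "measure_pmf.expectation"
  define H0 where "H0 = H \<times> {False}"
  define B where "B = (I - H) \<times> {False} \<union> I \<times> {True}"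
  define G where "G = {\<psi>. collision_loss H l \<psi> \<le> s}"
  define z where "z i = \<bar>y i\<bar>" for i
  have finH: "finite H" using I H finite_subset by blast
  have MB: "M = H0 \<union> B" "H0 \<inter> B = {}" "finite H0" "finite B"
    using I H finH by (auto simp: H0_def B_def UNIV_bool)
  have z0: "z i \<ge> 0" for i by (simp add: z_def)
  have split: "(\<Sum>i\<in>H. z i) + (\<Sum>i\<in>I - H. z i) = 1"
    using y sum.subset_diff[OF H I(1), of z] by (simp add: z_def)
  have sumB: "sum f B = (\<Sum>i\<in>I - H. f (i, False)) + (\<Sum>i\<in>I. f (i, True))" for f :: "'i \<times> bool \<Rightarrow> real"
  proof -
    have slice: "sum f (S \<times> {c}) = (\<Sum>i\<in>S. f (i, c))" for S c
    proof -
      have "S \<times> {c} = (\<lambda>i. (i, c)) ` S" by auto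
      then show ?thesis by (simp add: sum.reindex inj_on_def)
    qed
    have "sum f B = sum f ((I - H) \<times> {False}) + sum f (I \<times> {True})"
      unfolding B_def using I by (intro sum.union_disjoint) auto
    then show ?thesis by (simp only: slice)
  qed
  have "card B \<le> card M" using MB I by (intro card_mono) auto
  then have cardB: "card B \<le> 2 * card I" by (simp add: card_cartesian_product)
  have c: "real (card I) > 0" using I by (simp add: card_gt_0_iff)
  \<comment> \<open>Light entries are treated by \<open>gain_pair\<close>; those below
    \<open>s / card I\<close>, to which it does not apply, have total size at most \<open>s\<close>.
    Of the heavy entries only the second copies occur here, and their loss is bounded by
    \<open>gain_lower\<close>.\<close>
  have gain_total: "sum (gain y) B \<ge> (\<Sum>i\<in>I - H. z i) - 6 / J - 9 / 4 * s"
  proof -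
    define \<rho> where "\<rho> = 6 / J + 5 / 4 * s"
    have \<rho>: "\<rho> \<ge> 0" using s by (simp add: \<rho>_def)
    have pair: "z i * (1 - \<rho>) - s / card I \<le> gain y (i, False) + gain y (i, True)" for i
    proof (cases "s / card I \<le> z i")
      case True
      then have "z i * (1 - 6 / J - 5 / 4 * s) \<le> gain y (i, False) + gain y (i, True)"
        unfolding z_def by (rule gain_pair)
      moreover have "s / card I \<ge> 0" using s by simp
      ultimately show ?thesis by (simp add: \<rho>_def algebra_simps)
    next
      case False
      have "- z i * (3 / J + s) + - z i * (3 / J + s / 4) \<le> gain y (i, False) + gain y (i, True)"
      proof -
        have "- 3 * (z i / J) \<le> z i / J * (real (low_count (z i)) - 3)" using z0 by (simp add: algebra_simps)
        then have "- z i * (3 / J + s / 4) \<le> gain y (i, False)"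
          unfolding gain_def Let_def \<theta>K0z fst_conv snd_conv z_def[symmetric] by (simp add: algebra_simps)
        then show ?thesis using gain_lower[of y "(i, True)"] by (simp add: z_def)
      qed
      moreover have "z i \<le> s / card I" using False by simp
      ultimately show ?thesis by (simp add: \<rho>_def algebra_simps)
    qed
    have "(\<Sum>i\<in>I - H. z i * (1 - \<rho>) - s / card I) \<le> (\<Sum>i\<in>I - H. gain y (i, False) + gain y (i, True))"
      using pair by (intro sum_mono)
    moreover have "(\<Sum>i\<in>I - H. z i * (1 - \<rho>) - s / card I) = (\<Sum>i\<in>I - H. z i) * (1 - \<rho>) - real (card (I - H)) * (s / card I)"
      by (simp add: sum_subtractf sum_distrib_right)
    moreover have "real (card (I - H)) * (s / card I) \<le> s"
    proof -
      have "real (card (I - H)) \<le> card I" using I by (simp add: card_mono)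
      then show ?thesis using s c by (simp add: field_simps)
    qed
    ultimately have 1: "(\<Sum>i\<in>I - H. z i) * (1 - \<rho>) - s \<le> (\<Sum>i\<in>I - H. gain y (i, False) + gain y (i, True))" by linarith
    have "(\<Sum>i\<in>H. - z i * \<rho>) \<le> (\<Sum>i\<in>H. gain y (i, True))"
    proof (intro sum_mono)
      fix i
      have "3 / real J + s \<le> \<rho>" using s(1) J by (simp add: \<rho>_def field_simps)
      then have "z i * (3 / J + s) \<le> z i * \<rho>" using z0 by (intro mult_left_mono)
      then show "- z i * \<rho> \<le> gain y (i, True)" using gain_lower[of y "(i, True)"] by (simp add: z_def)
    qed
    then have 2: "- (\<Sum>i\<in>H. z i) * \<rho> \<le> (\<Sum>i\<in>H. gain y (i, True))" by (simp add: sum_distrib_right sum_negf)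
    have "sum (gain y) B = (\<Sum>i\<in>I - H. gain y (i, False) + gain y (i, True)) + (\<Sum>i\<in>H. gain y (i, True))"
      unfolding sumB using sum.subset_diff[OF H I(1), of "\<lambda>i. gain y (i, True)"] by (simp add: sum.distrib)
    moreover have "(\<Sum>i\<in>I - H. z i) * (1 - \<rho>) + - (\<Sum>i\<in>H. z i) * \<rho> = (\<Sum>i\<in>I - H. z i) - \<rho> * ((\<Sum>i\<in>H. z i) + (\<Sum>i\<in>I - H. z i))"
      by (simp add: algebra_simps)
    ultimately have "(\<Sum>i\<in>I - H. z i) - \<rho> - s \<le> sum (gain y) B" using 1 2 split by simp
    then show ?thesis by (simp add: \<rho>_def)
  qed
  define \<eta> where "\<eta> j = \<bar>y (fst j)\<bar> * (3 / J + s)" for j :: "'i \<times> bool"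
  have sum\<eta>: "sum \<eta> B \<le> 1"
  proof -
    have "sum \<eta> B = (\<Sum>i\<in>I - H. z i) * (3 / J + s) + (\<Sum>i\<in>I. z i) * (3 / J + s)"
      unfolding sumB by (simp add: \<eta>_def z_def sum_distrib_right)
    also have "\<dots> \<le> 1 * (3 / J + s) + 1 * (3 / J + s)"
    proof (intro add_mono mult_right_mono)
      show "(\<Sum>i\<in>I - H. z i) \<le> 1" using split sum_nonneg[of H z] z0 by simp
      show "(\<Sum>i\<in>I. z i) \<le> 1" using y by (simp add: z_def)
    qed (use s in auto)
    finally show ?thesis using s(3) by simp
  qed
  have rec: "?E (Pi_pmf (H0 \<union> B) d entry_move) (\<lambda>\<psi>. indicator G \<psi> * exp (- \<theta> * ?F (sketch (H0 \<union> B) (y \<circ> fst) \<psi>)))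
    \<le> exp (- \<theta> * sum (gain y) B) * ?E (Pi_pmf H0 d entry_move) (\<lambda>\<psi>. indicator G \<psi> * exp (- \<theta> * ?F (sketch H0 (y \<circ> fst) \<psi>)))
      + 2 * card B * exp (\<theta> * sum \<eta> B - 2 * \<theta>)"
  proof (rule sketch_recursion[OF MB(3,4,2)])
    show "0 \<le> \<theta>" using \<theta>_pos by simp
    show "finite (set_pmf (entry_move j))" for j :: "'i \<times> bool" by (rule finite_entry_move)
    show "?E (entry_move j) (\<lambda>v. exp (- \<theta> * ?F (x(fst v := x (fst v) + snd v * (y \<circ> fst) j))))
      \<le> exp (- \<theta> * gain y j) * exp (- \<theta> * ?F x) + 2 * exp (- 2 * \<theta>)" if "j \<in> B" for j x
      using entry_move_step[of j y x] light that by (auto simp: B_def)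
    show "- \<eta> j \<le> gain y j" for j using gain_lower[of y j] by (simp add: \<eta>_def)
    show "0 \<le> \<eta> j" for j using s by (simp add: \<eta>_def)
    fix \<psi> :: "'i \<times> bool \<Rightarrow> nat \<times> real" and j v assume j: "j \<in> B"
    have "(\<psi>(j := v)) (i, False) = \<psi> (i, False)" if "i \<in> H" for i using j that by (auto simp: B_def)
    then have "collision_loss H l (\<psi>(j := v)) = collision_loss H l \<psi>"
      unfolding collision_loss_def by (intro sum.cong refl if_cong) (auto simp del: fun_upd_apply)
    then show "\<psi>(j := v) \<in> G \<longleftrightarrow> \<psi> \<in> G" by (simp add: G_def)
  qed
  have a0: "?E (Pi_pmf H0 d entry_move) (\<lambda>\<psi>. indicator G \<psi> * exp (- \<theta> * ?F (sketch H0 (y \<circ> fst) \<psi>)))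
     \<le> exp (- \<theta> * ((\<Sum>i\<in>H. z i) - s))"
  proof -
    have "?E (Pi_pmf H0 d entry_move) (\<lambda>\<psi>. indicator G \<psi> * exp (- \<theta> * ?F (sketch H0 (y \<circ> fst) \<psi>)))
      \<le> ?E (Pi_pmf H0 d entry_move) (\<lambda>\<psi>. exp (- \<theta> * ((\<Sum>i\<in>H. z i) - s)))"
    proof (intro expectation_mono finite_set_Pi_pmf MB(3) finite_entry_move)
      fix \<psi> assume \<psi>: "\<psi> \<in> set_pmf (Pi_pmf H0 d entry_move)"
      show "indicator G \<psi> * exp (- \<theta> * ?F (sketch H0 (y \<circ> fst) \<psi>)) \<le> exp (- \<theta> * ((\<Sum>i\<in>H. z i) - s))"
      proof (cases "\<psi> \<in> G")
        case True
        have "(\<Sum>i\<in>H. z i) - s \<le> ?F (sketch H0 (y \<circ> fst) \<psi>)"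
          using heavy_sketch[of \<psi> d y] \<psi> l True by (simp add: H0_def G_def z_def)
        then have "\<theta> * ((\<Sum>i\<in>H. z i) - s) \<le> \<theta> * ?F (sketch H0 (y \<circ> fst) \<psi>)"
          using \<theta>_pos by (intro mult_left_mono) auto
        then show ?thesis using True by simp
      qed simp
    qed
    then show ?thesis by simp
  qed
  \<comment> \<open>Gains and heavy part exceed \<open>L\<close> by at least
    \<open>7 / 4 * s\<close> after all losses, and \<open>sum \<eta> B \<le> 1\<close> leaves at
    least \<open>s\<close> in the additive term. So both terms get the factor
    \<open>exp (- \<theta> * s)\<close>.\<close>
  define L where "L = 1 - 6 / J - 5 * s"
  let ?A = "{\<psi>. collision_loss H l \<psi> \<le> s \<and> ?F (sketch M (y \<circ> fst) \<psi>) \<le> L}"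
  have "measure_pmf.prob (P d) ?A \<le> ?E (P d) (\<lambda>\<psi>. exp (\<theta> * L) * (indicator G \<psi> * exp (- \<theta> * ?F (sketch M (y \<circ> fst) \<psi>))))"
  proof (intro prob_le_expectation finite_P)
    fix \<psi> assume "\<psi> \<in> ?A"
    then have "\<psi> \<in> G" "\<theta> * ?F (sketch M (y \<circ> fst) \<psi>) \<le> \<theta> * L" using \<theta>_pos by (auto simp: G_def)
    then show "1 \<le> exp (\<theta> * L) * (indicator G \<psi> * exp (- \<theta> * ?F (sketch M (y \<circ> fst) \<psi>)))"
      by (simp flip: exp_add)
  qed auto
  also have "\<dots> = exp (\<theta> * L) * ?E (P d) (\<lambda>\<psi>. indicator G \<psi> * exp (- \<theta> * ?F (sketch M (y \<circ> fst) \<psi>)))" by simp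
  also have "\<dots> \<le> exp (\<theta> * L) * (exp (- \<theta> * sum (gain y) B) * exp (- \<theta> * ((\<Sum>i\<in>H. z i) - s)) + 2 * card B * exp (\<theta> * sum \<eta> B - 2 * \<theta>))"
  proof (rule mult_left_mono)
    show "?E (P d) (\<lambda>\<psi>. indicator G \<psi> * exp (- \<theta> * ?F (sketch M (y \<circ> fst) \<psi>)))
      \<le> exp (- \<theta> * sum (gain y) B) * exp (- \<theta> * ((\<Sum>i\<in>H. z i) - s)) + 2 * card B * exp (\<theta> * sum \<eta> B - 2 * \<theta>)"
      unfolding MB(1) by (rule order_trans[OF rec], rule add_right_mono, rule mult_left_mono[OF a0]) simp
  qed simp
  also have "\<dots> = exp (\<theta> * (L - sum (gain y) B - (\<Sum>i\<in>H. z i) + s)) + 2 * card B * exp (\<theta> * (L + sum \<eta> B - 2))"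
    by (simp add: algebra_simps flip: exp_add)
  also have "\<dots> \<le> exp (- \<theta> * s) + 4 * card I * exp (- \<theta> * s)"
  proof (intro add_mono mult_mono)
    have "\<theta> * (L - sum (gain y) B - (\<Sum>i\<in>H. z i) + s) \<le> \<theta> * (- s)"
      using gain_total split s \<theta>_pos by (intro mult_left_mono) (auto simp: L_def)
    then show "exp (\<theta> * (L - sum (gain y) B - (\<Sum>i\<in>H. z i) + s)) \<le> exp (- \<theta> * s)" by simp
    have "6 / real J \<ge> 0" by simp
    then have "L + sum \<eta> B - 2 \<le> - s" unfolding L_def using sum\<eta> s(1) by linarith
    then have "\<theta> * (L + sum \<eta> B - 2) \<le> \<theta> * (- s)"
      using \<theta>_pos by (intro mult_left_mono) auto
    then show "exp (\<theta> * (L + sum \<eta> B - 2)) \<le> exp (- \<theta> * s)" by simp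
    show "real (2 * card B) \<le> real (4 * card I)" using cardB by linarith
  qed simp_all
  also have "\<dots> = (1 + 4 * card I) * exp (- (s\<^sup>2 / (4 * K0)))"
  proof -
    have "\<theta> * s = s\<^sup>2 / (4 * K0)" unfolding \<theta>_def unfolding K by (simp add: power2_eq_square)
    then have "- \<theta> * s = - (s\<^sup>2 / (4 * K0))" by simp
    then show ?thesis by (simp only: of_nat_add of_nat_1 distrib_right mult_1_left)
  qed
  finally have fin: "measure_pmf.prob (P d) ?A \<le> (1 + 4 * card I) * exp (- (s\<^sup>2 / (4 * K0)))" .
  then show ?thesis unfolding L_def .
qed

end

section \<open>The expectation for one vector\<close>

text \<open>The random sign kills the cross term of the square. Any \<open>h\<close> that is odd in
  the sign will do, in particular the truncation of a move to its light part.\<close>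

lemma quadratic_move:
  fixes x :: "nat \<Rightarrow> real" and h :: "nat \<times> real \<Rightarrow> real"
  assumes \<kappa>: "finite (set_pmf \<kappa>)"
    and B: "\<And>c. c \<in> set_pmf \<kappa> \<Longrightarrow> finite (B c) \<and> B c \<noteq> {} \<and> B c \<subseteq> {..<r}"
    and odd: "\<And>b a. h (b, - a) = - h (b, a)"
  shows "measure_pmf.expectation (move \<kappa> B a) (\<lambda>v. \<Sum>b<r. q b * ((x(fst v := x (fst v) + h v * y)) b)\<^sup>2)
    = (\<Sum>b<r. q b * (x b)\<^sup>2) + measure_pmf.expectation (move \<kappa> B a) (\<lambda>v. q (fst v) * (h v * y)\<^sup>2)"
proof -
  define Q where "Q x = (\<Sum>b<r. q b * (x b)\<^sup>2)" for x :: "nat \<Rightarrow> real"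
  have Q_upd: "Q (x(b := z)) = Q x - q b * (x b)\<^sup>2 + q b * z\<^sup>2" if "b < r" for b z
  proof -
    have "(\<Sum>c\<in>{..<r} - {b}. q c * ((x(b := z)) c)\<^sup>2) = (\<Sum>c\<in>{..<r} - {b}. q c * (x c)\<^sup>2)"
      by (intro sum.cong) auto
    then show ?thesis
      using that sum.remove[of "{..<r}" b "\<lambda>c. q c * ((x(b := z)) c)\<^sup>2"] sum.remove[of "{..<r}" b "\<lambda>c. q c * (x c)\<^sup>2"]
      unfolding Q_def by simp
  qed
  have B': "\<And>c. c \<in> set_pmf \<kappa> \<Longrightarrow> finite (B c) \<and> B c \<noteq> {}" using B by blast
  have E_move: "measure_pmf.expectation (move \<kappa> B a) f =
      measure_pmf.expectation \<kappa> (\<lambda>c. (\<Sum>b\<in>B c. (f (b, a c) + f (b, - a c)) / 2) / real (card (B c)))" for f :: "nat \<times> real \<Rightarrow> real"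
    using \<kappa> B' by (rule expectation_move)
  have "measure_pmf.expectation (move \<kappa> B a) (\<lambda>v. Q (x(fst v := x (fst v) + h v * y))) =
    measure_pmf.expectation \<kappa> (\<lambda>c. 1 * Q x + 1 * ((\<Sum>b\<in>B c. (q b * (h (b, a c) * y)\<^sup>2 + q b * (h (b, - a c) * y)\<^sup>2) / 2) / real (card (B c))))"
    unfolding E_move
  proof (rule expectation_cong)
    fix c assume c: "c \<in> set_pmf \<kappa>"
    have card: "real (card (B c)) > 0" using B[OF c] by (simp add: card_gt_0_iff)
    have "(\<Sum>b\<in>B c. (Q (x(fst (b, a c) := x (fst (b, a c)) + h (b, a c) * y)) + Q (x(fst (b, - a c) := x (fst (b, - a c)) + h (b, - a c) * y))) / 2)
      = (\<Sum>b\<in>B c. Q x + (q b * (h (b, a c) * y)\<^sup>2 + q b * (h (b, - a c) * y)\<^sup>2) / 2)"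
    proof (intro sum.cong refl)
      fix b assume "b \<in> B c"
      then have "b < r" using B[OF c] by auto
      then show "(Q (x(fst (b, a c) := x (fst (b, a c)) + h (b, a c) * y)) + Q (x(fst (b, - a c) := x (fst (b, - a c)) + h (b, - a c) * y))) / 2
        = Q x + (q b * (h (b, a c) * y)\<^sup>2 + q b * (h (b, - a c) * y)\<^sup>2) / 2"
        by (simp add: Q_upd odd power2_eq_square algebra_simps del: fun_upd_apply)
    qed
    also have "\<dots> = card (B c) * Q x + (\<Sum>b\<in>B c. (q b * (h (b, a c) * y)\<^sup>2 + q b * (h (b, - a c) * y)\<^sup>2) / 2)"
      by (simp add: sum.distrib)
    finally show "(\<Sum>b\<in>B c. (Q (x(fst (b, a c) := x (fst (b, a c)) + h (b, a c) * y)) + Q (x(fst (b, - a c) := x (fst (b, - a c)) + h (b, - a c) * y))) / 2) / real (card (B c))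
      = 1 * Q x + 1 * ((\<Sum>b\<in>B c. (q b * (h (b, a c) * y)\<^sup>2 + q b * (h (b, - a c) * y)\<^sup>2) / 2) / real (card (B c)))"
      using card by (simp add: add_divide_distrib)
  qed
  also have "\<dots> = Q x + measure_pmf.expectation (move \<kappa> B a) (\<lambda>v. q (fst v) * (h v * y)\<^sup>2)"
    unfolding expectation_linear[OF \<kappa>] E_move by simp
  finally show ?thesis unfolding Q_def .
qed

text \<open>The part \<open>h\<close> is later estimated with cancellation, the remainder entry by
  entry.\<close>

lemma abs_sketch_le:
  "\<bar>sketch A y \<psi> b\<bar> \<le> \<bar>sketch A y (\<lambda>j. (fst (\<psi> j), h j (\<psi> j))) b\<bar> + (\<Sum>j\<in>A. if fst (\<psi> j) = b then \<bar>(snd (\<psi> j) - h j (\<psi> j)) * y j\<bar> else 0)"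
proof -
  have "sketch A y \<psi> b = sketch A y (\<lambda>j. (fst (\<psi> j), h j (\<psi> j))) b +
     (\<Sum>j\<in>A. if fst (\<psi> j) = b then (snd (\<psi> j) - h j (\<psi> j)) * y j else 0)"
    unfolding sketch_def sum.distrib[symmetric] by (intro sum.cong) (auto simp: algebra_simps)
  moreover have "\<bar>\<Sum>j\<in>A. if fst (\<psi> j) = b then (snd (\<psi> j) - h j (\<psi> j)) * y j else 0\<bar>
      \<le> (\<Sum>j\<in>A. if fst (\<psi> j) = b then \<bar>(snd (\<psi> j) - h j (\<psi> j)) * y j\<bar> else 0)"
    by (rule order_trans[OF sum_abs]) (auto intro!: sum_mono)
  ultimately show ?thesis by linarith
qed

section \<open>Cancellation of light entries and the count of the remaining ones\<close>

context sketching_scheme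
begin

text \<open>\<open>LEAST\<close> recovers the index of the subtable that contains
  \<open>b\<close>.\<close>

definition bucket_size :: "nat \<Rightarrow> nat" where
  "bucket_size b = (if b < N0 then n0 * 2 ^ (LEAST u. b < n0 * (2 ^ Suc u - 1)) else N1)"

lemma bucket_size_subtable:
  assumes "u < J" "b \<in> subtable u"
  shows "bucket_size b = n0 * 2 ^ u" "b < N0"
proof -
  show b: "b < N0" using assms subtable_subset by auto
  have "(LEAST u. b < n0 * (2 ^ Suc u - 1)) = u"
  proof (rule Least_equality)
    show "b < n0 * (2 ^ Suc u - 1)" using assms by (simp add: subtable_def)
    fix u' assume u': "b < n0 * (2 ^ Suc u' - 1)"
    show "u \<le> u'"
    proof (rule ccontr)
      assume "\<not> u \<le> u'"
      then have "(2::nat) ^ Suc u' \<le> 2 ^ u" by (intro power_increasing) auto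
      then have "n0 * (2 ^ Suc u' - 1) \<le> n0 * (2 ^ u - 1)" by (intro mult_le_mono2 diff_le_mono)
      then show False using u' assms(2) unfolding subtable_def by (simp only: atLeastLessThan_iff) linarith
    qed
  qed
  then show "bucket_size b = n0 * 2 ^ u" using b by (simp add: bucket_size_def)
qed

lemma bucket_size_pos: "bucket_size b > 0"
  using n0 N1 by (simp add: bucket_size_def)

lemma sum_inverse_bucket_size: "(\<Sum>b<N0. 1 / real (bucket_size b)) = J"
proof -
  have "k \<le> J \<Longrightarrow> (\<Sum>b<n0 * (2 ^ k - 1). 1 / real (bucket_size b)) = k" for k
  proof (induction k)
    case 0
    then show ?case by simp
  next
    case (Suc k)
    have le: "n0 * (2 ^ k - 1) \<le> n0 * (2 ^ Suc k - 1)" by (intro mult_le_mono2 diff_le_mono) simp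
    have "{..<n0 * (2 ^ Suc k - 1)} = {..<n0 * (2 ^ k - 1)} \<union> subtable k"
      unfolding subtable_def by (rule ivl_disj_un_one(2)[OF le, symmetric])
    moreover have "{..<n0 * (2 ^ k - 1)} \<inter> subtable k = {}" by (auto simp: subtable_def)
    ultimately have "(\<Sum>b<n0 * (2 ^ Suc k - 1). 1 / real (bucket_size b)) =
      (\<Sum>b<n0 * (2 ^ k - 1). 1 / real (bucket_size b)) + (\<Sum>b\<in>subtable k. 1 / real (bucket_size b))"
      using subtable_finite by (simp add: sum.union_disjoint)
    also have "(\<Sum>b\<in>subtable k. 1 / real (bucket_size b)) = (\<Sum>b\<in>subtable k. 1 / real (n0 * 2 ^ k))"
      using Suc.prems bucket_size_subtable(1)[of k] by (intro sum.cong) auto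
    also have "\<dots> = 1" using n0 by simp
    finally show ?case using Suc by simp
  qed
  then show ?thesis by (simp add: N0_def)
qed

text \<open>The weights serve the estimate of \<open>\<bar>x\<bar>\<close> by half of
  \<open>v + x^2 / v\<close> with \<open>v = noise_weight b\<close>. They add up to
  \<open>2 / J\<close>, and the cutoffs are such that the weighted second moments of a vector of
  norm 1 add up to at most \<open>2 / J\<close>, too. The first table has an additional factor
  \<open>1 / J\<close> since each of its \<open>J\<close> subtables has the same share in the sum of
  weights.\<close>

definition "noise_cutoff b = (if b < N0 then 1 / (2 * (real J)\<^sup>2) else 1 / (2 * real J))"
definition "noise_weight b = (if b < N0 then 1 / (real J)\<^sup>2 else 1 / real J) / bucket_size b"

definition light :: "real \<Rightarrow> nat \<times> real \<Rightarrow> bool" where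
  "light z v \<longleftrightarrow> real (bucket_size (fst v)) * \<bar>snd v\<bar> * \<bar>z\<bar> < noise_cutoff (fst v)"

definition light_part :: "real \<Rightarrow> nat \<times> real \<Rightarrow> real" where
  "light_part z v = (if light z v then snd v else 0)"

lemma noise_weight_pos: "noise_weight b > 0"
  using J bucket_size_pos by (simp add: noise_weight_def)

lemma sum_noise_weight: "(\<Sum>b<N0 + N1. noise_weight b) = 2 / J"
proof -
  have "(\<Sum>b<N0 + N1. noise_weight b) = (\<Sum>b<N0. noise_weight b) + (\<Sum>b=N0..<N0 + N1. noise_weight b)"
    unfolding lessThan_atLeast0 by (subst sum.atLeastLessThan_concat) auto
  also have "(\<Sum>b<N0. noise_weight b) = (\<Sum>b<N0. 1 / real (bucket_size b)) / (real J)\<^sup>2"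
    by (simp add: noise_weight_def sum_divide_distrib mult.commute)
  also have "\<dots> = 1 / J" using J by (simp add: sum_inverse_bucket_size power2_eq_square)
  also have "(\<Sum>b=N0..<N0 + N1. noise_weight b) = (\<Sum>b=N0..<N0 + N1. 1 / (J * real N1))"
    by (intro sum.cong) (auto simp: noise_weight_def bucket_size_def)
  also have "\<dots> = 1 / J" using N1 by simp
  finally show ?thesis by simp
qed

lemma expectation_low_move:
  "measure_pmf.expectation low_move f = (\<Sum>u<J. (\<Sum>b\<in>subtable u. (f (b, 1) + f (b, - 1)) / 2) / (n0 * 2 ^ u)) / J"
  unfolding low_move_def using J subtable_finite
  by (subst expectation_move) (auto simp: set_pmf_of_set lessThan_empty_iff expectation_low)

lemma expectation_high_move:
  assumes "\<And>b. b \<in> {N0..<N0 + N1} \<Longrightarrow> f (b, 0) = 0"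
  shows "measure_pmf.expectation high_move f =
    (\<Sum>t\<in>{x0..x1}. (\<Sum>b\<in>{N0..<N0 + N1}. (f (b, 2 ^ t / J) + f (b, - (2 ^ t / J))) / 2) / N1 / 2 ^ t)"
proof -
  have "measure_pmf.expectation high_move f =
    measure_pmf.expectation level_pmf (\<lambda>t. (\<Sum>b\<in>{N0..<N0 + N1}. (f (b, level_scale t) + f (b, - level_scale t)) / 2) / N1)"
    unfolding high_move_def using N1 by (subst expectation_move[OF finite_level]) auto
  also have "\<dots> = (\<Sum>t\<in>{x0..x1}. (\<Sum>b\<in>{N0..<N0 + N1}. (f (b, level_scale t) + f (b, - level_scale t)) / 2) / N1 / 2 ^ t)"
    using assms by (intro expectation_level) (simp add: level_scale_def)
  also have "\<dots> = (\<Sum>t\<in>{x0..x1}. (\<Sum>b\<in>{N0..<N0 + N1}. (f (b, 2 ^ t / J) + f (b, - (2 ^ t / J))) / 2) / N1 / 2 ^ t)"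
    using x0 by (intro sum.cong refl) (auto simp: level_scale_def)
  finally show ?thesis .
qed

text \<open>The weighted squares grow geometrically with the subtable, and the cutoff bounds the
  last one that is still light.\<close>

lemma low_noise:
  "measure_pmf.expectation low_move (\<lambda>v. 1 / noise_weight (fst v) * (light_part z v * z)\<^sup>2) \<le> \<bar>z\<bar> / J"
proof -
  define U where "U = {u\<in>{..<J}. real n0 * 2 ^ u * \<bar>z\<bar> < 1 / (2 * (real J)\<^sup>2)}"
  have "measure_pmf.expectation low_move (\<lambda>v. 1 / noise_weight (fst v) * (light_part z v * z)\<^sup>2) =
     (\<Sum>u<J. if u \<in> U then real n0 * 2 ^ u * (real J)\<^sup>2 * z\<^sup>2 else 0) / J"
    unfolding expectation_low_move
  proof (intro arg_cong[of _ _ "\<lambda>x. x / real J"] sum.cong refl)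
    fix u assume u: "u \<in> {..<J}"
    have "(\<Sum>b\<in>subtable u. (1 / noise_weight (fst (b, 1::real)) * (light_part z (b, 1) * z)\<^sup>2 + 1 / noise_weight (fst (b, - 1::real)) * (light_part z (b, - 1) * z)\<^sup>2) / 2)
      = (\<Sum>b\<in>subtable u. if u \<in> U then real n0 * 2 ^ u * (real J)\<^sup>2 * z\<^sup>2 else 0)"
    proof (intro sum.cong refl)
      fix b assume "b \<in> subtable u"
      with u have "b < N0" "bucket_size b = n0 * 2 ^ u" using bucket_size_subtable[of u b] by auto
      then show "(1 / noise_weight (fst (b, 1::real)) * (light_part z (b, 1) * z)\<^sup>2 + 1 / noise_weight (fst (b, - 1::real)) * (light_part z (b, - 1) * z)\<^sup>2) / 2
        = (if u \<in> U then real n0 * 2 ^ u * (real J)\<^sup>2 * z\<^sup>2 else 0)"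
        using u by (simp add: noise_weight_def light_part_def light_def noise_cutoff_def U_def)
    qed
    then show "(\<Sum>b\<in>subtable u. (1 / noise_weight (fst (b, 1::real)) * (light_part z (b, 1) * z)\<^sup>2 + 1 / noise_weight (fst (b, - 1::real)) * (light_part z (b, - 1) * z)\<^sup>2) / 2) / (n0 * 2 ^ u)
      = (if u \<in> U then real n0 * 2 ^ u * (real J)\<^sup>2 * z\<^sup>2 else 0)"
      using n0 by simp
  qed
  also have "(\<Sum>u<J. if u \<in> U then real n0 * 2 ^ u * (real J)\<^sup>2 * z\<^sup>2 else 0) = (\<Sum>u\<in>U. real n0 * 2 ^ u * (real J)\<^sup>2 * z\<^sup>2)"
    by (subst sum.inter_restrict[symmetric]) (auto simp: U_def intro!: sum.cong)
  also have "\<dots> = (real J)\<^sup>2 * \<bar>z\<bar> * (\<Sum>u\<in>U. (real n0 * \<bar>z\<bar>) * 2 ^ u)"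
    unfolding sum_distrib_left
  proof (intro sum.cong refl)
    fix u
    have "z\<^sup>2 = \<bar>z\<bar> * \<bar>z\<bar>" by (simp add: power2_eq_square)
    then show "real n0 * 2 ^ u * (real J)\<^sup>2 * z\<^sup>2 = (real J)\<^sup>2 * \<bar>z\<bar> * (real n0 * \<bar>z\<bar> * 2 ^ u)"
      by (simp only: mult_ac)
  qed
  also have "\<dots> \<le> (real J)\<^sup>2 * \<bar>z\<bar> * (2 * (1 / (2 * (real J)\<^sup>2)))"
    by (intro mult_left_mono sum_powers_le) (auto simp: U_def mult_ac)
  also have "\<dots> = \<bar>z\<bar>" using J by simp
  finally show ?thesis by (simp add: divide_right_mono)
qed

lemma high_noise:
  "measure_pmf.expectation high_move (\<lambda>v. 1 / noise_weight (fst v) * (light_part z v * z)\<^sup>2) \<le> \<bar>z\<bar> / J"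
proof -
  define T where "T = {t\<in>{x0..x1}. real N1 * (2 ^ t / J) * \<bar>z\<bar> < 1 / (2 * real J)}"
  have "measure_pmf.expectation high_move (\<lambda>v. 1 / noise_weight (fst v) * (light_part z v * z)\<^sup>2) =
     (\<Sum>t\<in>{x0..x1}. if t \<in> T then real N1 * J * (2 ^ t / J * z)\<^sup>2 / 2 ^ t else 0)"
  proof (subst expectation_high_move, simp add: light_part_def, intro sum.cong refl)
    fix t assume t: "t \<in> {x0..x1}"
    have "(\<Sum>b=N0..<N0 + N1. (1 / noise_weight (fst (b, 2 ^ t / real J)) * (light_part z (b, 2 ^ t / real J) * z)\<^sup>2 +
         1 / noise_weight (fst (b, - (2 ^ t / real J))) * (light_part z (b, - (2 ^ t / real J)) * z)\<^sup>2) / 2)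
      = (\<Sum>b=N0..<N0 + N1. if t \<in> T then real N1 * J * (2 ^ t / J * z)\<^sup>2 else 0)"
      using t by (intro sum.cong refl) (simp add: noise_weight_def light_part_def light_def noise_cutoff_def T_def bucket_size_def)
    then show "(\<Sum>b=N0..<N0 + N1. (1 / noise_weight (fst (b, 2 ^ t / real J)) * (light_part z (b, 2 ^ t / real J) * z)\<^sup>2 +
         1 / noise_weight (fst (b, - (2 ^ t / real J))) * (light_part z (b, - (2 ^ t / real J)) * z)\<^sup>2) / 2) / N1 / 2 ^ t
      = (if t \<in> T then real N1 * J * (2 ^ t / J * z)\<^sup>2 / 2 ^ t else 0)"
      using N1 by simp
  qed
  also have "\<dots> = (\<Sum>t\<in>T. real N1 * J * (2 ^ t / J * z)\<^sup>2 / 2 ^ t)"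
    by (subst sum.inter_restrict[symmetric]) (auto simp: T_def intro!: sum.cong)
  also have "\<dots> = \<bar>z\<bar> * (\<Sum>t\<in>T. (real N1 / J * \<bar>z\<bar>) * 2 ^ t)"
    unfolding sum_distrib_left
  proof (intro sum.cong refl)
    fix t
    have "\<bar>z\<bar> * \<bar>z\<bar> = z * z" by (rule abs_mult_self_eq)
    then have "\<bar>z\<bar> * (real N1 / J * \<bar>z\<bar> * 2 ^ t) = real N1 / J * 2 ^ t * (z * z)" by (simp add: mult_ac)
    also have "\<dots> = real N1 * J * (2 ^ t / J * z)\<^sup>2 / 2 ^ t" using J by (simp add: power2_eq_square)
    finally show "real N1 * J * (2 ^ t / J * z)\<^sup>2 / 2 ^ t = \<bar>z\<bar> * (real N1 / J * \<bar>z\<bar> * 2 ^ t)" by simp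
  qed
  also have "\<dots> \<le> \<bar>z\<bar> * (2 * (1 / (2 * real J)))"
    by (intro mult_left_mono sum_powers_le) (auto simp: T_def mult_ac)
  finally show ?thesis by simp
qed

text \<open>The counterparts of \<open>low_count\<close> and \<open>high_count\<close> for the upper
  bound: an entry is charged wherever it is not light and, in the second table, not beyond
  \<open>A\<close>.\<close>

definition "kept_low (z :: real) = card {u\<in>{..<J}. 1 / (2 * (real J)\<^sup>2) \<le> real n0 * 2 ^ u * z}"
definition "kept_high A (z :: real) = card {t\<in>{x0..x1}. 1 / (2 * real J) \<le> real N1 * (2 ^ t / J) * z \<and> 2 ^ t * z \<le> A}"

text \<open>The charged levels form a window whose length is less than \<open>J + w\<close> plus
  one, by the ratio of its extreme scales. If the charged subtables begin with \<open>a\<close>,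
  then \<open>low\<close> excludes the levels from \<open>x0 + w + a\<close> on. So the
  \<open>J - a\<close> subtables and at most \<open>w + a\<close> levels balance each other.\<close>

lemma kept_le:
  fixes A :: real
  assumes z: "0 < z" and low: "2 * (real J)\<^sup>2 * A * n0 < 2 ^ (x0 + w)" and high: "2 * A * N1 < 2 ^ (J + w)"
  shows "kept_low z + kept_high A z \<le> J + w"
proof -
  define U where "U = {u\<in>{..<J}. 1 / (2 * (real J)\<^sup>2) \<le> real n0 * 2 ^ u * z}"
  define T where "T = {t\<in>{x0..x1}. 1 / (2 * real J) \<le> real N1 * (2 ^ t / J) * z \<and> 2 ^ t * z \<le> A}"
  have fin: "finite U" "finite T" by (auto simp: U_def T_def)
  have cardU: "card U \<le> J" using card_mono[of "{..<J}" U] by (auto simp: U_def)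
  have "card U + card T \<le> J + w"
  proof (cases "T = {}")
    case True
    then show ?thesis using cardU by simp
  next
    case False
    define g where "g = Max T"
    define k where "k = Min T"
    have g: "g \<in> T" "\<And>t. t \<in> T \<Longrightarrow> t \<le> g" and k: "k \<in> T" "\<And>t. t \<in> T \<Longrightarrow> k \<le> t"
      using fin False by (auto simp: g_def k_def)
    have gA: "2 ^ g * z \<le> A" using g by (simp add: T_def)
    have "g < k + (J + w)"
    proof -
      have "1 / 2 \<le> N1 * 2 ^ k * z" using k J by (simp add: T_def field_simps)
      then have "2 ^ g * 1 \<le> 2 ^ g * (2 * N1 * 2 ^ k * z)" by (intro mult_left_mono) auto
      also have "\<dots> = (2 ^ g * z) * (2 * N1 * 2 ^ k)" by simp
      also have "\<dots> \<le> A * (2 * N1 * 2 ^ k)" using gA by (intro mult_right_mono) auto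
      also have "\<dots> = (2 * A * N1) * 2 ^ k" by simp
      also have "\<dots> < 2 ^ (J + w) * 2 ^ k" using high by (intro mult_strict_right_mono) auto
      finally have "(2::real) ^ g < 2 ^ (k + (J + w))" by (simp add: power_add mult_ac)
      then show ?thesis using power_less_imp_less_exp[of "2::real"] by simp
    qed
    moreover have "card T \<le> Suc g - k"
    proof -
      have "T \<subseteq> {k..g}" using g k by auto
      from card_mono[OF _ this] show ?thesis by simp
    qed
    ultimately have T1: "card T \<le> J + w" by simp
    show ?thesis
    proof (cases "U = {}")
      case True
      then show ?thesis using T1 by simp
    next
      case False
      define a where "a = Min U"
      have a: "a \<in> U" "\<And>u. u \<in> U \<Longrightarrow> a \<le> u" using fin False by (auto simp: a_def)
      have "U \<subseteq> {a..<J}" using a by (auto simp: U_def)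
      from card_mono[OF _ this] have U1: "card U \<le> J - a" by simp
      have "g < x0 + w + a"
      proof -
        have "1 \<le> 2 * (real J)\<^sup>2 * (n0 * 2 ^ a * z)" using a J by (simp add: U_def field_simps)
        then have "2 ^ g * 1 \<le> 2 ^ g * (2 * (real J)\<^sup>2 * (n0 * 2 ^ a * z))" by (intro mult_left_mono) auto
        also have "\<dots> = (2 ^ g * z) * (2 * (real J)\<^sup>2 * n0 * 2 ^ a)" by simp
        also have "\<dots> \<le> A * (2 * (real J)\<^sup>2 * n0 * 2 ^ a)" using gA by (intro mult_right_mono) auto
        also have "\<dots> = (2 * (real J)\<^sup>2 * A * n0) * 2 ^ a" by simp
        also have "\<dots> < 2 ^ (x0 + w) * 2 ^ a" using low by (intro mult_strict_right_mono) auto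
        finally have "(2::real) ^ g < 2 ^ (x0 + w + a)" by (simp add: power_add mult_ac)
        then show ?thesis using power_less_imp_less_exp[of "2::real"] by simp
      qed
      moreover have "card T \<le> Suc g - x0"
      proof -
        have "T \<subseteq> {x0..g}" using g by (auto simp: T_def)
        from card_mono[OF _ this] show ?thesis by simp
      qed
      ultimately have "card T \<le> w + a" by simp
      moreover have "a \<le> J" using a(1) by (simp add: U_def)
      ultimately show ?thesis using U1 by simp
    qed
  qed
  then show ?thesis by (simp add: kept_low_def kept_high_def U_def T_def)
qed

text \<open>The flag \<open>k\<close> marks the second table, the only one where entries are scaled
  up and can exceed \<open>A\<close>.\<close>

definition heavy_part :: "real \<Rightarrow> real \<Rightarrow> bool \<Rightarrow> nat \<times> real \<Rightarrow> real" where
  "heavy_part A z k v = (if light z v \<or> k \<and> real J * \<bar>snd v\<bar> * \<bar>z\<bar> > A then 0 else \<bar>snd v * z\<bar>)"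

text \<open>The scale \<open>2 ^ t / J\<close> of a level cancels its probability, so each subtable
  or level that is charged contributes \<open>\<bar>z\<bar> / J\<close>.\<close>

lemma expectation_heavy_part:
  fixes A :: real
  assumes A: "0 \<le> A"
  shows "measure_pmf.expectation (entry_move (i, False)) (heavy_part A z False) = \<bar>z\<bar> * kept_low \<bar>z\<bar> / J" (is ?low)
    "measure_pmf.expectation (entry_move (i, True)) (heavy_part A z True) = \<bar>z\<bar> * kept_high A \<bar>z\<bar> / J" (is ?high)
proof -
  define U where "U = {u\<in>{..<J}. 1 / (2 * (real J)\<^sup>2) \<le> real n0 * 2 ^ u * \<bar>z\<bar>}"
  define T where "T = {t\<in>{x0..x1}. 1 / (2 * real J) \<le> real N1 * (2 ^ t / J) * \<bar>z\<bar> \<and> 2 ^ t * \<bar>z\<bar> \<le> A}"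
  have "measure_pmf.expectation low_move (heavy_part A z False) = (\<Sum>u<J. if u \<in> U then \<bar>z\<bar> else 0) / J"
    unfolding expectation_low_move
  proof (intro arg_cong[of _ _ "\<lambda>x. x / real J"] sum.cong refl)
    fix u assume u: "u \<in> {..<J}"
    have "(\<Sum>b\<in>subtable u. (heavy_part A z False (b, 1) + heavy_part A z False (b, - 1)) / 2) = (\<Sum>b\<in>subtable u. if u \<in> U then \<bar>z\<bar> else 0)"
    proof (intro sum.cong refl)
      fix b assume "b \<in> subtable u"
      with u have "b < N0" "bucket_size b = n0 * 2 ^ u" using bucket_size_subtable[of u b] by auto
      then show "(heavy_part A z False (b, 1) + heavy_part A z False (b, - 1)) / 2 = (if u \<in> U then \<bar>z\<bar> else 0)"
        using u by (auto simp: heavy_part_def light_def noise_cutoff_def U_def)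
    qed
    then show "(\<Sum>b\<in>subtable u. (heavy_part A z False (b, 1) + heavy_part A z False (b, - 1)) / 2) / (n0 * 2 ^ u) = (if u \<in> U then \<bar>z\<bar> else 0)"
      using n0 by simp
  qed
  also have "(\<Sum>u<J. if u \<in> U then \<bar>z\<bar> else 0) = \<bar>z\<bar> * card U"
    by (subst sum.inter_restrict[symmetric]) (auto simp: U_def Int_def)
  finally show ?low by (simp add: entry_move_def kept_low_def U_def)
  have "measure_pmf.expectation high_move (heavy_part A z True) = (\<Sum>t\<in>{x0..x1}. if t \<in> T then \<bar>z\<bar> / J else 0)"
  proof (subst expectation_high_move, simp add: heavy_part_def, intro sum.cong refl)
    fix t assume t: "t \<in> {x0..x1}"
    have "(\<Sum>b=N0..<N0 + N1. (heavy_part A z True (b, 2 ^ t / real J) + heavy_part A z True (b, - (2 ^ t / real J))) / 2)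
      = (\<Sum>b=N0..<N0 + N1. if t \<in> T then 2 ^ t / J * \<bar>z\<bar> else 0)"
      using t J by (intro sum.cong refl) (auto simp: heavy_part_def light_def noise_cutoff_def T_def bucket_size_def abs_mult)
    then show "(\<Sum>b=N0..<N0 + N1. (heavy_part A z True (b, 2 ^ t / real J) + heavy_part A z True (b, - (2 ^ t / real J))) / 2) / N1 / 2 ^ t
      = (if t \<in> T then \<bar>z\<bar> / J else 0)"
      using N1 by simp
  qed
  also have "\<dots> = \<bar>z\<bar> / J * card T"
  proof -
    have "T \<subseteq> {x0..x1}" by (auto simp: T_def)
    then show ?thesis by (simp add: sum.inter_restrict[symmetric] Int_absorb1)
  qed
  finally show ?high by (simp add: entry_move_def kept_high_def T_def)
qed

lemma entry_move_range:
  assumes "v \<in> set_pmf (entry_move j)"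
  shows "fst v < N0 + N1"
proof (cases "snd j")
  case True
  then have "v \<in> set_pmf high_move" using assms by (simp add: entry_move_def)
  then obtain t where "fst v \<in> {N0..<N0 + N1}" by (rule high_moveD)
  then show ?thesis by simp
next
  case False
  then show ?thesis using assms low_moveD(1)[of v] by (simp add: entry_move_def)
qed

lemma light_sketch_second_moment:
  fixes y :: "'i \<times> bool \<Rightarrow> real"
  assumes "finite A"
  shows "measure_pmf.expectation (Pi_pmf A d entry_move)
     (\<lambda>\<psi>. \<Sum>b<N0 + N1. 1 / noise_weight b * (sketch A y (\<lambda>j. (fst (\<psi> j), light_part (y j) (\<psi> j))) b)\<^sup>2)
     \<le> (\<Sum>j\<in>A. \<bar>y j\<bar> / J)"
  using assms
proof (induction A rule: finite_induct)
  case empty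
  then show ?case by (simp add: sketch_def)
next
  case (insert j A)
  let ?x = "\<lambda>\<psi>. sketch A y (\<lambda>j. (fst (\<psi> j), light_part (y j) (\<psi> j)))"
  let ?Q = "\<lambda>x. \<Sum>b<N0 + N1. 1 / noise_weight b * (x b)\<^sup>2"
  have fin: "finite (set_pmf (Pi_pmf A d (entry_move :: 'i \<times> bool \<Rightarrow> _)))"
    using insert.hyps by (intro finite_set_Pi_pmf finite_entry_move)
  have odd: "light_part z (b, - a) = - light_part z (b, a)" for z b a
    by (simp add: light_part_def light_def)
  have upd: "(\<lambda>j'. (fst ((\<psi>(j := v)) j'), light_part (y j') ((\<psi>(j := v)) j'))) =
     (\<lambda>j'. (fst (\<psi> j'), light_part (y j') (\<psi> j')))(j := (fst v, light_part (y j) v))" for \<psi> :: "'i \<times> bool \<Rightarrow> nat \<times> real" and v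
    by auto
  have step: "measure_pmf.expectation (entry_move j) (\<lambda>v. ?Q (x(fst v := x (fst v) + light_part (y j) v * y j))) \<le> ?Q x + \<bar>y j\<bar> / J" for x
  proof (cases "snd j")
    case True
    have "measure_pmf.expectation high_move (\<lambda>v. ?Q (x(fst v := x (fst v) + light_part (y j) v * y j))) =
      ?Q x + measure_pmf.expectation high_move (\<lambda>v. 1 / noise_weight (fst v) * (light_part (y j) v * y j)\<^sup>2)"
      unfolding high_move_def using N1 by (intro quadratic_move finite_level odd) auto
    then show ?thesis using True high_noise[of "y j"] by (simp add: entry_move_def)
  next
    case False
    have "measure_pmf.expectation low_move (\<lambda>v. ?Q (x(fst v := x (fst v) + light_part (y j) v * y j))) =
      ?Q x + measure_pmf.expectation low_move (\<lambda>v. 1 / noise_weight (fst v) * (light_part (y j) v * y j)\<^sup>2)"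
      unfolding low_move_def
    proof (intro quadratic_move odd)
      show "finite (subtable c) \<and> subtable c \<noteq> {} \<and> subtable c \<subseteq> {..<N0 + N1}" if "c \<in> set_pmf (pmf_of_set {..<J})" for c
        using that J subtable_finite[of c] subtable_subset[of c] by (auto simp: set_pmf_of_set lessThan_empty_iff)
    qed (use J in \<open>auto simp: set_pmf_of_set lessThan_empty_iff\<close>)
    then show ?thesis using False low_noise[of "y j"] by (simp add: entry_move_def)
  qed
  have "measure_pmf.expectation (Pi_pmf (insert j A) d entry_move) (\<lambda>\<psi>. ?Q (sketch (insert j A) y (\<lambda>j. (fst (\<psi> j), light_part (y j) (\<psi> j)))))
    = measure_pmf.expectation (Pi_pmf A d entry_move) (\<lambda>\<psi>. measure_pmf.expectation (entry_move j)
        (\<lambda>v. ?Q (sketch (insert j A) y (\<lambda>j'. (fst ((\<psi>(j := v)) j'), light_part (y j') ((\<psi>(j := v)) j'))))))"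
    by (rule expectation_Pi_insert[OF insert.hyps]) (rule finite_entry_move)
  also have "\<dots> = measure_pmf.expectation (Pi_pmf A d entry_move) (\<lambda>\<psi>. measure_pmf.expectation (entry_move j)
        (\<lambda>v. ?Q ((?x \<psi>)(fst v := ?x \<psi> (fst v) + light_part (y j) v * y j))))"
    unfolding upd sketch_insert[OF insert.hyps] by simp
  also have "\<dots> \<le> measure_pmf.expectation (Pi_pmf A d entry_move) (\<lambda>\<psi>. 1 * ?Q (?x \<psi>) + 1 * (\<bar>y j\<bar> / J))"
    using step by (intro expectation_mono fin) simp
  also have "\<dots> = measure_pmf.expectation (Pi_pmf A d entry_move) (\<lambda>\<psi>. ?Q (?x \<psi>)) + \<bar>y j\<bar> / J"
    by (subst expectation_linear[OF fin]) simp
  also have "\<dots> \<le> (\<Sum>j\<in>insert j A. \<bar>y j\<bar> / J)" using insert by simp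
  finally show ?case .
qed

text \<open>Every level adds its share to the expectation, even a level so rare that a single
  sampled entry exceeds \<open>A\<close>. Excluding those entries keeps the number of charged levels
  independent of \<open>x1\<close>.\<close>

definition no_outlier :: "real \<Rightarrow> 'i set \<Rightarrow> ('i \<Rightarrow> real) \<Rightarrow> ('i \<times> bool \<Rightarrow> nat \<times> real) set" where
  "no_outlier A I y = {\<psi>. \<forall>i\<in>I. real J * \<bar>snd (\<psi> (i, True))\<bar> * \<bar>y i\<bar> \<le> A}"

text \<open>The levels with \<open>2 ^ t * \<bar>y i\<bar> > A\<close> have total probability at
  most \<open>2 * \<bar>y i\<bar> / A\<close>, twice that of the lowest of them at worst; a union
  bound over the entries of a unit vector remains.\<close>

lemma prob_outlier:
  fixes A :: real
  assumes I: "finite I" and y: "(\<Sum>i\<in>I. \<bar>y i\<bar>) = 1" and A: "A > 0"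
  shows "measure_pmf.prob (Pi_pmf (I \<times> UNIV) d entry_move) (- no_outlier A I y) \<le> 2 / A"
proof -
  let ?P = "Pi_pmf (I \<times> (UNIV :: bool set)) d entry_move"
  have fin: "finite (set_pmf ?P)" using I by (intro finite_set_Pi_pmf finite_entry_move) auto
  have one: "measure_pmf.expectation ?P (\<lambda>\<psi>. of_bool (real J * \<bar>snd (\<psi> (i, True))\<bar> * \<bar>y i\<bar> > A)) \<le> 2 * (\<bar>y i\<bar> / A)" if "i \<in> I" for i
  proof -
    define T where "T = {t\<in>{x0..x1}. 2 ^ t * \<bar>y i\<bar> > A}"
    have "measure_pmf.expectation ?P (\<lambda>\<psi>. of_bool (real J * \<bar>snd (\<psi> (i, True))\<bar> * \<bar>y i\<bar> > A) :: real) =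
       measure_pmf.expectation (entry_move (i, True)) (\<lambda>v. of_bool (real J * \<bar>snd v\<bar> * \<bar>y i\<bar> > A) :: real)"
      using I that by (intro expectation_Pi_component) auto
    also have "\<dots> = (\<Sum>t\<in>{x0..x1}. if t \<in> T then 1 / 2 ^ t else 0)"
      unfolding entry_move_def snd_conv if_True using A N1 J
      by (subst expectation_high_move) (auto simp: T_def intro!: sum.cong)
    also have "\<dots> = (\<Sum>t\<in>T. 1 / 2 ^ t)"
      by (subst sum.inter_restrict[symmetric]) (auto simp: T_def intro!: sum.cong)
    also have "\<dots> \<le> 2 * (\<bar>y i\<bar> / A)"
      using A by (intro sum_inverse_powers_le) (auto simp: T_def field_simps)
    finally show ?thesis .
  qed
  have "measure_pmf.prob ?P (- no_outlier A I y) \<le> measure_pmf.expectation ?P (\<lambda>\<psi>. \<Sum>i\<in>I. of_bool (real J * \<bar>snd (\<psi> (i, True))\<bar> * \<bar>y i\<bar> > A))"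
  proof (intro prob_le_expectation fin)
    fix \<psi> assume "\<psi> \<in> - no_outlier A I y"
    then obtain i where i: "i \<in> I" "real J * \<bar>snd (\<psi> (i, True))\<bar> * \<bar>y i\<bar> > A" by (auto simp: no_outlier_def not_le)
    have "(1::real) = of_bool (real J * \<bar>snd (\<psi> (i, True))\<bar> * \<bar>y i\<bar> > A)" using i by simp
    also have "\<dots> \<le> (\<Sum>i\<in>I. of_bool (real J * \<bar>snd (\<psi> (i, True))\<bar> * \<bar>y i\<bar> > A))"
      using I i(1) by (intro member_le_sum) auto
    finally show "1 \<le> (\<Sum>i\<in>I. of_bool (real J * \<bar>snd (\<psi> (i, True))\<bar> * \<bar>y i\<bar> > A) :: real)" .
  qed (simp add: sum_nonneg)
  also have "\<dots> \<le> (\<Sum>i\<in>I. 2 * (\<bar>y i\<bar> / A))"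
    unfolding expectation_sum[OF fin] using one by (intro sum_mono)
  also have "\<dots> = 2 / A" using y by (simp add: sum_distrib_left[symmetric] sum_divide_distrib[symmetric])
  finally show ?thesis .
qed

text \<open>The light parts contribute \<open>2 / J\<close>, half from the noise weights and half
  from the second moments. The rest is at most \<open>(J + w) / J\<close> by
  \<open>kept_le\<close>.\<close>

lemma expectation_sketched_norm:
  fixes A :: real
  assumes I: "finite I" and y: "(\<Sum>i\<in>I. \<bar>y i\<bar>) = 1" and A: "A > 0"
    and low: "2 * (real J)\<^sup>2 * A * n0 < 2 ^ (x0 + w)" and high: "2 * A * N1 < 2 ^ (J + w)"
  shows "measure_pmf.expectation (Pi_pmf (I \<times> UNIV) d entry_move)
      (\<lambda>\<psi>. indicator (no_outlier A I y) \<psi> * (\<Sum>b<N0 + N1. \<bar>sketch (I \<times> UNIV) (y \<circ> fst) \<psi> b\<bar>)) \<le> 1 + (w + 2) / J"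
proof -
  let ?M = "I \<times> (UNIV :: bool set)"
  let ?P = "Pi_pmf ?M d entry_move"
  let ?l = "\<lambda>\<psi> j. (fst (\<psi> j), light_part ((y \<circ> fst) j) (\<psi> j))"
  let ?X = "\<lambda>\<psi> b. sketch ?M (y \<circ> fst) (?l \<psi>) b"
  let ?h = "\<lambda>\<psi> j. heavy_part A (y (fst j)) (snd j) (\<psi> j)"
  have finM: "finite ?M" using I by simp
  have fin: "finite (set_pmf ?P)" by (intro finite_set_Pi_pmf finite_entry_move finM)
  have sumM: "sum f ?M = (\<Sum>i\<in>I. f (i, False) + f (i, True))" for f :: "_ \<Rightarrow> real"
  proof -
    have "sum f ?M = (\<Sum>i\<in>I. \<Sum>k\<in>UNIV. f (i, k))" by (simp add: sum.cartesian_product)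
    then show ?thesis by (simp add: UNIV_bool)
  qed
  have "measure_pmf.expectation ?P (\<lambda>\<psi>. indicator (no_outlier A I y) \<psi> * (\<Sum>b<N0 + N1. \<bar>sketch ?M (y \<circ> fst) \<psi> b\<bar>))
    \<le> measure_pmf.expectation ?P (\<lambda>\<psi>. 1 * (1/2 * (\<Sum>b<N0 + N1. noise_weight b) + 1/2 * (\<Sum>b<N0 + N1. 1 / noise_weight b * (?X \<psi> b)\<^sup>2)) + 1 * (\<Sum>j\<in>?M. ?h \<psi> j))"
  proof (intro expectation_mono fin)
    fix \<psi> assume \<psi>: "\<psi> \<in> set_pmf ?P"
    have range: "fst (\<psi> j) < N0 + N1" if "j \<in> ?M" for j
    proof -
      have "\<psi> j \<in> set_pmf (entry_move j)" using \<psi> that finM by (auto simp: set_Pi_pmf PiE_dflt_def)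
      then show ?thesis by (rule entry_move_range)
    qed
    show "indicator (no_outlier A I y) \<psi> * (\<Sum>b<N0 + N1. \<bar>sketch ?M (y \<circ> fst) \<psi> b\<bar>) \<le>
       1 * (1/2 * (\<Sum>b<N0 + N1. noise_weight b) + 1/2 * (\<Sum>b<N0 + N1. 1 / noise_weight b * (?X \<psi> b)\<^sup>2)) + 1 * (\<Sum>j\<in>?M. ?h \<psi> j)"
    proof (cases "\<psi> \<in> no_outlier A I y")
      case True
      have amgm: "\<bar>?X \<psi> b\<bar> \<le> (noise_weight b + 1 / noise_weight b * (?X \<psi> b)\<^sup>2) / 2" for b
      proof -
        define nw x where "nw = noise_weight b" and "x = \<bar>?X \<psi> b\<bar>"
        have nw: "nw > 0" using noise_weight_pos by (simp add: nw_def)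
        have "0 \<le> (nw - x)\<^sup>2" by simp
        then have "2 * x * nw \<le> nw\<^sup>2 + x\<^sup>2" by (simp add: power2_diff mult_ac)
        then have "x \<le> (nw + 1 / nw * x\<^sup>2) / 2" using nw by (simp add: field_simps power2_eq_square)
        then show ?thesis by (simp add: nw_def x_def)
      qed
      have heavy: "\<bar>(snd (\<psi> j) - light_part ((y \<circ> fst) j) (\<psi> j)) * (y \<circ> fst) j\<bar> = ?h \<psi> j" if "j \<in> ?M" for j
      proof -
        obtain i k where j: "j = (i, k)" by (cases j)
        have "k \<Longrightarrow> real J * \<bar>snd (\<psi> j)\<bar> * \<bar>y i\<bar> \<le> A" using True that by (auto simp: no_outlier_def j)
        then show ?thesis by (auto simp: heavy_part_def light_part_def j)
      qed
      have "(\<Sum>b<N0 + N1. \<bar>sketch ?M (y \<circ> fst) \<psi> b\<bar>) \<le>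
        (\<Sum>b<N0 + N1. \<bar>?X \<psi> b\<bar> + (\<Sum>j\<in>?M. if fst (\<psi> j) = b then \<bar>(snd (\<psi> j) - light_part ((y \<circ> fst) j) (\<psi> j)) * (y \<circ> fst) j\<bar> else 0))"
        by (intro sum_mono) (rule abs_sketch_le[of ?M "y \<circ> fst" \<psi> _ "\<lambda>j. light_part ((y \<circ> fst) j)"])
      also have "\<dots> = (\<Sum>b<N0 + N1. \<bar>?X \<psi> b\<bar>) + (\<Sum>j\<in>?M. \<Sum>b<N0 + N1. if fst (\<psi> j) = b then \<bar>(snd (\<psi> j) - light_part ((y \<circ> fst) j) (\<psi> j)) * (y \<circ> fst) j\<bar> else 0)"
        by (simp only: sum.distrib sum.swap[of _ ?M])
      also have "(\<Sum>j\<in>?M. \<Sum>b<N0 + N1. if fst (\<psi> j) = b then \<bar>(snd (\<psi> j) - light_part ((y \<circ> fst) j) (\<psi> j)) * (y \<circ> fst) j\<bar> else 0) = (\<Sum>j\<in>?M. ?h \<psi> j)"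
        using range heavy by (intro sum.cong refl) (simp add: sum.delta')
      also have "(\<Sum>b<N0 + N1. \<bar>?X \<psi> b\<bar>) \<le> (1/2 * (\<Sum>b<N0 + N1. noise_weight b) + 1/2 * (\<Sum>b<N0 + N1. 1 / noise_weight b * (?X \<psi> b)\<^sup>2))"
      proof -
        have "(\<Sum>b<N0 + N1. \<bar>?X \<psi> b\<bar>) \<le> (\<Sum>b<N0 + N1. (noise_weight b + 1 / noise_weight b * (?X \<psi> b)\<^sup>2) / 2)"
          by (intro sum_mono amgm)
        then show ?thesis by (simp only: sum_divide_distrib[symmetric] sum.distrib) simp
      qed
      finally show ?thesis using True by (simp add: o_def)
    next
      case False
      have "0 \<le> (1/2 * (\<Sum>b<N0 + N1. noise_weight b) + 1/2 * (\<Sum>b<N0 + N1. 1 / noise_weight b * (?X \<psi> b)\<^sup>2))"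
        using noise_weight_pos by (intro add_nonneg_nonneg mult_nonneg_nonneg sum_nonneg) (auto simp: less_imp_le)
      moreover have "0 \<le> (\<Sum>j\<in>?M. ?h \<psi> j)" by (intro sum_nonneg) (simp add: heavy_part_def)
      ultimately show ?thesis using False by simp
    qed
  qed
  also have "\<dots> = measure_pmf.expectation ?P (\<lambda>\<psi>. 1/2 * (\<Sum>b<N0 + N1. noise_weight b) + 1/2 * (\<Sum>b<N0 + N1. 1 / noise_weight b * (?X \<psi> b)\<^sup>2))
      + (\<Sum>j\<in>?M. measure_pmf.expectation ?P (\<lambda>\<psi>. ?h \<psi> j))"
    by (subst expectation_linear[OF fin]) (simp only: expectation_sum[OF fin] mult_1_left)
  also have "measure_pmf.expectation ?P (\<lambda>\<psi>. 1/2 * (\<Sum>b<N0 + N1. noise_weight b) + 1/2 * (\<Sum>b<N0 + N1. 1 / noise_weight b * (?X \<psi> b)\<^sup>2))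
      \<le> 1/2 * (2 / J) + 1/2 * (2 / J)"
  proof -
    have "measure_pmf.expectation ?P (\<lambda>\<psi>. \<Sum>b<N0 + N1. 1 / noise_weight b * (?X \<psi> b)\<^sup>2) \<le> (\<Sum>j\<in>?M. \<bar>(y \<circ> fst) j\<bar> / J)"
      by (rule light_sketch_second_moment[OF finM])
    also have "\<dots> = 2 / J" unfolding sumM using y by (simp add: sum_distrib_left[symmetric] sum_divide_distrib[symmetric])
    finally show ?thesis unfolding expectation_linear[OF fin] sum_noise_weight by simp
  qed
  also have "(\<Sum>j\<in>?M. measure_pmf.expectation ?P (\<lambda>\<psi>. ?h \<psi> j)) = (\<Sum>i\<in>I. \<bar>y i\<bar> * kept_low \<bar>y i\<bar> / J + \<bar>y i\<bar> * kept_high A \<bar>y i\<bar> / J)"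
    unfolding sumM
  proof (intro sum.cong refl)
    fix i assume "i \<in> I"
    then have "measure_pmf.expectation ?P (\<lambda>\<psi>. heavy_part A (y i) k (\<psi> (i, k))) = measure_pmf.expectation (entry_move (i, k)) (heavy_part A (y i) k)" for k
      by (intro expectation_Pi_component finM) auto
    then show "measure_pmf.expectation ?P (\<lambda>\<psi>. ?h \<psi> (i, False)) + measure_pmf.expectation ?P (\<lambda>\<psi>. ?h \<psi> (i, True)) = \<bar>y i\<bar> * kept_low \<bar>y i\<bar> / J + \<bar>y i\<bar> * kept_high A \<bar>y i\<bar> / J"
      using A by (simp add: expectation_heavy_part)
  qed
  also have "\<dots> \<le> (\<Sum>i\<in>I. \<bar>y i\<bar> * (1 + w / J))"
  proof (intro sum_mono)
    fix i
    show "\<bar>y i\<bar> * kept_low \<bar>y i\<bar> / J + \<bar>y i\<bar> * kept_high A \<bar>y i\<bar> / J \<le> \<bar>y i\<bar> * (1 + w / J)"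
    proof (cases "y i = 0")
      case False
      then have "kept_low \<bar>y i\<bar> + kept_high A \<bar>y i\<bar> \<le> J + w" using low high by (intro kept_le) auto
      then have "real (kept_low \<bar>y i\<bar>) + real (kept_high A \<bar>y i\<bar>) \<le> J + w" by linarith
      then have "\<bar>y i\<bar> / J * (real (kept_low \<bar>y i\<bar>) + real (kept_high A \<bar>y i\<bar>)) \<le> \<bar>y i\<bar> / J * (J + w)"
        by (intro mult_left_mono) auto
      also have "\<dots> = \<bar>y i\<bar> * (1 + w / J)" using J by (simp add: field_simps)
      finally show ?thesis by (simp add: algebra_simps add_divide_distrib)
    qed simp
  qed
  also have "\<dots> = 1 + w / J" using y by (simp add: sum_distrib_right[symmetric])
  finally show ?thesis by (simp add: add_divide_distrib o_def)
qed

end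

section \<open>The lower tail for a subspace\<close>

lemma sketch_diff: "sketch A (\<lambda>j. y j - y' j) \<psi> b = sketch A y \<psi> b - sketch A y' \<psi> b"
  unfolding sketch_def by (simp add: sum_subtractf[symmetric] right_diff_distrib if_distrib cong: if_cong)

lemma sketch_scale: "sketch A (\<lambda>j. c * y j) \<psi> b = c * sketch A y \<psi> b"
  unfolding sketch_def sum_distrib_left by (intro sum.cong) auto

definition sketched_norm :: "nat \<Rightarrow> 'm set \<Rightarrow> ('m \<Rightarrow> real) \<Rightarrow> ('m \<Rightarrow> nat \<times> real) \<Rightarrow> real" where
  "sketched_norm r A y \<psi> = (\<Sum>b<r. \<bar>sketch A y \<psi> b\<bar>)"

lemma sketched_norm_nonneg: "0 \<le> sketched_norm r A y \<psi>"
  by (simp add: sketched_norm_def sum_nonneg)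

lemma sketched_norm_scale: "sketched_norm r A (\<lambda>j. c * y j) \<psi> = \<bar>c\<bar> * sketched_norm r A y \<psi>"
  by (simp add: sketched_norm_def sketch_scale abs_mult sum_distrib_left)

lemma sketched_norm_diff: "sketched_norm r A y' \<psi> - sketched_norm r A (\<lambda>j. y' j - y j) \<psi> \<le> sketched_norm r A y \<psi>"
proof -
  have "sketched_norm r A y' \<psi> \<le> (\<Sum>b<r. \<bar>sketch A y \<psi> b\<bar> + \<bar>sketch A y' \<psi> b - sketch A y \<psi> b\<bar>)"
    unfolding sketched_norm_def by (intro sum_mono) auto
  also have "\<dots> = sketched_norm r A y \<psi> + sketched_norm r A (\<lambda>j. y' j - y j) \<psi>"
    by (simp add: sketched_norm_def sketch_diff sum.distrib)
  finally show ?thesis by simp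
qed

lemma sketched_norm_le:
  assumes "\<And>j. j \<in> A \<Longrightarrow> \<bar>snd (\<psi> j)\<bar> \<le> c j"
  shows "sketched_norm r A y \<psi> \<le> (\<Sum>j\<in>A. c j * \<bar>y j\<bar>)"
proof -
  have "sketched_norm r A y \<psi> \<le> (\<Sum>b<r. \<Sum>j\<in>A. if fst (\<psi> j) = b then c j * \<bar>y j\<bar> else 0)"
    unfolding sketched_norm_def sketch_def
  proof (intro sum_mono order_trans[OF sum_abs])
    fix b j assume "j \<in> A"
    then show "\<bar>if fst (\<psi> j) = b then snd (\<psi> j) * y j else 0\<bar> \<le> (if fst (\<psi> j) = b then c j * \<bar>y j\<bar> else 0)"
      using assms by (simp add: abs_mult mult_right_mono)
  qed
  also have "\<dots> = (\<Sum>j\<in>A. \<Sum>b<r. if fst (\<psi> j) = b then c j * \<bar>y j\<bar> else 0)" by (rule sum.swap)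
  also have "\<dots> \<le> (\<Sum>j\<in>A. c j * \<bar>y j\<bar>)"
  proof (intro sum_mono)
    fix j assume "j \<in> A"
    then have "0 \<le> c j" using assms[of j] by linarith
    then show "(\<Sum>b<r. if fst (\<psi> j) = b then c j * \<bar>y j\<bar> else 0) \<le> c j * \<bar>y j\<bar>" by (simp add: sum.delta')
  qed
  finally show ?thesis .
qed

lemma clipped_norm_le_sketched_norm: "clipped_norm N0 K r (sketch A y \<psi>) \<le> sketched_norm r A y \<psi>"
  unfolding clipped_norm_def sketched_norm_def by (intro sum_mono) (simp add: bucket_val_def)

context sketching_scheme
begin

lemma entry_move_scale:
  assumes "v \<in> set_pmf (entry_move j)"
  shows "\<bar>snd v\<bar> \<le> (if snd j then 2 ^ x1 / J else 1)"
proof (cases "snd j")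
  case True
  then have "v \<in> set_pmf high_move" using assms by (simp add: entry_move_def)
  then obtain t where t: "t \<in> insert 0 {x0..x1}" "\<bar>snd v\<bar> = level_scale t" by (rule high_moveD)
  have "level_scale t \<le> 2 ^ x1 / J"
    using t(1) by (auto simp: level_scale_def intro!: divide_right_mono power_increasing)
  then show ?thesis using t True by simp
next
  case False
  then show ?thesis using assms low_moveD(2)[of v] by (simp add: entry_move_def)
qed

end

section \<open>Union bound over a net of coefficient vectors\<close>

context sketching_lower
begin

text \<open>The net has the coefficients in steps of \<open>1 / q\<close> between -2 and 2, as the
  basis bounds the coefficients of a unit vector by 2; these are \<open>4 * q + 1\<close> values
  each. Rounding changes the norm by at most \<open>m / q\<close> and the sketched norm by at most
  \<open>1 + 2 ^ x1 / J\<close> times that. By the choice of \<open>q\<close> this costs one more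
  \<open>s\<close> than the bound for a fixed vector.\<close>

lemma uniform_lower_tail:
  fixes u :: "nat \<Rightarrow> 'i \<Rightarrow> real" and m q :: nat
  defines "z \<equiv> (\<lambda>e i. \<Sum>a<m. e a * u a i)"
  defines "N \<equiv> (\<lambda>y. \<Sum>i\<in>I. \<bar>y i\<bar> :: real)"
  assumes u: "\<And>a. a < m \<Longrightarrow> N (u a) \<le> 1"
    and coeff: "\<And>e a. a < m \<Longrightarrow> \<bar>e a\<bar> \<le> 2 * N (z e)"
    and lev: "\<And>e i. i \<in> I \<Longrightarrow> \<bar>z e i\<bar> \<le> l i * N (z e)"
    and light: "\<And>i. i \<in> I - H \<Longrightarrow> l i \<le> K0"
    and q: "real m * (2 + 2 ^ x1 / J) \<le> s * real q"
  shows "measure_pmf.prob (P d) {\<psi>. collision_loss H l \<psi> \<le> s \<and>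
      (\<exists>e. sketched_norm (N0 + N1) M (z e \<circ> fst) \<psi> < (1 - 6 / J - 6 * s) * N (z e))}
    \<le> real ((4 * q + 1) ^ m) * ((1 + 4 * card I) * exp (- (s\<^sup>2 / (4 * K0))))"
proof -
  let ?g = "\<lambda>y \<psi>. sketched_norm (N0 + N1) M (y \<circ> fst) \<psi>"
  define L where "L = 1 - 6 / J - 5 * s"
  have "6 / real J \<ge> 0" by simp
  then have L1: "L \<le> 1" unfolding L_def using s(1) by linarith
  have N_nonneg: "N y \<ge> 0" for y by (simp add: N_def sum_nonneg)
  have N_scale: "N (\<lambda>i. c * y i) = \<bar>c\<bar> * N y" for c y
    by (simp add: N_def abs_mult sum_distrib_left)
  have z_scale: "z (\<lambda>a. c * e a) = (\<lambda>i. c * z e i)" for c e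
    by (simp add: z_def sum_distrib_left mult.assoc)
  have g_scale: "?g (\<lambda>i. c * y i) \<psi> = \<bar>c\<bar> * ?g y \<psi>" for c y \<psi>
    using sketched_norm_scale[of "N0 + N1" M c "y \<circ> fst" \<psi>] by (simp add: o_def)
  define E where "E = {\<psi>. collision_loss H l \<psi> \<le> s}"
  define grid where "grid = PiE {..<m} (\<lambda>_. {- 2 * int q..2 * int q})"
  define pt where "pt f = z (\<lambda>a. real_of_int (f a) / q)" for f :: "nat \<Rightarrow> int"
  define bad where "bad f = {\<psi>. \<psi> \<in> E \<and> ?g (pt f) \<psi> < L * N (pt f)}" for f
  have fin_grid: "finite grid" by (simp add: grid_def finite_PiE)
  have card_grid: "card grid = (4 * q + 1) ^ m"
  proof -
    have "card {- 2 * int q..2 * int q} = 4 * q + 1" by simp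
    then show ?thesis by (simp add: grid_def card_PiE del: card_atLeastAtMost_int)
  qed
  have bad: "measure_pmf.prob (P d) (bad f) \<le> (1 + 4 * card I) * exp (- (s\<^sup>2 / (4 * K0)))" for f
  proof (cases "N (pt f) = 0")
    \<comment> \<open>The strict inequality in \<open>bad\<close> rules out the zero vector, which
      cannot be normalized.\<close>
    case True
    then have "bad f = {}" using sketched_norm_nonneg[of "N0 + N1" M "pt f \<circ> fst"] by (auto simp: bad_def not_less)
    then show ?thesis by (simp only: measure_empty) simp
  next
    case False
    define e where "e a = real_of_int (f a) / q" for a
    define c where "c = 1 / N (pt f)"
    define y where "y i = c * pt f i" for i
    have c: "c > 0" using False N_nonneg[of "pt f"] by (simp add: c_def)
    have Ny: "N y = 1" using c False unfolding y_def N_scale by (simp add: c_def)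
    have "pt f = z e" by (simp add: pt_def e_def[abs_def])
    then have y_z: "y = z (\<lambda>a. c * e a)" using z_scale[of c e] by (simp add: y_def fun_eq_iff)
    have lev': "\<bar>y i\<bar> \<le> l i" if "i \<in> I" for i
      using lev[OF that, of "\<lambda>a. c * e a"] Ny unfolding y_z[symmetric] by simp
    have "bad f \<subseteq> {\<psi>. collision_loss H l \<psi> \<le> s \<and> clipped_norm N0 K (N0 + N1) (sketch M (y \<circ> fst) \<psi>) \<le> 1 - 6 / J - 5 * s}"
    proof
      fix \<psi> assume "\<psi> \<in> bad f"
      then have \<psi>: "\<psi> \<in> E" "?g (pt f) \<psi> < L * N (pt f)" by (auto simp: bad_def)
      have "?g y \<psi> = c * ?g (pt f) \<psi>" using g_scale[of c "pt f" \<psi>] c by (simp add: y_def[abs_def])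
      also have "\<dots> \<le> c * (L * N (pt f))" using \<psi>(2) c by simp
      also have "\<dots> = L" using False by (simp add: c_def)
      finally have "clipped_norm N0 K (N0 + N1) (sketch M (y \<circ> fst) \<psi>) \<le> L"
        using clipped_norm_le_sketched_norm order_trans by blast
      then show "\<psi> \<in> {\<psi>. collision_loss H l \<psi> \<le> s \<and> clipped_norm N0 K (N0 + N1) (sketch M (y \<circ> fst) \<psi>) \<le> 1 - 6 / J - 5 * s}"
        using \<psi>(1) by (simp add: E_def L_def)
    qed
    then have "measure_pmf.prob (P d) (bad f) \<le> measure_pmf.prob (P d)
       {\<psi>. collision_loss H l \<psi> \<le> s \<and> clipped_norm N0 K (N0 + N1) (sketch M (y \<circ> fst) \<psi>) \<le> 1 - 6 / J - 5 * s}"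
      by (intro measure_pmf.finite_measure_mono) auto
    also have "\<dots> \<le> (1 + 4 * card I) * exp (- (s\<^sup>2 / (4 * K0)))"
    proof (rule clipped_norm_lower_tail)
      show "(\<Sum>i\<in>I. \<bar>y i\<bar>) = 1" using Ny by (simp add: N_def)
      show "\<bar>y i\<bar> \<le> K0" if "i \<in> I - H" for i using lev'[of i] light[OF that] that by simp
      show "\<bar>y i\<bar> \<le> l i" if "i \<in> H" for i using lev'[of i] that H by auto
    qed
    finally show ?thesis .
  qed
  let ?A = "{\<psi>. collision_loss H l \<psi> \<le> s \<and> (\<exists>e. ?g (z e) \<psi> < (1 - 6 / J - 6 * s) * N (z e))}"
  \<comment> \<open>The rounding error in the sketch is bounded by the largest scale of a move,
    which is only known on the support.\<close>
  have "?A \<inter> set_pmf (P d) \<subseteq> (\<Union>f\<in>grid. bad f)"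
  proof
    fix \<psi> assume \<psi>: "\<psi> \<in> ?A \<inter> set_pmf (P d)"
    then obtain e0 where e0: "?g (z e0) \<psi> < (1 - 6 / J - 6 * s) * N (z e0)" and E: "\<psi> \<in> E"
      by (auto simp: E_def)
    have N0: "N (z e0) > 0"
      using e0 sketched_norm_nonneg[of "N0 + N1" M "z e0 \<circ> fst" \<psi>] N_nonneg[of "z e0"]
      by (cases "N (z e0) = 0") auto
    define c where "c = 1 / N (z e0)"
    define e where "e a = c * e0 a" for a
    have ze: "z e = (\<lambda>i. c * z e0 i)" unfolding e_def by (rule z_scale)
    have Ne: "N (z e) = 1" unfolding ze N_scale using N0 by (simp add: c_def)
    have ge: "?g (z e) \<psi> < L - s"
    proof -
      have "?g (z e) \<psi> = c * ?g (z e0) \<psi>" unfolding ze using g_scale[of c "z e0" \<psi>] N0 by (simp add: c_def)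
      also have "\<dots> < c * ((1 - 6 / J - 6 * s) * N (z e0))" by (rule mult_strict_left_mono[OF e0]) (simp add: c_def N0)
      also have "\<dots> = L - s" using N0 by (simp add: c_def L_def)
      finally show ?thesis .
    qed
    have m: "m \<noteq> 0"
    proof
      assume "m = 0"
      then show False using Ne by (simp add: z_def N_def)
    qed
    have "0 < real m * (2 + 2 ^ x1 / J)" using m by (simp add: add_pos_nonneg)
    then have q0: "real q > 0" using q s(1) by (meson less_le_trans zero_less_mult_pos)
    define f where "f = restrict (\<lambda>a. \<lfloor>q * e a\<rfloor>) {..<m}"
    have ea: "\<bar>e a\<bar> \<le> 2" if "a < m" for a using coeff[OF that, of e] Ne by simp
    have f: "f \<in> grid"
      unfolding grid_def
    proof (rule PiE_I)
      fix a assume a: "a \<in> {..<m}"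
      have "\<bar>q * e a\<bar> \<le> q * 2" using ea[of a] a q0 by (simp add: abs_mult)
      then have "- 2 * int q \<le> \<lfloor>q * e a\<rfloor> \<and> \<lfloor>q * e a\<rfloor> \<le> 2 * int q"
        by (auto simp: le_floor_iff floor_le_iff abs_le_iff)
      then show "f a \<in> {- 2 * int q..2 * int q}" using a by (simp add: f_def)
    qed (simp add: f_def)
    define \<Delta> where "\<Delta> i = pt f i - z e i" for i
    have N\<Delta>: "N \<Delta> \<le> m / q"
    proof -
      have "N \<Delta> \<le> (\<Sum>i\<in>I. \<Sum>a<m. 1 / q * \<bar>u a i\<bar>)"
        unfolding N_def
      proof (intro sum_mono)
        fix i
        have "\<Delta> i = (\<Sum>a<m. (\<lfloor>q * e a\<rfloor> / q - e a) * u a i)"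
          by (simp add: \<Delta>_def pt_def z_def f_def sum_subtractf left_diff_distrib)
        also have "\<bar>\<dots>\<bar> \<le> (\<Sum>a<m. 1 / q * \<bar>u a i\<bar>)"
        proof (intro order_trans[OF sum_abs] sum_mono)
          fix a
          have "\<bar>\<lfloor>q * e a\<rfloor> / q - e a\<bar> \<le> 1 / q"
          proof -
            have "\<lfloor>q * e a\<rfloor> / q - e a = (\<lfloor>q * e a\<rfloor> - q * e a) / q" using q0 by (simp add: field_simps)
            also have "\<bar>\<dots>\<bar> \<le> 1 / q" unfolding abs_divide using q0 by (intro frac_le) (auto simp: abs_le_iff, linarith+)
            finally show ?thesis .
          qed
          then show "\<bar>(\<lfloor>q * e a\<rfloor> / q - e a) * u a i\<bar> \<le> 1 / q * \<bar>u a i\<bar>"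
            unfolding abs_mult by (intro mult_right_mono) auto
        qed
        finally show "\<bar>\<Delta> i\<bar> \<le> (\<Sum>a<m. 1 / q * \<bar>u a i\<bar>)" .
      qed
      also have "\<dots> = (\<Sum>a<m. 1 / q * N (u a))" by (subst sum.swap) (simp add: N_def sum_divide_distrib)
      also have "\<dots> \<le> (\<Sum>a<m. 1 / q * 1)" using u by (intro sum_mono mult_left_mono) auto
      finally show ?thesis by simp
    qed
    have Npt: "1 - m / q \<le> N (pt f)"
    proof -
      have "N (z e) \<le> (\<Sum>i\<in>I. \<bar>pt f i\<bar> + \<bar>\<Delta> i\<bar>)" unfolding N_def \<Delta>_def by (intro sum_mono) auto
      also have "\<dots> = N (pt f) + N \<Delta>" by (simp add: N_def sum.distrib)
      finally show ?thesis using Ne N\<Delta> by simp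
    qed
    have g\<Delta>: "?g \<Delta> \<psi> \<le> (1 + 2 ^ x1 / J) * (m / q)"
    proof -
      have "\<bar>snd (\<psi> j)\<bar> \<le> (if snd j then 2 ^ x1 / J else 1)" if "j \<in> M" for j
        using \<psi> that finite_M by (intro entry_move_scale) (auto simp: set_Pi_pmf PiE_dflt_def)
      then have "?g \<Delta> \<psi> \<le> (\<Sum>j\<in>M. (if snd j then 2 ^ x1 / J else 1) * \<bar>(\<Delta> \<circ> fst) j\<bar>)"
        by (rule sketched_norm_le)
      also have "\<dots> = (\<Sum>i\<in>I. \<Sum>k\<in>UNIV. (if k then 2 ^ x1 / J else 1) * \<bar>\<Delta> i\<bar>)"
        by (simp add: sum.cartesian_product case_prod_beta)
      also have "\<dots> = (1 + 2 ^ x1 / J) * N \<Delta>"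
        by (simp add: UNIV_bool N_def sum_distrib_left sum.distrib sum_divide_distrib algebra_simps)
      also have "\<dots> \<le> (1 + 2 ^ x1 / J) * (m / q)" using N\<Delta> by (intro mult_left_mono) auto
      finally show ?thesis .
    qed
    have "?g (pt f) \<psi> - ?g \<Delta> \<psi> \<le> ?g (z e) \<psi>"
      using sketched_norm_diff[of "N0 + N1" M "pt f \<circ> fst" \<psi> "z e \<circ> fst"] by (simp add: \<Delta>_def o_def)
    then have "?g (pt f) \<psi> < L - s + (1 + 2 ^ x1 / J) * (m / q)" using ge g\<Delta> by linarith
    also have "\<dots> \<le> L - m / q"
    proof -
      have "(m / q) * (2 + 2 ^ x1 / J) \<le> s" using q q0 by (simp add: field_simps)
      then show ?thesis by (simp add: algebra_simps)
    qed
    also have "\<dots> \<le> L * N (pt f)"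
    proof (cases "L \<ge> 0")
      case True
      have "L * (m / q) \<le> 1 * (m / q)" using L1 by (intro mult_right_mono) auto
      then have "L - m / q \<le> L * (1 - m / q)" by (simp add: algebra_simps)
      also have "\<dots> \<le> L * N (pt f)" using Npt True by (rule mult_left_mono)
      finally show ?thesis .
    next
      case False
      have "?g (z e) \<psi> \<ge> 0" by (rule sketched_norm_nonneg)
      then show ?thesis using ge False s(1) by linarith
    qed
    finally have "\<psi> \<in> bad f" using E by (simp add: bad_def)
    then show "\<psi> \<in> (\<Union>f\<in>grid. bad f)" using f by blast
  qed
  then have "measure_pmf.prob (P d) (?A \<inter> set_pmf (P d)) \<le> measure_pmf.prob (P d) (\<Union>f\<in>grid. bad f)"
    by (intro measure_pmf.finite_measure_mono) auto
  also have "\<dots> \<le> (\<Sum>f\<in>grid. measure_pmf.prob (P d) (bad f))" by (rule prob_UN_le[OF fin_grid])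
  also have "\<dots> \<le> (\<Sum>f\<in>grid. (1 + 4 * card I) * exp (- (s\<^sup>2 / (4 * K0))))" using bad by (intro sum_mono)
  also have "\<dots> = real ((4 * q + 1) ^ m) * ((1 + 4 * card I) * exp (- (s\<^sup>2 / (4 * K0))))" by (simp add: card_grid)
  finally show ?thesis by (simp only: measure_Int_set_pmf)
qed

text \<open>Heavy entries have \<open>l i > K0\<close>, so there are at most
  \<open>sum l H / K0\<close> of them. Markov's inequality then yields the square of the
  sum.\<close>

lemma collision_tail:
  assumes "\<And>i. i \<in> H \<Longrightarrow> K0 < l i"
  shows "measure_pmf.prob (P d) {\<psi>. s < collision_loss H l \<psi>} \<le> (sum l H)\<^sup>2 / (K0 * n0 * s)"
proof -
  have l: "0 \<le> l i" if "i \<in> H" for i using assms[OF that] K0 by simp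
  have "measure_pmf.prob (P d) {\<psi>. s < collision_loss H l \<psi>} \<le> measure_pmf.expectation (P d) (collision_loss H l) / s"
    using l s by (intro prob_Markov finite_P) (auto simp: collision_loss_def intro!: sum_nonneg)
  also have "\<dots> \<le> (sum l H * card H / n0) / s"
    using s l by (intro divide_right_mono expectation_collision_loss[OF I(1) H]) auto
  also have "\<dots> \<le> (sum l H * (sum l H / K0) / n0) / s"
  proof -
    have "card H * K0 = (\<Sum>i\<in>H. K0)" by simp
    also have "\<dots> \<le> sum l H" using assms by (intro sum_mono) (auto intro: less_imp_le)
    finally have "card H \<le> sum l H / K0" using K0 by (simp add: field_simps)
    moreover have "0 \<le> sum l H" using l by (simp add: sum_nonneg)
    ultimately show ?thesis using s by (intro divide_right_mono mult_left_mono) auto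
  qed
  also have "\<dots> = (sum l H)\<^sup>2 / (K0 * n0 * s)" by (simp add: power2_eq_square)
  finally show ?thesis .
qed

end

section \<open>The random sketching matrix\<close>

text \<open>Each input row is split into \<open>R\<close> equal parts and each part enters both
  tables: the index \<open>l\<close> encodes the part \<open>l div 2\<close> and the copy
  \<open>odd l\<close>.\<close>

definition sketch_matrix :: "nat \<Rightarrow> nat \<Rightarrow> nat \<Rightarrow> ((nat \<times> nat) \<times> bool \<Rightarrow> nat \<times> real) \<Rightarrow> real mat" where
  "sketch_matrix r n R \<psi> = column_matrix r n (2 * R) (\<lambda>i l. fst (\<psi> ((i, l div 2), odd l)))
     (\<lambda>i l. snd (\<psi> ((i, l div 2), odd l)) / R)"

lemma sum_even_odd:
  fixes f :: "nat \<Rightarrow> bool \<Rightarrow> real"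
  shows "(\<Sum>l<2 * R. f (l div 2) (odd l)) = (\<Sum>l<R. \<Sum>k\<in>UNIV. f l k)"
proof (induction R)
  case (Suc R)
  have "2 * Suc R = Suc (Suc (2 * R))" by simp
  then show ?case using Suc by (simp add: UNIV_bool add.commute)
qed simp

lemma sum_Times: "sum f (A \<times> B) = (\<Sum>x\<in>A. \<Sum>y\<in>B. f (x, y))"
  by (simp add: sum.cartesian_product)

lemma sketch_matrix_row:
  assumes A: "A \<in> carrier_mat n k" and v: "v \<in> carrier_vec k" and b: "b < r"
  shows "row (sketch_matrix r n R \<psi> * A) b \<bullet> v =
    sketch (({..<n} \<times> {..<R}) \<times> UNIV) ((\<lambda>i. (A *\<^sub>v v) $ fst i / R) \<circ> fst) \<psi> b"
proof -
  let ?S = "sketch_matrix r n R \<psi>"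
  define z where "z = A *\<^sub>v v"
  have S: "?S \<in> carrier_mat r n" by (simp add: sketch_matrix_def column_matrix_def)
  have z: "z \<in> carrier_vec n" using A v by (simp add: z_def)
  have "row (?S * A) b \<bullet> v = ((?S * A) *\<^sub>v v) $ b" using S b by simp
  also have "(?S * A) *\<^sub>v v = ?S *\<^sub>v z" unfolding z_def using S A v by (intro assoc_mult_mat_vec)
  also have "(?S *\<^sub>v z) $ b = (\<Sum>i<n. ?S $$ (b, i) * z $ i)"
    using S z b by (simp add: scalar_prod_def lessThan_atLeast0)
  also have "\<dots> = (\<Sum>i<n. \<Sum>l<R. \<Sum>k\<in>UNIV. if fst (\<psi> ((i, l), k)) = b then snd (\<psi> ((i, l), k)) * (z $ i / R) else 0)"
  proof (intro sum.cong refl)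
    fix i assume "i \<in> {..<n}"
    then have "?S $$ (b, i) * z $ i =
      (\<Sum>l<2 * R. (\<lambda>l k. if fst (\<psi> ((i, l), k)) = b then snd (\<psi> ((i, l), k)) * (z $ i / R) else 0) (l div 2) (odd l))"
    proof -
      have "?S $$ (b, i) = (\<Sum>l<2 * R. if fst (\<psi> ((i, l div 2), odd l)) = b then snd (\<psi> ((i, l div 2), odd l)) / R else 0)"
        using b \<open>i \<in> {..<n}\<close> by (simp add: sketch_matrix_def column_matrix_def)
      then show ?thesis
        unfolding sum_distrib_right by (simp only: sum_distrib_right) (intro sum.cong refl, simp)
    qed
    also have "\<dots> = (\<Sum>l<R. \<Sum>k\<in>UNIV. if fst (\<psi> ((i, l), k)) = b then snd (\<psi> ((i, l), k)) * (z $ i / R) else 0)"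
      by (rule sum_even_odd)
    finally show "?S $$ (b, i) * z $ i = \<dots>" .
  qed
  also have "\<dots> = sketch (({..<n} \<times> {..<R}) \<times> UNIV) ((\<lambda>i. z $ fst i / R) \<circ> fst) \<psi> b"
    unfolding sketch_def sum_Times o_apply fst_conv ..
  finally show ?thesis by (simp add: z_def)
qed

lemma append_col_mult:
  assumes X: "X \<in> carrier_mat n d" and Y: "Y \<in> carrier_vec n" and \<beta>: "\<beta> \<in> carrier_vec d"
  shows "append_col X Y *\<^sub>v (\<beta> @\<^sub>v vec_of_list [-1]) = X *\<^sub>v \<beta> - Y"
proof (rule eq_vecI)
  fix i assume "i < dim_vec (X *\<^sub>v \<beta> - Y)"
  then have i: "i < n" using X Y by simp
  have "(append_col X Y *\<^sub>v (\<beta> @\<^sub>v vec_of_list [-1])) $ i =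
     (\<Sum>a\<in>{0..<Suc d}. (if a < d then X $$ (i, a) else Y $ i) * (\<beta> @\<^sub>v vec_of_list [-1]) $ a)"
    using X Y \<beta> i by (simp add: append_col_def scalar_prod_def)
  also have "\<dots> = (\<Sum>a\<in>{0..<d}. X $$ (i, a) * \<beta> $ a) - Y $ i"
  proof -
    have "(\<Sum>a\<in>{0..<d}. (if a < d then X $$ (i, a) else Y $ i) * (\<beta> @\<^sub>v vec_of_list [-1]) $ a) = (\<Sum>a\<in>{0..<d}. X $$ (i, a) * \<beta> $ a)"
      using \<beta> by (intro sum.cong) auto
    moreover have "(\<beta> @\<^sub>v vec_of_list [-1]) $ d = - 1" using \<beta> by simp
    ultimately show ?thesis by simp
  qed
  also have "\<dots> = (X *\<^sub>v \<beta> - Y) $ i" using X Y \<beta> i by (simp add: scalar_prod_def)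
  finally show "(append_col X Y *\<^sub>v (\<beta> @\<^sub>v vec_of_list [-1])) $ i = (X *\<^sub>v \<beta> - Y) $ i" .
qed (use X Y in \<open>simp add: append_col_def\<close>)

lemma sketched_loss_eq:
  assumes X: "X \<in> carrier_mat n d" and Y: "Y \<in> carrier_vec n" and \<beta>: "\<beta> \<in> carrier_vec d" and \<nu>: "\<nu> \<ge> 0"
  shows "sketched_loss (sketch_matrix r n R \<psi> * append_col X Y) (vec r (\<lambda>_. \<nu>)) \<beta> =
    \<nu> * sketched_norm r (({..<n} \<times> {..<R}) \<times> UNIV) ((\<lambda>i. (X *\<^sub>v \<beta> - Y) $ fst i / R) \<circ> fst) \<psi>"
proof -
  have A: "append_col X Y \<in> carrier_mat n (Suc d)" using X by (auto simp: append_col_def)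
  have v: "\<beta> @\<^sub>v vec_of_list [-1] \<in> carrier_vec (Suc d)" using \<beta> by (intro carrier_vecI) simp
  have dim: "dim_row (sketch_matrix r n R \<psi> * append_col X Y) = r" by (simp add: sketch_matrix_def column_matrix_def)
  show ?thesis
    unfolding sketched_loss_def sketched_norm_def sum_distrib_left dim
  proof (intro sum.cong refl)
    fix b assume "b \<in> {..<r}"
    then have b: "b < r" by simp
    show "vec r (\<lambda>_. \<nu>) $ b * \<bar>row (sketch_matrix r n R \<psi> * append_col X Y) b \<bullet> (\<beta> @\<^sub>v vec_of_list [-1])\<bar> =
      \<nu> * \<bar>sketch (({..<n} \<times> {..<R}) \<times> UNIV) ((\<lambda>i. (X *\<^sub>v \<beta> - Y) $ fst i / R) \<circ> fst) \<psi> b\<bar>"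
      unfolding sketch_matrix_row[OF A v b] append_col_mult[OF X Y \<beta>] index_vec[OF b] ..
  qed
qed

context sketching_scheme
begin

definition sketch_pmf :: "nat \<Rightarrow> nat \<Rightarrow> real \<Rightarrow> (real mat \<times> real vec) pmf" where
  "sketch_pmf n R \<nu> = map_pmf (\<lambda>\<psi>. (sketch_matrix (N0 + N1) n R \<psi>, vec (N0 + N1) (\<lambda>_. \<nu>)))
     (Pi_pmf (({..<n} \<times> {..<R}) \<times> UNIV) (0, 0) entry_move)"

lemma sketch_pmf_distribution:
  assumes "\<nu> > 0"
  shows "sketch_distribution (N0 + N1) n (sketch_pmf n R \<nu>)"
  using assms by (auto simp: sketch_distribution_def sketch_pmf_def sketch_matrix_def column_matrix_def)

lemma sketch_pmf_computes:
  assumes "(S, w) \<in> set_pmf (sketch_pmf n R \<nu>)" "18 * real R + 5 \<le> \<tau>"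
  shows "stream_computes sketch_update S m \<tau>"
proof -
  obtain \<psi> where \<psi>: "\<psi> \<in> set_pmf (Pi_pmf (({..<n} \<times> {..<R}) \<times> UNIV) (0, 0) entry_move)"
    and S: "S = sketch_matrix (N0 + N1) n R \<psi>" using assms(1) by (auto simp: sketch_pmf_def)
  show ?thesis
    unfolding S sketch_matrix_def
  proof (rule stream_computes_column_matrix)
    fix i l assume il: "i < n" "l < 2 * R"
    then have "\<psi> ((i, l div 2), odd l) \<in> set_pmf (entry_move ((i, l div 2), odd l))"
      using \<psi> by (auto simp: set_Pi_pmf PiE_dflt_def)
    then show "fst (\<psi> ((i, l div 2), odd l)) < N0 + N1" by (rule entry_move_range)
  qed (use assms(2) in simp)
qed

text \<open>All failure events for parameters that are still open: \<open>\<delta>H\<close> for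
  collisions of heavy entries, \<open>\<delta>N\<close> for the net, \<open>2 / A\<close> for
  outliers, and Markov's bound at the optimum. The alternative in \<open>heavy\<close> distinguishes
  the two variants: rows split so finely that no entry is heavy, or few collisions of the heavy
  ones.\<close>

lemma sketch_success:
  fixes X :: "real mat" and \<epsilon> \<alpha> s K0 K A \<delta>H \<delta>N \<delta> :: real and n R d q w :: nat
  defines "L \<equiv> 1 - 6 / J - 6 * s"
  assumes X: "X \<in> carrier_mat n d" and Y: "Y \<in> carrier_vec n" and opt: "l1_minimizer X Y \<beta>opt"
    and nR: "n \<ge> 1" "R \<ge> 1"
    and s: "0 < s" "1 / s \<le> real J" "6 / J + 2 * s \<le> 1"
    and K0: "0 < K0" and K: "K = K0 / s"
    and n0K: "real n0 * K \<ge> 8" and N1K: "real N1 * K \<ge> 4 * 2 ^ J" "real N1 * K \<ge> 4 * real (Suc x1 - x0)"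
    and x0K: "4 * 2 ^ x0 \<le> K * J * n0" and x1K: "K * J < 2 ^ Suc x1 * (s / (real n * real R))"
    and heavy: "1 \<le> R * K0 \<or> R = 1 \<and> (2 * (real d + 1))\<^sup>2 \<le> \<delta>H * (K0 * n0 * s)" and \<delta>H: "0 \<le> \<delta>H"
    and q: "(real d + 1) * (2 + 2 ^ x1 / J) \<le> s * real q"
    and \<delta>N: "real ((4 * q + 1) ^ (d + 1)) * ((1 + 4 * real (n * R)) * exp (- (s\<^sup>2 / (4 * K0)))) \<le> \<delta>N"
    and A: "A > 0" and low: "2 * (real J)\<^sup>2 * A * n0 < 2 ^ (x0 + w)" and high: "2 * A * N1 < 2 ^ (J + w)"
    and L: "L > 0" and \<epsilon>: "0 < \<epsilon>" "\<epsilon> < 1" and \<alpha>: "\<alpha> > 1"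
    and \<delta>: "\<delta> = \<delta>H + \<delta>N + 2 / A"
  shows "measure_pmf.prob (sketch_pmf n R ((1 - \<epsilon>) / L))
      {(S, w). weak_weighted_sketch X Y \<beta>opt \<alpha> \<epsilon> (S * append_col X Y) w}
    \<ge> 1 - (\<delta> + (1 - \<epsilon>) * ((1 + (real w + 2) / J) / L - 1 + \<delta>) / (\<alpha> - 1 + \<epsilon>))"
proof -
  define I where "I = {..<n} \<times> {..<R}"
  let ?M = "I \<times> (UNIV :: bool set)"
  define P where "P = Pi_pmf ?M (0, 0 :: real) entry_move"
  \<comment> \<open>This weight turns the uniform lower bound \<open>L\<close> into exactly
    \<open>1 - \<epsilon>\<close>.\<close>
  define \<nu> where "\<nu> = (1 - \<epsilon>) / L"
  define r where "r = N0 + N1"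
  have \<nu>: "\<nu> > 0" "\<nu> * L = 1 - \<epsilon>" using L \<epsilon> by (auto simp: \<nu>_def)
  have I: "finite I" "I \<noteq> {}" "card I = n * R" using nR by (auto simp: I_def lessThan_empty_iff)
  have sumI: "(\<Sum>i\<in>I. \<bar>f (fst i) / R\<bar>) = (\<Sum>i<n. \<bar>f i\<bar>)" for f :: "nat \<Rightarrow> real"
  proof -
    have "(\<Sum>i\<in>I. \<bar>f (fst i) / R\<bar>) = (\<Sum>i<n. \<Sum>l<R. \<bar>f i / R\<bar>)"
      unfolding I_def sum_Times by simp
    also have "\<dots> = (\<Sum>i<n. \<bar>f i\<bar>)" using nR by (intro sum.cong) auto
    finally show ?thesis .
  qed
  obtain m u0 where m: "m \<le> d + 1" and u0: "\<forall>a<m. (\<Sum>i<n. \<bar>u0 a i\<bar>) \<le> 1"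
    and coeff: "\<forall>e. \<forall>a<m. \<bar>e a\<bar> \<le> 2 * (\<Sum>i<n. \<bar>\<Sum>b<m. e b * u0 b i\<bar>)"
    and span: "\<forall>c. \<exists>e. \<forall>i\<in>{..<n}. (\<Sum>a<d + 1. c a * append_col X Y $$ (i, a)) = (\<Sum>a<m. e a * u0 a i)"
    using near_auerbach_basis[of "{..<n}" "d + 1" "\<lambda>a i. append_col X Y $$ (i, a)"] by blast
  define u where "u a i = u0 a (fst i) / R" for a and i :: "nat \<times> nat"
  define z where "z e i = (\<Sum>a<m. e a * u a i)" for e i
  define N where "N y = (\<Sum>i\<in>I. \<bar>y i :: real\<bar>)" for y
  have z_u0: "z e i = (\<Sum>a<m. e a * u0 a (fst i)) / R" for e i
    by (simp add: z_def u_def sum_divide_distrib)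
  have N_z: "N (z e) = (\<Sum>i<n. \<bar>\<Sum>a<m. e a * u0 a i\<bar>)" for e
    unfolding N_def z_u0 by (rule sumI)
  have Nu: "N (u a) \<le> 1" if "a < m" for a
    using u0 that unfolding N_def u_def sumI by simp
  have N_nonneg: "N y \<ge> 0" for y by (simp add: N_def sum_nonneg)
  \<comment> \<open>Bounds for the share of an entry in the norm, uniform over the subspace. For
    split rows it is \<open>1 / R\<close>. Otherwise the coefficient bound 2 gives twice the row sum
    of \<open>u0\<close>, and these shares add up to at most \<open>2 * (d + 1)\<close>.\<close>
  define l where "l i = (if 1 \<le> R * K0 then 1 / R else 2 * (\<Sum>a<m. \<bar>u0 a (fst i)\<bar>))" for i :: "nat \<times> nat"
  define H where "H = {i\<in>I. K0 < l i}"
  have lev: "\<bar>z e i\<bar> \<le> l i * N (z e)" if "i \<in> I" for e i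
  proof (cases "1 \<le> R * K0")
    case True
    have "\<bar>z e i\<bar> = 1 / R * \<bar>\<Sum>a<m. e a * u0 a (fst i)\<bar>" by (simp add: z_u0)
    also have "\<dots> \<le> 1 / R * N (z e)"
      unfolding N_z using that by (intro mult_left_mono member_le_sum) (auto simp: I_def)
    finally show ?thesis using True by (simp add: l_def)
  next
    case False
    then have R: "R = 1" using heavy by simp
    have "\<bar>z e i\<bar> \<le> (\<Sum>a<m. \<bar>e a * u0 a (fst i)\<bar>)" unfolding z_u0 R by simp
    also have "\<dots> \<le> (\<Sum>a<m. 2 * N (z e) * \<bar>u0 a (fst i)\<bar>)"
      unfolding abs_mult N_z using coeff by (intro sum_mono mult_right_mono) auto
    also have "\<dots> = l i * N (z e)" using False by (simp add: l_def sum_distrib_left mult_ac)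
    finally show ?thesis .
  qed
  interpret lower: sketching_lower J n0 N1 x0 x1 I H l K0 s K
    using I s K0 K n0K N1K x0K x1K by unfold_locales (auto simp: H_def)
  let ?g = "\<lambda>y \<psi>. sketched_norm r ?M (y \<circ> fst) \<psi>"
  define B1 where "B1 = {\<psi>. s < collision_loss H l \<psi>}"
  define B2 where "B2 = {\<psi>. collision_loss H l \<psi> \<le> s \<and> (\<exists>e. ?g (z e) \<psi> < L * N (z e))}"
  have PB1: "measure_pmf.prob P B1 \<le> \<delta>H"
  proof (cases "1 \<le> R * K0")
    case True
    then have "1 / R \<le> K0" using nR by (simp add: field_simps)
    then have "H = {}" using True by (auto simp: H_def l_def)
    then have "B1 = {}" using s by (simp add: B1_def collision_loss_def)
    then show ?thesis using \<delta>H by simp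
  next
    case False
    then have R: "R = 1" and h: "(2 * (real d + 1))\<^sup>2 \<le> \<delta>H * (K0 * n0 * s)" using heavy by auto
    have l0: "0 \<le> l i" for i by (simp add: l_def sum_nonneg)
    have "sum l H \<le> sum l I" using I l0 by (intro sum_mono2) (auto simp: H_def)
    also have "sum l I = 2 * (\<Sum>i<n. \<Sum>a<m. \<bar>u0 a i\<bar>)"
      using False unfolding I_def R sum_Times by (simp add: l_def R sum_distrib_left)
    also have "(\<Sum>i<n. \<Sum>a<m. \<bar>u0 a i\<bar>) = (\<Sum>a<m. \<Sum>i<n. \<bar>u0 a i\<bar>)" by (rule sum.swap)
    also have "\<dots> \<le> (\<Sum>a<m. 1)" using u0 by (intro sum_mono) auto
    also have "\<dots> \<le> real d + 1" using m by simp
    finally have "sum l H \<le> 2 * (real d + 1)" by simp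
    then have "(sum l H)\<^sup>2 \<le> (2 * (real d + 1))\<^sup>2" using l0 by (intro power_mono sum_nonneg) auto
    then have "(sum l H)\<^sup>2 / (K0 * n0 * s) \<le> \<delta>H"
      using h K0 n0 s by (simp add: divide_le_eq)
    moreover have "measure_pmf.prob P B1 \<le> (sum l H)\<^sup>2 / (K0 * n0 * s)"
      unfolding P_def B1_def by (rule lower.collision_tail) (simp add: H_def)
    ultimately show ?thesis by linarith
  qed
  have PB2: "measure_pmf.prob P B2 \<le> \<delta>N"
  proof -
    have "measure_pmf.prob P B2 \<le> real ((4 * q + 1) ^ m) * ((1 + 4 * card I) * exp (- (s\<^sup>2 / (4 * K0))))"
      unfolding P_def B2_def L_def r_def z_def[abs_def] N_def[abs_def]
    proof (rule lower.uniform_lower_tail)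
      show "(\<Sum>i\<in>I. \<bar>u a i\<bar>) \<le> 1" if "a < m" for a using Nu[OF that] by (simp add: N_def)
      show "\<bar>e a\<bar> \<le> 2 * (\<Sum>i\<in>I. \<bar>\<Sum>a<m. e a * u a i\<bar>)" if "a < m" for e a
        using coeff that N_z[of e] by (simp add: N_def z_def)
      show "\<bar>\<Sum>a<m. e a * u a i\<bar> \<le> l i * (\<Sum>i\<in>I. \<bar>\<Sum>a<m. e a * u a i\<bar>)" if "i \<in> I" for e i
        using lev[OF that, of e] by (simp add: N_def z_def)
      show "l i \<le> K0" if "i \<in> I - H" for i using that by (auto simp: H_def not_less)
      have "real m * (2 + 2 ^ x1 / J) \<le> (real d + 1) * (2 + 2 ^ x1 / J)"
        using m by (intro mult_right_mono) auto
      then show "real m * (2 + 2 ^ x1 / J) \<le> s * real q" using q by linarith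
    qed
    also have "\<dots> \<le> real ((4 * q + 1) ^ (d + 1)) * ((1 + 4 * card I) * exp (- (s\<^sup>2 / (4 * K0))))"
    proof (rule mult_right_mono)
      have "(4 * q + 1) ^ m \<le> (4 * q + 1) ^ (d + 1)" using m by (intro power_increasing) auto
      then show "real ((4 * q + 1) ^ m) \<le> real ((4 * q + 1) ^ (d + 1))" by (rule of_nat_mono)
    qed simp
    also have "\<dots> \<le> \<delta>N" using \<delta>N I(3) by simp
    finally show ?thesis .
  qed
  define y where "y \<beta> i = (X *\<^sub>v \<beta> - Y) $ fst i / R" for \<beta> and i :: "nat \<times> nat"
  have y_span: "\<exists>e. \<forall>i\<in>I. y \<beta> i = z e i" if \<beta>: "\<beta> \<in> carrier_vec d" for \<beta>
  proof -
    define v where "v = \<beta> @\<^sub>v vec_of_list [-1]"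
    have Av: "(\<Sum>a<d + 1. v $ a * append_col X Y $$ (i, a)) = (X *\<^sub>v \<beta> - Y) $ i" if "i < n" for i
    proof -
      have "dim_vec v = d + 1" using \<beta> by (simp add: v_def)
      then have "(\<Sum>a<d + 1. v $ a * append_col X Y $$ (i, a)) = (append_col X Y *\<^sub>v v) $ i"
        using that X by (simp add: append_col_def scalar_prod_def lessThan_atLeast0 mult.commute)
      then show ?thesis unfolding v_def append_col_mult[OF X Y \<beta>] .
    qed
    obtain e where "\<forall>i\<in>{..<n}. (\<Sum>a<d + 1. v $ a * append_col X Y $$ (i, a)) = (\<Sum>a<m. e a * u0 a i)"
      using span by blast
    then have "\<forall>i\<in>I. y \<beta> i = z e i" using Av by (auto simp: y_def z_u0 I_def)
    then show ?thesis by blast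
  qed
  have N_y: "N (y \<beta>) = l1_loss X Y \<beta>" for \<beta>
    unfolding N_def y_def sumI using Y X by (simp add: l1_loss_def l1_norm_def)
  have g_cong: "?g f \<psi> = ?g f' \<psi>" if "\<And>i. i \<in> I \<Longrightarrow> f i = f' i" for f f' \<psi>
    unfolding sketched_norm_def sketch_def using that by (intro sum.cong arg_cong[of _ _ abs]) auto
  have g_lower: "L * N (y \<beta>) \<le> ?g (y \<beta>) \<psi>" if \<psi>: "\<psi> \<notin> B1" "\<psi> \<notin> B2" and \<beta>: "\<beta> \<in> carrier_vec d" for \<psi> \<beta>
  proof -
    obtain e where e: "\<forall>i\<in>I. y \<beta> i = z e i" using y_span[OF \<beta>] by blast
    have "L * N (z e) \<le> ?g (z e) \<psi>" using \<psi> by (auto simp: B1_def B2_def not_less)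
    moreover have "N (y \<beta>) = N (z e)" using e by (simp add: N_def)
    moreover have "?g (y \<beta>) \<psi> = ?g (z e) \<psi>" using e by (intro g_cong) auto
    ultimately show ?thesis by simp
  qed
  have \<beta>opt: "\<beta>opt \<in> carrier_vec d" using opt X by (simp add: l1_minimizer_def is_arg_min_def)
  define ok where "ok = {\<psi>. ?g (y \<beta>opt) \<psi> * \<nu> \<le> \<alpha> * N (y \<beta>opt)}"
  have good: "weak_weighted_sketch X Y \<beta>opt \<alpha> \<epsilon> (sketch_matrix r n R \<psi> * append_col X Y) (vec r (\<lambda>_. \<nu>))"
    if "\<psi> \<notin> B1" "\<psi> \<notin> B2" "\<psi> \<in> ok" for \<psi>
  proof -
    have loss: "sketched_loss (sketch_matrix r n R \<psi> * append_col X Y) (vec r (\<lambda>_. \<nu>)) \<beta> = \<nu> * ?g (y \<beta>) \<psi>"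
      if "\<beta> \<in> carrier_vec d" for \<beta>
      using sketched_loss_eq[OF X Y that, of \<nu> r R \<psi>] \<nu> by (simp add: I_def y_def[abs_def])
    have "(1 - \<epsilon>) * l1_loss X Y \<beta> \<le> \<nu> * ?g (y \<beta>) \<psi>" if "\<beta> \<in> carrier_vec d" for \<beta>
    proof -
      have "(1 - \<epsilon>) * l1_loss X Y \<beta> = \<nu> * (L * N (y \<beta>))" using \<nu>(2) by (simp add: N_y mult.assoc[symmetric])
      also have "\<dots> \<le> \<nu> * ?g (y \<beta>) \<psi>" using g_lower[OF \<open>\<psi> \<notin> B1\<close> \<open>\<psi> \<notin> B2\<close> that] \<nu> by (intro mult_left_mono) auto
      finally show ?thesis .
    qed
    moreover have "\<nu> * ?g (y \<beta>opt) \<psi> \<le> \<alpha> * l1_loss X Y \<beta>opt"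
      using that(3) by (simp add: ok_def N_y mult.commute)
    ultimately show ?thesis
      using opt X \<beta>opt by (auto simp: weak_weighted_sketch_def loss)
  qed
  define \<delta>' where "\<delta>' = (1 - \<epsilon>) * ((1 + (real w + 2) / J) / L - 1 + \<delta>) / (\<alpha> - 1 + \<epsilon>)"
  have finP: "finite (set_pmf P)" unfolding P_def by (rule lower.finite_P)
  have P_fail: "measure_pmf.prob P (B1 \<union> B2 \<union> - ok) \<le> \<delta> + \<delta>'"
  proof (cases "N (y \<beta>opt) = 0")
    \<comment> \<open>An exact fit cannot be normalized, but its sketch vanishes as well, so the
      upper bound holds with certainty.\<close>
    case True
    then have "y \<beta>opt i = 0" if "i \<in> I" for i using I(1) that by (simp add: N_def sum_nonneg_eq_0_iff)
    then have "?g (y \<beta>opt) \<psi> = 0" for \<psi>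
      using g_cong[of "y \<beta>opt" "\<lambda>_. 0" \<psi>] by (simp add: sketched_norm_def sketch_def cong: if_cong)
    then have "- ok = {}" using True by (auto simp: ok_def)
    moreover have "measure_pmf.prob P (B1 \<union> B2) \<le> \<delta>H + \<delta>N"
      using prob_Un_le[of P B1 B2] PB1 PB2 by linarith
    moreover have "\<delta>' \<ge> 0"
    proof -
      have "6 / real J \<ge> 0" by simp
      then have "L \<le> 1" unfolding L_def using s(1) by linarith
      moreover have "(real w + 2) / J \<ge> 0" by simp
      ultimately have "L \<le> 1 + (real w + 2) / J" by linarith
      then have "1 \<le> (1 + (real w + 2) / J) / L" using L by (simp add: field_simps)
      moreover have "0 \<le> \<delta>N" using PB2 measure_nonneg[of P B2] by linarith
      ultimately have "0 \<le> (1 + (real w + 2) / J) / L - 1 + \<delta>" unfolding \<delta> using \<delta>H A by simp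
      then show ?thesis unfolding \<delta>'_def using \<epsilon> \<alpha> by (intro divide_nonneg_nonneg mult_nonneg_nonneg) auto
    qed
    moreover have "2 / A \<ge> 0" using A by simp
    ultimately show ?thesis unfolding \<delta> by (simp only: Un_empty_right)
  next
    case False
    define c where "c = 1 / N (y \<beta>opt)"
    have c: "c > 0" using False N_nonneg[of "y \<beta>opt"] by (simp add: c_def)
    define y1 where "y1 i = c * y \<beta>opt i" for i
    have Ny1: "(\<Sum>i\<in>I. \<bar>y1 i\<bar>) = 1"
    proof -
      have "(\<Sum>i\<in>I. \<bar>y1 i\<bar>) = c * N (y \<beta>opt)" using c by (simp add: y1_def N_def abs_mult sum_distrib_left)
      then show ?thesis using False by (simp add: c_def)
    qed
    have gy1: "?g y1 \<psi> = c * ?g (y \<beta>opt) \<psi>" for \<psi>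
      using sketched_norm_scale[of r ?M c "y \<beta>opt \<circ> fst" \<psi>] c by (simp add: y1_def[abs_def] o_def)
    define G where "G = no_outlier A I y1"
    \<comment> \<open>On \<open>W\<close> the excess of the sketched norm over the guaranteed bound
      is nonnegative, as Markov's inequality requires.\<close>
    define W where "W = G \<inter> {\<psi>. L \<le> ?g y1 \<psi>}"
    define B4 where "B4 = {\<psi>\<in>W. \<alpha> < \<nu> * ?g y1 \<psi>}"
    have PG: "measure_pmf.prob P (- G) \<le> 2 / A"
      unfolding P_def G_def by (rule prob_outlier[OF I(1) Ny1 A])
    have W: "- W \<subseteq> B1 \<union> B2 \<union> - G"
    proof
      fix \<psi> assume "\<psi> \<in> - W"
      then have "\<psi> \<notin> G \<or> ?g y1 \<psi> < L" by (auto simp: W_def)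
      moreover have "L \<le> ?g y1 \<psi>" if "\<not> (\<psi> \<in> B1 \<or> \<psi> \<in> B2)"
      proof -
        have "c * (L * N (y \<beta>opt)) \<le> c * ?g (y \<beta>opt) \<psi>" using g_lower[of \<psi> \<beta>opt] that \<beta>opt c by (intro mult_left_mono) auto
        then show ?thesis using False unfolding gy1 by (simp add: c_def)
      qed
      ultimately show "\<psi> \<in> B1 \<union> B2 \<union> - G"
        by (cases "\<psi> \<in> B1 \<or> \<psi> \<in> B2") (auto simp: not_less)
    qed
    have P3: "measure_pmf.prob P (B1 \<union> B2 \<union> - G) \<le> \<delta>"
      using prob_Un_le[of P "B1 \<union> B2" "- G"] prob_Un_le[of P B1 B2] PB1 PB2 PG unfolding \<delta> by linarith
    have "measure_pmf.prob P (- W) \<le> \<delta>"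
      using measure_pmf.finite_measure_mono[OF W, of P] P3 by simp
    then have PW: "1 - \<delta> \<le> measure_pmf.prob P W"
      using measure_pmf.prob_compl[of W P] by (simp add: Compl_eq_Diff_UNIV)
    have EG: "measure_pmf.expectation P (\<lambda>\<psi>. indicator G \<psi> * ?g y1 \<psi>) \<le> 1 + (real w + 2) / J"
      unfolding P_def G_def sketched_norm_def r_def by (rule expectation_sketched_norm[OF I(1) Ny1 A low high])
    have "measure_pmf.prob P B4 \<le> measure_pmf.expectation P (\<lambda>\<psi>. indicator W \<psi> * (\<nu> * ?g y1 \<psi> - (1 - \<epsilon>))) / (\<alpha> - 1 + \<epsilon>)"
    proof (intro prob_Markov finP)
      fix \<psi>
      show "0 \<le> indicator W \<psi> * (\<nu> * ?g y1 \<psi> - (1 - \<epsilon>))"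
      proof (cases "\<psi> \<in> W")
        case True
        then have "\<nu> * L \<le> \<nu> * ?g y1 \<psi>" using \<nu>(1) by (intro mult_left_mono) (auto simp: W_def)
        then show ?thesis using True \<nu>(2) by simp
      qed simp
      show "\<alpha> - 1 + \<epsilon> \<le> indicator W \<psi> * (\<nu> * ?g y1 \<psi> - (1 - \<epsilon>))" if "\<psi> \<in> B4"
        using that by (simp add: B4_def)
    qed (use \<alpha> \<epsilon> in auto)
    \<comment> \<open>The norm is integrated over the larger event \<open>G\<close>, for which its
      expectation is known. The subtracted constant stays with \<open>W\<close>, whose probability
      is at least \<open>1 - \<delta>\<close>.\<close>
    also have "measure_pmf.expectation P (\<lambda>\<psi>. indicator W \<psi> * (\<nu> * ?g y1 \<psi> - (1 - \<epsilon>)))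
      \<le> measure_pmf.expectation P (\<lambda>\<psi>. \<nu> * (indicator G \<psi> * ?g y1 \<psi>) + (- (1 - \<epsilon>)) * indicator W \<psi>)"
    proof (intro expectation_mono finP)
      fix \<psi>
      have "indicator W \<psi> * ?g y1 \<psi> \<le> indicator G \<psi> * ?g y1 \<psi>"
        using sketched_norm_nonneg[of r ?M "y1 \<circ> fst" \<psi>] by (auto simp: W_def indicator_def)
      then have "\<nu> * (indicator W \<psi> * ?g y1 \<psi>) \<le> \<nu> * (indicator G \<psi> * ?g y1 \<psi>)"
        using \<nu>(1) by (intro mult_left_mono) auto
      then show "indicator W \<psi> * (\<nu> * ?g y1 \<psi> - (1 - \<epsilon>)) \<le> \<nu> * (indicator G \<psi> * ?g y1 \<psi>) + (- (1 - \<epsilon>)) * indicator W \<psi>"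
        by (simp add: algebra_simps)
    qed
    also have "\<dots> = \<nu> * measure_pmf.expectation P (\<lambda>\<psi>. indicator G \<psi> * ?g y1 \<psi>) - (1 - \<epsilon>) * measure_pmf.prob P W"
      by (subst expectation_linear[OF finP]) (simp add: algebra_simps)
    also have "\<dots> \<le> \<nu> * (1 + (real w + 2) / J) - (1 - \<epsilon>) * (1 - \<delta>)"
      using EG PW \<nu>(1) \<epsilon> by (intro diff_mono mult_left_mono) auto
    also have "\<dots> = (1 - \<epsilon>) * ((1 + (real w + 2) / J) / L - 1 + \<delta>)"
    proof -
      have "(1 - \<epsilon>) / L * U - (1 - \<epsilon>) * (1 - \<delta>) = (1 - \<epsilon>) * (U / L - 1 + \<delta>)" for U
        by (simp add: algebra_simps)
      then show ?thesis unfolding \<nu>_def .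
    qed
    finally have PB4: "measure_pmf.prob P B4 \<le> \<delta>'"
      unfolding \<delta>'_def using \<alpha> \<epsilon> by (simp add: divide_right_mono)
    have "B1 \<union> B2 \<union> - ok \<subseteq> (B1 \<union> B2 \<union> - G) \<union> B4"
    proof
      fix \<psi> assume \<psi>: "\<psi> \<in> B1 \<union> B2 \<union> - ok"
      show "\<psi> \<in> (B1 \<union> B2 \<union> - G) \<union> B4"
      proof (cases "\<psi> \<in> W")
        case True
        show ?thesis
        proof (cases "\<psi> \<in> ok")
          case True
          then show ?thesis using \<psi> by auto
        next
          case False
          then have "c * (\<alpha> * N (y \<beta>opt)) < c * (?g (y \<beta>opt) \<psi> * \<nu>)" using c by (simp add: ok_def)
          then have "\<alpha> < \<nu> * ?g y1 \<psi>" using \<open>N (y \<beta>opt) \<noteq> 0\<close> unfolding gy1 by (simp add: c_def mult_ac)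
          then show ?thesis using \<open>\<psi> \<in> W\<close> by (simp add: B4_def)
        qed
      next
        case False
        then show ?thesis using W by blast
      qed
    qed
    then have "measure_pmf.prob P (B1 \<union> B2 \<union> - ok) \<le> measure_pmf.prob P ((B1 \<union> B2 \<union> - G) \<union> B4)"
      by (intro measure_pmf.finite_measure_mono) auto
    also have "\<dots> \<le> \<delta> + \<delta>'" using prob_Un_le[of P "B1 \<union> B2 \<union> - G" B4] P3 PB4 by linarith
    finally show ?thesis .
  qed
  have "1 - (\<delta> + \<delta>') \<le> 1 - measure_pmf.prob P (B1 \<union> B2 \<union> - ok)" using P_fail by simp
  also have "\<dots> = measure_pmf.prob P (- (B1 \<union> B2 \<union> - ok))"
    using measure_pmf.prob_compl[of "B1 \<union> B2 \<union> - ok" P] by (simp add: Compl_eq_Diff_UNIV)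
  also have "\<dots> \<le> measure_pmf.prob P ((\<lambda>\<psi>. (sketch_matrix r n R \<psi>, vec r (\<lambda>_. \<nu>))) -`
      {(S, w). weak_weighted_sketch X Y \<beta>opt \<alpha> \<epsilon> (S * append_col X Y) w})"
    using good by (intro measure_pmf.finite_measure_mono) auto
  also have "\<dots> = measure_pmf.prob (sketch_pmf n R \<nu>) {(S, w). weak_weighted_sketch X Y \<beta>opt \<alpha> \<epsilon> (S * append_col X Y) w}"
    by (simp add: sketch_pmf_def P_def I_def r_def)
  finally show ?thesis by (simp add: \<nu>_def \<delta>'_def)
qed

end

section \<open>Sketches with factor close to one\<close>

lemma l1_loss_nonneg: "0 \<le> l1_loss X Y \<beta>"
  by (simp add: l1_loss_def l1_norm_def sum_nonneg)

text \<open>For \<open>\<epsilon> \<ge> 1\<close> the lower bound only asks for a nonnegative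
  sketched loss.\<close>

lemma empty_sketch:
  fixes n :: nat and \<alpha> \<epsilon> :: real
  defines "D \<equiv> return_pmf (column_matrix 0 n 0 (\<lambda>_ _. 0) (\<lambda>_ _. 0), vec 0 (\<lambda>_. 1) :: real vec)"
  assumes "\<epsilon> \<ge> 1" "\<alpha> \<ge> 0"
  shows "l1_minimizer X Y \<beta>opt \<Longrightarrow>
    measure_pmf.prob D {(S, w). weak_weighted_sketch X Y \<beta>opt \<alpha> \<epsilon> (S * append_col X Y) w} = 1"
proof -
  assume opt: "l1_minimizer X Y \<beta>opt"
  have "sketched_loss (column_matrix 0 n 0 (\<lambda>_ _. 0) (\<lambda>_ _. 0) * append_col X Y) w \<beta> = 0" for w \<beta>
    by (simp add: sketched_loss_def column_matrix_def)
  moreover have "(1 - \<epsilon>) * l1_loss X Y \<beta> \<le> 0" for \<beta>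
    using assms(2) l1_loss_nonneg[of X Y \<beta>] by (simp add: mult_nonpos_nonneg)
  ultimately have "weak_weighted_sketch X Y \<beta>opt \<alpha> \<epsilon> (column_matrix 0 n 0 (\<lambda>_ _. 0) (\<lambda>_ _. 0) * append_col X Y) w" for w
    using opt assms(3) l1_loss_nonneg[of X Y \<beta>opt] by (simp add: weak_weighted_sketch_def)
  then show ?thesis by (simp add: D_def)
qed

text \<open>For the case that the admissible size is at least \<open>n\<close>.\<close>

lemma identity_sketch:
  fixes n :: nat and \<alpha> \<epsilon> :: real
  defines "D \<equiv> return_pmf (column_matrix n n 1 (\<lambda>i _. i) (\<lambda>_ _. 1), vec n (\<lambda>_. 1) :: real vec)"
  assumes "\<epsilon> \<ge> 0" "\<alpha> \<ge> 1" and X: "X \<in> carrier_mat n d" and Y: "Y \<in> carrier_vec n"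
    and opt: "l1_minimizer X Y \<beta>opt"
  shows "measure_pmf.prob D {(S, w). weak_weighted_sketch X Y \<beta>opt \<alpha> \<epsilon> (S * append_col X Y) w} = 1"
proof -
  let ?A = "append_col X Y"
  have A: "?A \<in> carrier_mat n (Suc d)" using X by (auto simp: append_col_def)
  have "column_matrix n n 1 (\<lambda>i _. i) (\<lambda>_ _. 1) = 1\<^sub>m n"
    by (auto simp: column_matrix_def)
  then have SA: "column_matrix n n 1 (\<lambda>i _. i) (\<lambda>_ _. 1) * ?A = ?A" using A by simp
  have loss: "sketched_loss ?A (vec n (\<lambda>_. 1)) \<beta> = l1_loss X Y \<beta>" if \<beta>: "\<beta> \<in> carrier_vec d" for \<beta>
  proof -
    have "sketched_loss ?A (vec n (\<lambda>_. 1)) \<beta> = (\<Sum>j<n. \<bar>(?A *\<^sub>v (\<beta> @\<^sub>v vec_of_list [-1])) $ j\<bar>)"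
      using A by (simp add: sketched_loss_def carrier_matD)
    also have "\<dots> = l1_loss X Y \<beta>"
      unfolding append_col_mult[OF X Y \<beta>] using X Y by (simp add: l1_loss_def l1_norm_def)
    finally show ?thesis .
  qed
  have scale: "c * l1_loss X Y \<beta> \<le> l1_loss X Y \<beta>" if "c \<le> 1" for c \<beta>
    using mult_right_mono[OF that l1_loss_nonneg[of X Y \<beta>]] by simp
  have "l1_loss X Y \<beta>opt \<le> \<alpha> * l1_loss X Y \<beta>opt"
    using mult_right_mono[OF assms(3) l1_loss_nonneg[of X Y \<beta>opt]] by simp
  moreover have "\<beta>opt \<in> carrier_vec d" using opt X by (simp add: l1_minimizer_def is_arg_min_def)
  ultimately have "weak_weighted_sketch X Y \<beta>opt \<alpha> \<epsilon> (column_matrix n n 1 (\<lambda>i _. i) (\<lambda>_ _. 1) * ?A) (vec n (\<lambda>_. 1))"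
    unfolding SA weak_weighted_sketch_def using opt X assms(2) by (auto simp: loss intro!: scale)
  then show ?thesis by (simp add: D_def)
qed

lemma dyadic_bracket:
  fixes y :: real
  assumes "y \<ge> 1"
  obtains x :: nat where "2 ^ x \<le> y" "y < 2 ^ Suc x"
proof -
  define k where "k = (LEAST k. y < 2 ^ k)"
  obtain k0 where "y < 2 ^ k0" using real_arch_pow[of 2 y] by auto
  then have k: "y < 2 ^ k" unfolding k_def by (rule LeastI)
  have "k \<noteq> 0" using k assms by (cases k) auto
  then obtain x where x: "k = Suc x" by (cases k) auto
  have "\<not> y < 2 ^ x" using not_less_Least[of x "\<lambda>k. y < 2 ^ k"] x by (simp add: k_def)
  then show thesis using that[of x] k x by simp
qed

text \<open>The factor \<open>3 / 2\<close> comes from \<open>ln 2 \<ge> 2 / 3\<close>.\<close>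

lemma exponent_le_ln:
  assumes "2 ^ J \<le> (y :: real)"
  shows "real J \<le> 3 / 2 * ln y"
proof -
  have y: "y > 0" using assms zero_less_power[of "2::real" J] by linarith
  have "real J * ln 2 = ln (2 ^ J)" by (simp add: ln_realpow)
  also have "\<dots> \<le> ln y" using assms y by simp
  finally have "real J * ln 2 \<le> ln y" .
  moreover have "real J * (2 / 3) \<le> real J * ln 2" using ln2_ge_two_thirds by (intro mult_left_mono) auto
  ultimately show ?thesis by simp
qed

text \<open>With \<open>L = ln n\<close>, the right-hand side is
  \<open>32 * L ^ 3 * (64 * L ^ 5) ^ 2\<close>, a lower bound of the admissible size. So
  \<open>n < exp 60\<close> is covered by the identity matrix.\<close>

lemma exp_le_poly:
  fixes L :: real
  assumes "2 / 3 \<le> L" "L < 60"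
  shows "exp L \<le> 131072 * L ^ 13"
proof -
  have e: "exp (real k) \<le> (272 / 100) ^ k" for k
  proof -
    have "exp (real k) = exp 1 ^ k" by (simp flip: exp_of_nat_mult)
    also have "\<dots> \<le> (272 / 100) ^ k" using e_less_272 by (intro power_mono) auto
    finally show ?thesis .
  qed
  \<comment> \<open>On an interval, the exponential is compared at the right end with the polynomial
    at the left end.\<close>
  have piece: "exp L \<le> 131072 * L ^ 13" if "lo \<le> L" "L \<le> real k" "(272 / 100) ^ k \<le> 131072 * lo ^ 13" "0 \<le> lo" for lo k
  proof -
    have "exp L \<le> exp (real k)" using that by simp
    also note e
    also note that(3)
    also have "131072 * lo ^ 13 \<le> 131072 * L ^ 13" using that by (intro mult_left_mono power_mono) auto
    finally show ?thesis .
  qed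
  consider "L \<le> 1" | "1 \<le> L" "L \<le> 11" | "11 \<le> L" "L \<le> 42" | "42 \<le> L" by linarith
  then show ?thesis
  proof cases
    case 1
    then show ?thesis using assms by (intro piece[of "2/3" 1]) (auto simp: power_divide)
  next
    case 2
    then show ?thesis by (intro piece[of 1 11]) (auto simp: power_divide)
  next
    case 3
    then show ?thesis by (intro piece[of 11 42]) (auto simp: power_divide)
  next
    case 4
    then show ?thesis using assms by (intro piece[of 42 60]) (auto simp: power_divide)
  qed
qed

lemma precise_size_bound:
  fixes d L \<epsilon> \<delta> :: real
  assumes d: "d \<ge> 1" and \<epsilon>: "0 < \<epsilon>" "\<epsilon> < 1" and \<delta>: "0 < \<delta>" "\<delta> < 1" and L: "L \<ge> 60"
  shows "3 / 4 * d ^ 2 * L * (264241152 * (d * L ^ 3 / (\<epsilon> * \<delta>))) powr (1 / \<epsilon>)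
    \<le> 32 * d * L ^ 3 / \<epsilon> ^ 5 * (64 * d * L ^ 5 / (\<epsilon> ^ 6 * \<delta>)) powr (1 + 1 / \<epsilon>)"
proof -
  define B where "B = 64 * d * L ^ 5 / (\<epsilon> ^ 6 * \<delta>)"
  \<comment> \<open>\<open>x\<close> is the quotient of the two bases, as
    \<open>264241152 = 4128768 * 64\<close>. For small \<open>\<epsilon>\<close> it is at most 1, so
    the large exponent does no harm; otherwise \<open>1 / \<epsilon> \<le> 5\<close> and a constant
    power is absorbed by powers of \<open>L \<ge> 60\<close>.\<close>
  define x where "x = 4128768 * \<epsilon> ^ 5 / L ^ 2"
  have B: "B > 0" using assms by (simp add: B_def)
  have x: "x > 0" using assms by (simp add: x_def)
  have "264241152 * (d * L ^ 3 / (\<epsilon> * \<delta>)) = x * B"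
  proof -
    have "x * B = (4128768 * 64) * d * (\<epsilon> ^ 5 / \<epsilon> ^ 6) * (L ^ 5 / L ^ 2) / \<delta>" by (simp add: x_def B_def mult_ac)
    also have "L ^ 5 / L ^ 2 = L ^ 3" using L by (simp add: field_simps flip: power_add)
    also have "\<epsilon> ^ 5 / \<epsilon> ^ 6 = 1 / \<epsilon>" using \<epsilon> by (simp add: field_simps flip: power_Suc)
    finally show ?thesis by simp
  qed
  then have "(264241152 * (d * L ^ 3 / (\<epsilon> * \<delta>))) powr (1 / \<epsilon>) = x powr (1 / \<epsilon>) * B powr (1 / \<epsilon>)"
    using x B by (simp add: powr_mult)
  moreover have "3 / 4 * d ^ 2 * L * x powr (1 / \<epsilon>) \<le> 32 * d * L ^ 3 / \<epsilon> ^ 5 * B"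
  proof -
    have x1: "x \<le> 1147 * \<epsilon> ^ 5"
    proof -
      have "(60::real) ^ 2 \<le> L ^ 2" using L by (intro power_mono) auto
      then have "4128768 * \<epsilon> ^ 5 \<le> 1147 * \<epsilon> ^ 5 * L ^ 2" using \<epsilon> by (simp add: field_simps)
      then show ?thesis using L by (simp add: x_def divide_le_eq)
    qed
    have xp: "x powr (1 / \<epsilon>) \<le> 1147 ^ 5"
    proof (cases "\<epsilon> \<le> 24 / 100")
      case True
      then have "\<epsilon> ^ 5 \<le> (24 / 100) ^ 5" using \<epsilon> by (intro power_mono) auto
      then have "x \<le> 1" using x1 by (simp add: power_divide)
      then have "x powr (1 / \<epsilon>) \<le> 1 powr (1 / \<epsilon>)" using x \<epsilon> by (intro powr_mono2) auto
      then show ?thesis by simp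
    next
      case False
      have "\<epsilon> ^ 5 \<le> 1" using \<epsilon> by (intro power_le_one) auto
      then have "x \<le> 1147" using x1 by simp
      then have "x powr (1 / \<epsilon>) \<le> 1147 powr (1 / \<epsilon>)" using x \<epsilon> by (intro powr_mono2) auto
      also have "\<dots> \<le> 1147 powr 5" using False \<epsilon> by (intro powr_mono) (auto simp: field_simps)
      finally show ?thesis by simp
    qed
    have e11: "\<epsilon> ^ 11 * \<delta> \<le> 1" using \<epsilon> \<delta> by (intro mult_le_one power_le_one) auto
    have "3 / 4 * d ^ 2 * L * x powr (1 / \<epsilon>) \<le> 3 / 4 * d ^ 2 * L * 1147 ^ 5"
      using xp d L by (intro mult_left_mono) auto
    also have "\<dots> \<le> 2048 * d ^ 2 * L * L ^ 7"
    proof -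
      have "(60::real) ^ 7 \<le> L ^ 7" using L by (intro power_mono) auto
      then have "3 / 4 * 1147 ^ 5 \<le> 2048 * L ^ 7" by simp
      then have "d ^ 2 * L * (3 / 4 * 1147 ^ 5) \<le> d ^ 2 * L * (2048 * L ^ 7)" using d L by (intro mult_left_mono) auto
      then show ?thesis by (simp add: mult_ac)
    qed
    also have "\<dots> = 2048 * d ^ 2 * L ^ 8" by (simp add: power_Suc[symmetric] del: power_Suc)
    also have "\<dots> \<le> 2048 * d ^ 2 * L ^ 8 / (\<epsilon> ^ 11 * \<delta>)"
      using e11 \<epsilon> \<delta> d L by (simp add: le_divide_eq mult_left_le)
    also have "\<dots> = 32 * d * L ^ 3 / \<epsilon> ^ 5 * B"
      by (simp add: B_def power2_eq_square mult_ac flip: power_add)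
    finally show ?thesis .
  qed
  then have "3 / 4 * d ^ 2 * L * x powr (1 / \<epsilon>) * B powr (1 / \<epsilon>) \<le> 32 * d * L ^ 3 / \<epsilon> ^ 5 * B * B powr (1 / \<epsilon>)"
    by (intro mult_right_mono) auto
  moreover have "B powr (1 + 1 / \<epsilon>) = B * B powr (1 / \<epsilon>)" using B by (simp add: powr_add)
  ultimately show ?thesis unfolding B_def[symmetric] by (simp only: mult.assoc)
qed

lemma real_nat_ceiling_le: "0 \<le> y \<Longrightarrow> real (nat \<lceil>y\<rceil>) \<le> y + 1"
  by linarith

lemma precise_sketch:
  fixes n d :: nat and \<epsilon> \<delta> a :: real
  defines "b \<equiv> 32 * real d * ln (real n) ^ 3 / \<epsilon> ^ 5 * (64 * real d * ln (real n) ^ 5 / (\<epsilon> ^ 6 * \<delta>)) powr (1 + 1 / \<epsilon>)"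
  assumes n: "n \<ge> 2" and d: "d \<ge> 1" and \<epsilon>: "0 < \<epsilon>" "\<epsilon> < 1" and \<delta>: "0 < \<delta>" "\<delta> < 1" and a: "a > 1"
    and large: "b < n"
  shows "\<exists>r D. real r \<le> b \<and> sketch_distribution r n D \<and>
    (\<forall>(S, w)\<in>set_pmf D. stream_computes sketch_update S m 23) \<and>
    (\<forall>X\<in>carrier_mat n d. \<forall>Y\<in>carrier_vec n. \<forall>\<beta>opt. l1_minimizer X Y \<beta>opt \<longrightarrow>
      measure_pmf.prob D {(S, w). weak_weighted_sketch X Y \<beta>opt (1 + a * \<epsilon>) \<epsilon> (S * append_col X Y) w}
        \<ge> 1 - (\<delta> + 1 / a))"
proof -
  define L where "L = ln (real n)"
  have expL: "exp L = n" using n by (simp add: L_def)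
  have d1: "real d \<ge> 1" using d by simp
  have L23: "2 / 3 \<le> L"
  proof -
    have "ln 2 \<le> L" unfolding L_def using n by simp
    then show ?thesis using ln2_ge_two_thirds by linarith
  qed
  have \<epsilon>p: "\<epsilon> ^ k \<le> 1" for k using \<epsilon> by (intro power_le_one) auto
  define B where "B = 64 * real d * L ^ 5 / (\<epsilon> ^ 6 * \<delta>)"
  have L0: "L > 0" using L23 by simp
  have B64: "64 * L ^ 5 \<le> B"
  proof -
    have "\<epsilon> ^ 6 * \<delta> \<le> 1" using \<epsilon>p \<epsilon> \<delta> by (intro mult_le_one) auto
    then have "64 * L ^ 5 * (\<epsilon> ^ 6 * \<delta>) \<le> 64 * L ^ 5 * real d"
      using d1 L0 by (intro mult_left_mono) auto
    then show ?thesis using \<epsilon> \<delta> by (simp add: B_def le_divide_eq mult_ac)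
  qed
  have B1: "1 \<le> B"
  proof -
    have "(2 / 3) ^ 5 \<le> L ^ 5" using L23 by (intro power_mono) auto
    then show ?thesis using B64 by (simp add: power_divide)
  qed
  \<comment> \<open>For smaller \<open>n\<close> the size bound would exceed \<open>n\<close>,
    contrary to \<open>large\<close>. Hence constants can be absorbed by powers of
    \<open>L\<close>.\<close>
  have L60: "L \<ge> 60"
  proof (rule ccontr)
    assume "\<not> L \<ge> 60"
    then have "real n \<le> 131072 * L ^ 13" using exp_le_poly[of L] L23 expL by simp
    also have "\<dots> = 32 * L ^ 3 * (64 * L ^ 5)\<^sup>2" by (simp add: power_mult_distrib flip: power_mult power_add)
    also have "\<dots> \<le> 32 * real d * L ^ 3 / \<epsilon> ^ 5 * B powr (1 + 1 / \<epsilon>)"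
    proof (rule mult_mono)
      have "32 * L ^ 3 * \<epsilon> ^ 5 \<le> 32 * L ^ 3 * real d"
        using \<epsilon>p[of 5] d1 L0 by (intro mult_left_mono) auto
      then show "32 * L ^ 3 \<le> 32 * real d * L ^ 3 / \<epsilon> ^ 5" using \<epsilon> by (simp add: le_divide_eq mult_ac)
      have "(64 * L ^ 5)\<^sup>2 \<le> B\<^sup>2" using B64 L0 by (intro power_mono) auto
      also have "\<dots> = B powr 2" using B1 by simp
      also have "\<dots> \<le> B powr (1 + 1 / \<epsilon>)" using B1 \<epsilon> by (intro powr_mono) auto
      finally show "(64 * L ^ 5)\<^sup>2 \<le> B powr (1 + 1 / \<epsilon>)" .
    qed (use L0 \<epsilon> in auto)
    finally show False using large by (simp add: b_def B_def L_def)
  qed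
  define D0 where "D0 = real d * L ^ 3 / (\<epsilon> * \<delta>)"
  have D0: "D0 \<ge> 1"
  proof -
    have "\<epsilon> * \<delta> \<le> 1" using \<epsilon> \<delta> by (intro mult_le_one) auto
    moreover have "1 \<le> real d * L ^ 3" using d1 L60 one_le_power[of L 3] mult_mono[of 1 "real d" 1 "L ^ 3"] by simp
    ultimately have "\<epsilon> * \<delta> \<le> real d * L ^ 3" by linarith
    then show ?thesis using \<epsilon> \<delta> by (simp add: D0_def)
  qed
  define P where "P = (264241152 * D0) powr (1 / \<epsilon>)"
  define G where "G = real d ^ 2 * L"
  have Pb: "3 / 4 * G * P \<le> b"
    using precise_size_bound[of "real d" \<epsilon> \<delta> L] d1 \<epsilon> \<delta> L60 by (simp add: P_def b_def D0_def L_def G_def mult.assoc)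
  have PD: "264241152 * D0 \<le> P"
  proof -
    have "264241152 * D0 = (264241152 * D0) powr 1" using D0 by simp
    also have "\<dots> \<le> P" unfolding P_def using D0 \<epsilon> by (intro powr_mono) auto
    finally show ?thesis .
  qed
  have P_n: "3 / 4 * G * P < n" using Pb large by simp
  have G60: "60 \<le> G"
  proof -
    have "1 * 60 \<le> (real d)\<^sup>2 * L" using L60 d1 by (intro mult_mono) auto
    then show ?thesis by (simp add: G_def)
  qed
  have Pn: "P < n"
  proof -
    have "1 * P \<le> 3 / 4 * G * P" using G60 PD D0 by (intro mult_right_mono) auto
    then show ?thesis using P_n by simp
  qed
  \<comment> \<open>\<open>8064 = 16 * 8 * 28 * 9 / 4\<close> stems from
    \<open>16 * J * A / K\<close> with the values below and \<open>J \<le> 3 / 2 * L\<close>;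
    \<open>2 ^ w\<close> has to exceed this for the conditions of \<open>kept_le\<close>.\<close>
  obtain w' where w': "2 ^ w' \<le> 8064 * D0" "8064 * D0 < 2 ^ Suc w'"
    using dyadic_bracket[of "8064 * D0"] D0 by auto
  define w where "w = Suc w'"
  have w: "8064 * D0 < 2 ^ w" "2 ^ w \<le> 16128 * D0" using w' by (auto simp: w_def)
  \<comment> \<open>12 is the loss \<open>6 / J + 6 * s\<close> with \<open>s = 1 / J\<close>,
    multiplied by \<open>J\<close>, and \<open>14 = 12 + 2\<close> includes the noise. The choice
    makes \<open>(1 - \<epsilon>) * (w + 14) / (J - 12)\<close>, the main part of the mean excess,
    at most \<open>\<epsilon>\<close>.\<close>
  define J where "J = 12 + nat \<lceil>(real w + 14) * (1 / \<epsilon> - 1)\<rceil>"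
  have gap: "(real w + 14) * (1 / \<epsilon> - 1) > 0" using \<epsilon> by simp
  have Jb: "(real w + 14) * (1 / \<epsilon> - 1) \<le> real J - 12" "real J \<le> 13 + (real w + 14) * (1 / \<epsilon> - 1)" "J \<ge> 13"
  proof -
    show "(real w + 14) * (1 / \<epsilon> - 1) \<le> real J - 12" using gap by (simp add: J_def)
    show "real J \<le> 13 + (real w + 14) * (1 / \<epsilon> - 1)" using gap by (simp add: J_def) linarith
    have "\<lceil>(real w + 14) * (1 / \<epsilon> - 1)\<rceil> \<ge> 1" using gap by (simp add: one_le_ceiling)
    then show "J \<ge> 13" unfolding J_def by linarith
  qed
  \<comment> \<open>\<open>264241152 = 16128 * 2 ^ 14\<close> bounds \<open>2 ^ (w + 14)\<close> in
    terms of \<open>D0\<close>. So \<open>2 ^ J\<close> is of order \<open>D0\<close> to the power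
    \<open>1 / \<epsilon> - 1\<close>, and the factor \<open>D0\<close> from \<open>n0\<close>
    completes the exponent.\<close>
  have powJ: "2 ^ J * D0 * 264241152 \<le> 8192 * P"
  proof -
    have "(2::real) ^ J = 2 powr real J" by (simp add: powr_realpow)
    also have "\<dots> \<le> 2 powr (13 + (real w + 14) * (1 / \<epsilon> - 1))" using Jb(2) by simp
    also have "\<dots> = 8192 * (2 ^ (w + 14)) powr (1 / \<epsilon> - 1)"
      by (simp add: powr_add powr_powr[symmetric] powr_realpow[symmetric] del: powr_powr)
    also have "\<dots> \<le> 8192 * (264241152 * D0) powr (1 / \<epsilon> - 1)"
      using w(2) \<epsilon> by (intro mult_left_mono powr_mono2) (auto simp: power_add)
    finally have "2 ^ J * (264241152 * D0) \<le> 8192 * (264241152 * D0) powr (1 / \<epsilon> - 1) * (264241152 * D0)"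
      using D0 by (intro mult_right_mono) auto
    also have "\<dots> = 8192 * ((264241152 * D0) powr (1 / \<epsilon> - 1) * (264241152 * D0) powr 1)" using D0 by simp
    also have "\<dots> = 8192 * P" unfolding P_def powr_add[symmetric] by simp
    finally show ?thesis by (simp add: mult_ac)
  qed
  have J_L: "real J \<le> 3 / 2 * L"
  proof -
    have "2 ^ J * 1 \<le> 2 ^ J * D0" using D0 by (intro mult_left_mono) auto
    then have "2 ^ J \<le> real n" using powJ Pn PD D0 by linarith
    then show ?thesis unfolding L_def by (rule exponent_le_ln)
  qed
  have J13: "real J \<ge> 13" using Jb(3) by linarith
  define s where "s = 1 / real J"
  \<comment> \<open>With 28, the exponent \<open>s^2 / (4 * K0)\<close> is \<open>7 * d * L\<close>.
    A point of the net fails with probability about \<open>1 / n ^ (7 * d)\<close>, against at most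
    \<open>n ^ (2 * (d + 1))\<close> points.\<close>
  define K0 where "K0 = 1 / (28 * real J ^ 2 * d * L)"
  define K where "K = K0 / s"
  have K_eq: "K = 1 / (28 * real J * d * L)" using J13 by (simp add: K_def K0_def s_def power2_eq_square)
  have pos: "s > 0" "K0 > 0" "K > 0" using J13 d1 L0 by (auto simp: s_def K0_def K_eq)
  \<comment> \<open>\<open>3584 = 8 * 16 * 28\<close> makes the heavy entries collide with
    probability at most \<open>\<epsilon> * \<delta> / 8\<close>. In \<open>N1\<close>,
    \<open>6 * L\<close> is 4 times the bound \<open>3 / 2 * L\<close> for the number of
    levels.\<close>
  define n0 where "n0 = nat \<lceil>3584 * real d ^ 3 * J ^ 3 * L / (\<epsilon> * \<delta>)\<rceil>"
  define N1 where "N1 = nat \<lceil>6 * L * 2 ^ J / K\<rceil>"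
  have \<epsilon>\<delta>: "0 < \<epsilon> * \<delta>" "\<epsilon> * \<delta> \<le> 1" using \<epsilon> \<delta> by (auto intro!: mult_le_one)
  have n0_ge: "3584 * real d ^ 3 * J ^ 3 * L / (\<epsilon> * \<delta>) \<le> n0" unfolding n0_def by (rule real_nat_ceiling_ge)
  have n0_le: "n0 \<le> 12097 * (G * D0)"
  proof -
    have "real n0 \<le> 3584 * real d ^ 3 * J ^ 3 * L / (\<epsilon> * \<delta>) + 1"
      unfolding n0_def using d1 L0 \<epsilon>\<delta> by (intro real_nat_ceiling_le divide_nonneg_pos mult_nonneg_nonneg) auto
    also have "3584 * real d ^ 3 * J ^ 3 * L / (\<epsilon> * \<delta>) \<le> 3584 * real d ^ 3 * (3 / 2 * L) ^ 3 * L / (\<epsilon> * \<delta>)"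
      using J_L d1 L0 \<epsilon>\<delta> by (intro divide_right_mono mult_right_mono mult_left_mono power_mono) auto
    also have "\<dots> = 12096 * (G * D0)" by (simp add: G_def D0_def power_mult_distrib power_divide power2_eq_square power3_eq_cube)
    also have "12096 * (G * D0) + 1 \<le> 12097 * (G * D0)"
    proof -
      have "1 * 1 \<le> G * D0" using G60 D0 by (intro mult_mono) auto
      then show ?thesis by linarith
    qed
    finally show ?thesis by simp
  qed
  have N1_ge: "6 * L * 2 ^ J / K \<le> N1" unfolding N1_def by (rule real_nat_ceiling_ge)
  have J2: "(1::real) \<le> 2 ^ J" by simp
  have JdL: "1 \<le> real J * d * L"
  proof -
    have "1 * 1 * 1 \<le> real J * d * L" using J13 d1 L60 by (intro mult_mono) auto
    then show ?thesis by simp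
  qed
  have N1_le: "N1 \<le> 7 * L * 2 ^ J / K"
  proof -
    have "real N1 \<le> 6 * L * 2 ^ J / K + 1"
      unfolding N1_def using L0 pos by (intro real_nat_ceiling_le divide_nonneg_pos mult_nonneg_nonneg) auto
    moreover have "1 \<le> L * 2 ^ J / K"
    proof -
      have "1 * 1 * 1 \<le> L * 2 ^ J * (28 * (real J * d * L))" using L60 J2 JdL by (intro mult_mono) auto
      then show ?thesis by (simp add: K_eq mult_ac)
    qed
    moreover have "6 * L * 2 ^ J / K = 6 * (L * 2 ^ J / K)" "7 * L * 2 ^ J / K = 7 * (L * 2 ^ J / K)" by simp_all
    ultimately show ?thesis by linarith
  qed
  have n0K: "128 * (real d ^ 2 * real J ^ 2) \<le> n0 * K"
  proof -
    have "128 * (real d ^ 2 * real J ^ 2) \<le> 128 * (real d ^ 2 * real J ^ 2) / (\<epsilon> * \<delta>)"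
      using \<epsilon>\<delta> by (simp add: le_divide_eq mult_left_le)
    also have "\<dots> = 3584 * real d ^ 3 * J ^ 3 * L / (\<epsilon> * \<delta>) * K"
      using J13 d1 L0 by (simp add: K_eq power2_eq_square power3_eq_cube mult_ac)
    also have "\<dots> \<le> n0 * K" using n0_ge pos by (intro mult_right_mono) auto
    finally show ?thesis by simp
  qed
  have n0K8: "8 \<le> n0 * K"
  proof -
    have "1 * 1 \<le> real d ^ 2 * real J ^ 2" using d1 J13 by (intro mult_mono) auto
    then show ?thesis using n0K by simp
  qed
  obtain x0 where x0b: "2 ^ x0 \<le> K * J * n0 / 4" "K * J * n0 / 4 < 2 ^ Suc x0"
  proof -
    have "8 * 13 \<le> (n0 * K) * J" using n0K8 J13 by (intro mult_mono) auto
    then have "1 \<le> K * J * n0 / 4" by (simp add: mult_ac)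
    then show thesis using dyadic_bracket that by blast
  qed
  have x0_1: "x0 \<ge> 1"
  proof (rule ccontr)
    assume "\<not> 1 \<le> x0"
    then have "x0 = 0" by simp
    then have "K * J * n0 / 4 < 2" using x0b(2) by simp
    moreover have "8 * 13 \<le> (n0 * K) * J" using n0K8 J13 by (intro mult_mono) auto
    ultimately show False by (simp add: mult_ac)
  qed
  obtain x1 where x1: "2 ^ x1 \<le> real n" "real n < 2 ^ Suc x1" using dyadic_bracket[of "real n"] n by auto
  have x1_L: "real x1 \<le> 3 / 2 * L" unfolding L_def using x1(1) by (rule exponent_le_ln)
  interpret sketching_scheme J n0 N1 x0 x1
  proof
    show "0 < J" using Jb(3) by simp
    show "0 < n0" using n0K8 by (cases n0) auto
    have "0 < 6 * L * 2 ^ J / K" using L0 pos by simp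
    then show "0 < N1" using N1_ge by (cases N1) auto
  qed (rule x0_1)
  \<comment> \<open>Outliers get probability \<open>\<epsilon> * \<delta> / 4\<close>, the heavy
    collisions and the net half of this each.\<close>
  define A where "A = 8 / (\<epsilon> * \<delta>)"
  define q where "q = (d + 1) * (2 * J + 2 ^ x1)"
  define Lo where "Lo = 1 - 6 / real J - 6 * s"
  have Lo: "Lo = (real J - 12) / J" using J13 by (simp add: Lo_def s_def field_simps)
  have Lo0: "Lo > 0" using J13 unfolding Lo by simp
  have size: "real (N0 + N1) \<le> b"
  proof -
    have "real N0 \<le> real n0 * 2 ^ J" by (simp add: N0_def mult_left_mono of_nat_diff)
    also have "\<dots> \<le> 12097 * (G * D0) * 2 ^ J" using n0_le by (intro mult_right_mono) auto
    finally have 1: "real N0 \<le> 12097 * (G * D0 * 2 ^ J)" by simp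
    have "real N1 \<le> 7 * L * 2 ^ J * (28 * real d * L) * J" using N1_le by (simp add: K_eq mult_ac)
    also have "\<dots> \<le> 7 * L * 2 ^ J * (28 * real d * L) * (3 / 2 * L)"
      using J_L L0 by (intro mult_left_mono) auto
    also have "\<dots> = 294 * (real d * L ^ 3 * 2 ^ J)" by (simp add: power3_eq_cube)
    also have "real d * L ^ 3 * 2 ^ J \<le> G * D0 * 2 ^ J"
    proof (intro mult_right_mono)
      have "real d * L ^ 3 = (\<epsilon> * \<delta>) * D0" using \<epsilon> \<delta> by (simp add: D0_def)
      also have "\<dots> \<le> G * D0" using G60 D0 \<epsilon>\<delta> by (intro mult_right_mono) auto
      finally show "real d * L ^ 3 \<le> G * D0" .
    qed simp
    finally have 2: "real N1 \<le> 294 * (G * D0 * 2 ^ J)" by simp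
    have "G * (2 ^ J * D0 * 264241152) \<le> G * (8192 * P)"
      using powJ G60 by (intro mult_left_mono) auto
    moreover have "G * (2 ^ J * D0 * 264241152) = 264241152 * (G * D0 * 2 ^ J)" by (simp only: mult_ac)
    moreover have "G * (8192 * P) = 8192 * (G * P)" "3 / 4 * G * P = 3 / 4 * (G * P)" by simp_all
    moreover have "G * P \<ge> 0" using G60 by (simp add: P_def)
    ultimately have "12391 * (G * D0 * 2 ^ J) \<le> 3 / 4 * G * P" by linarith
    then show ?thesis using Pb 1 2 by simp
  qed
  have big: "1000 * (G * D0) \<le> n"
  proof -
    have "G * (264241152 * D0) \<le> G * P" using PD G60 by (intro mult_left_mono) auto
    moreover have "3 / 4 * (G * P) < n" using P_n by simp
    moreover have "G * (264241152 * D0) = 264241152 * (G * D0)" by simp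
    moreover have "G * D0 \<ge> 0" using G60 D0 by simp
    ultimately show ?thesis by linarith
  qed
  have n_d: "16 * real d + 5 \<le> n" and n_L: "3 * L \<le> n" and n_\<delta>: "8 / (\<epsilon> * \<delta>) \<le> n"
  proof -
    have "real d \<le> real d ^ 2" using d1 by (simp add: power2_eq_square)
    then have "real d * 1 * 1 \<le> G * D0" unfolding G_def using L60 D0 by (intro mult_mono) auto
    then show "16 * real d + 5 \<le> n" using big d1 by linarith
    have "1 * L * 1 \<le> G * D0" unfolding G_def using d1 L60 D0 by (intro mult_mono) auto
    then show "3 * L \<le> n" using big L0 by linarith
    have "1 \<le> real d * L ^ 3" using d1 L60 one_le_power[of L 3] mult_mono[of 1 "real d" 1 "L ^ 3"] by simp
    then have "1 / (\<epsilon> * \<delta>) \<le> D0" unfolding D0_def using \<epsilon>\<delta> by (intro divide_right_mono) auto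
    moreover have "1 * D0 \<le> G * D0" using G60 D0 by (intro mult_right_mono) auto
    moreover have "8 / (\<epsilon> * \<delta>) = 8 * (1 / (\<epsilon> * \<delta>))" by simp
    ultimately show "8 / (\<epsilon> * \<delta>) \<le> n" using big D0 by linarith
  qed
  have net: "real ((4 * q + 1) ^ (d + 1)) * ((1 + 4 * real (n * 1)) * exp (- (s\<^sup>2 / (4 * K0)))) \<le> \<epsilon> * \<delta> / 8"
  proof -
    have n1: "real n \<ge> 1" using n by simp
    have q1: "real (4 * q + 1) \<le> real n ^ 2"
    proof -
      have "real q = (real d + 1) * (2 * real J + 2 ^ x1)" by (simp add: q_def algebra_simps)
      also have "\<dots> \<le> (2 * real d) * (2 * real n)"
      proof (rule mult_mono)
        show "2 * real J + 2 ^ x1 \<le> 2 * real n" using J_L n_L x1(1) by linarith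
      qed (use d1 in auto)
      finally have "real (4 * q + 1) \<le> 16 * real d * n + 1" by simp
      also have "\<dots> \<le> (16 * real d + 5) * n" using n1 by (simp add: algebra_simps)
      also have "\<dots> \<le> real n * real n" using n_d by (intro mult_right_mono) auto
      finally show ?thesis by (simp add: power2_eq_square)
    qed
    have "exp (- (s\<^sup>2 / (4 * K0))) = exp (- (7 * d * L))"
      using J13 d1 L0 by (simp add: s_def K0_def power2_eq_square)
    also have "\<dots> = 1 / real n ^ (7 * d)"
      unfolding exp_minus exp_of_nat_mult expL by (simp add: inverse_eq_divide)
    finally have e: "exp (- (s\<^sup>2 / (4 * K0))) = 1 / real n ^ (7 * d)" .
    have "real ((4 * q + 1) ^ (d + 1)) * (1 + 4 * real (n * 1)) * (8 / (\<epsilon> * \<delta>)) \<le> (real n ^ 2) ^ (d + 1) * (real n ^ 2) * n"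
    proof (intro mult_mono)
      show "real ((4 * q + 1) ^ (d + 1)) \<le> (real n ^ 2) ^ (d + 1)"
        unfolding of_nat_power using q1 by (intro power_mono) auto
      have "1 + 4 * real n \<le> 5 * real n" using n1 by simp
      also have "\<dots> \<le> real n * real n" using n_d d1 by (intro mult_right_mono) auto
      finally show "1 + 4 * real (n * 1) \<le> real n ^ 2" by (simp add: power2_eq_square)
    qed (use n_\<delta> \<epsilon>\<delta> in auto)
    also have "\<dots> = real n ^ (2 * (d + 1) + 2 + 1)" by (simp only: power_mult power_add power_one_right)
    also have "\<dots> \<le> real n ^ (7 * d)" using n1 d by (intro power_increasing) auto
    finally show ?thesis unfolding e using n1 \<epsilon>\<delta> by (simp add: field_simps)
  qed
  have low: "2 * (real J)\<^sup>2 * A * n0 < 2 ^ (x0 + w)" and high: "2 * A * N1 < 2 ^ (J + w)"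
  proof -
    have A0: "A > 0" using \<epsilon>\<delta> by (simp add: A_def)
    have JL2: "real J ^ 2 \<le> (3 / 2 * L) ^ 2" using J_L by (intro power_mono) auto
    have AK: "16 * J * A / K \<le> 8064 * D0"
    proof -
      have "16 * J * A / K = 3584 * J ^ 2 * (d * L / (\<epsilon> * \<delta>))" by (simp add: K_eq A_def power2_eq_square)
      also have "\<dots> \<le> 3584 * (3 / 2 * L) ^ 2 * (d * L / (\<epsilon> * \<delta>))"
        using JL2 L0 \<epsilon>\<delta> by (intro mult_right_mono mult_left_mono) auto
      also have "\<dots> = 8064 * D0" by (simp add: D0_def power2_eq_square power3_eq_cube)
      finally show ?thesis .
    qed
    have "2 * (real J)\<^sup>2 * A * n0 = (16 * J * A / K) * (K * J * n0 / 8)" using pos by (simp add: power2_eq_square)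
    also have "\<dots> \<le> 8064 * D0 * (K * J * n0 / 8)" using AK pos by (intro mult_right_mono) auto
    also have "\<dots> \<le> 8064 * D0 * 2 ^ x0" using x0b(2) D0 by (intro mult_left_mono) auto
    also have "\<dots> < 2 ^ w * 2 ^ x0" using w(1) by (intro mult_strict_right_mono) auto
    finally show "2 * (real J)\<^sup>2 * A * n0 < 2 ^ (x0 + w)" by (simp add: power_add mult_ac)
    have "2 * A * N1 \<le> 2 * A * (7 * L * 2 ^ J / K)" using N1_le A0 by (intro mult_left_mono) auto
    also have "\<dots> = (14 * L * A / K) * 2 ^ J" by simp
    also have "14 * L * A / K \<le> 8064 * D0"
    proof -
      have "14 * L * A / K = 3136 * J * (d * L ^ 2 / (\<epsilon> * \<delta>))" by (simp add: K_eq A_def power2_eq_square)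
      also have "\<dots> \<le> 3136 * (3 / 2 * L) * (d * L ^ 2 / (\<epsilon> * \<delta>))"
        using J_L L0 \<epsilon>\<delta> by (intro mult_right_mono mult_left_mono) auto
      also have "\<dots> = 4704 * D0" by (simp add: D0_def power2_eq_square power3_eq_cube)
      finally show ?thesis using D0 by linarith
    qed
    then have "(14 * L * A / K) * 2 ^ J \<le> 8064 * D0 * 2 ^ J" by (intro mult_right_mono) auto
    also have "\<dots> < 2 ^ w * 2 ^ J" using w(1) by (intro mult_strict_right_mono) auto
    finally show "2 * A * N1 < 2 ^ (J + w)" by (simp add: power_add mult_ac)
  qed
  have success: "measure_pmf.prob (sketch_pmf n 1 ((1 - \<epsilon>) / Lo))
      {(S, w). weak_weighted_sketch X Y \<beta>opt (1 + a * \<epsilon>) \<epsilon> (S * append_col X Y) w} \<ge> 1 - (\<delta> + 1 / a)"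
    if X: "X \<in> carrier_mat n d" and Y: "Y \<in> carrier_vec n" and opt: "l1_minimizer X Y \<beta>opt" for X Y \<beta>opt
  proof -
    have "1 - (\<epsilon> * \<delta> / 2 + (1 - \<epsilon>) * ((1 + (real w + 2) / J) / Lo - 1 + \<epsilon> * \<delta> / 2) / (1 + a * \<epsilon> - 1 + \<epsilon>)) \<le>
      measure_pmf.prob (sketch_pmf n 1 ((1 - \<epsilon>) / Lo))
        {(S, w). weak_weighted_sketch X Y \<beta>opt (1 + a * \<epsilon>) \<epsilon> (S * append_col X Y) w}"
      unfolding Lo_def
    proof (rule sketch_success[OF X Y opt _ _ _ _ _ _ K_def, where A = A and q = q and \<delta>H = "\<epsilon> * \<delta> / 8" and \<delta>N = "\<epsilon> * \<delta> / 8"])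
      show "8 \<le> real n0 * K" using n0K8 by simp
      have N1K: "6 * L * 2 ^ J \<le> real N1 * K" using N1_ge pos by (simp add: divide_le_eq)
      have "4 * 2 ^ J \<le> 6 * L * 2 ^ J" using L60 by (intro mult_right_mono) auto
      then show "4 * 2 ^ J \<le> real N1 * K" using N1K by linarith
      have "real (Suc x1 - x0) \<le> 3 / 2 * L" using x0_1 x1_L by (simp add: of_nat_diff)
      then have "4 * real (Suc x1 - x0) \<le> 6 * L * 1" by simp
      also have "\<dots> \<le> 6 * L * 2 ^ J" using L0 J2 by (intro mult_left_mono) auto
      finally show "4 * real (Suc x1 - x0) \<le> real N1 * K" using N1K by linarith
      show "4 * 2 ^ x0 \<le> K * J * n0" using x0b(1) by simp
      show "K * J < 2 ^ Suc x1 * (s / (real n * real 1))"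
      proof -
        have "K * J = 1 / (28 * d * L)" using J13 by (simp add: K_eq)
        also have "\<dots> \<le> s"
        proof -
          have "real J \<le> 28 * 1 * L" using J_L L0 by simp
          also have "\<dots> \<le> 28 * real d * L" using d1 L0 by (intro mult_right_mono mult_left_mono) auto
          finally show ?thesis using J13 d1 L0 unfolding s_def by (intro frac_le) auto
        qed
        also have "\<dots> = n * (s / n)" using n by simp
        also have "\<dots> < 2 ^ Suc x1 * (s / n)" using x1(2) pos n by (intro mult_strict_right_mono) auto
        finally show ?thesis by simp
      qed
      have "(2 * (real d + 1))\<^sup>2 \<le> (2 * (2 * real d))\<^sup>2" using d1 by (intro power_mono) auto
      also have "\<dots> = \<epsilon> * \<delta> / 8 * (K0 * (3584 * real d ^ 3 * J ^ 3 * L / (\<epsilon> * \<delta>)) * s)"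
        using J13 d1 L0 \<epsilon> \<delta> by (simp add: K0_def s_def power2_eq_square power3_eq_cube)
      also have "\<dots> \<le> \<epsilon> * \<delta> / 8 * (K0 * n0 * s)"
        using n0_ge pos \<epsilon>\<delta> by (intro mult_left_mono mult_right_mono) auto
      finally show "1 \<le> real 1 * K0 \<or> (1::nat) = 1 \<and> (2 * (real d + 1))\<^sup>2 \<le> \<epsilon> * \<delta> / 8 * (K0 * n0 * s)" by simp
      show "(real d + 1) * (2 + 2 ^ x1 / J) \<le> s * real q"
        using J13 by (simp add: q_def s_def field_simps)
      show "0 < 1 - 6 / real J - 6 * s" using Lo0 by (simp add: Lo_def)
      show "\<epsilon> * \<delta> / 2 = \<epsilon> * \<delta> / 8 + \<epsilon> * \<delta> / 8 + 2 / A" by (simp add: A_def)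
      show "6 / real J + 2 * s \<le> 1" using J13 by (simp add: s_def field_simps)
      show "1 < 1 + a * \<epsilon>" using a \<epsilon> by simp
    qed (use n pos low high \<epsilon> \<epsilon>\<delta> net in \<open>auto simp: A_def s_def\<close>)
    moreover have "\<epsilon> * \<delta> / 2 + (1 - \<epsilon>) * ((1 + (real w + 2) / J) / Lo - 1 + \<epsilon> * \<delta> / 2) / (1 + a * \<epsilon> - 1 + \<epsilon>) \<le> \<delta> + 1 / a"
    proof -
      have "(1 + (real w + 2) / J) / Lo - 1 = (real w + 14) / (real J - 12)"
        unfolding Lo using J13 by (simp add: field_simps)
      then have "(1 - \<epsilon>) * ((1 + (real w + 2) / J) / Lo - 1) = ((real w + 14) * (1 - \<epsilon>)) / (real J - 12)" by simp
      also have "\<dots> \<le> \<epsilon>"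
      proof -
        have "(real w + 14) * (1 - \<epsilon>) = \<epsilon> * ((real w + 14) * (1 / \<epsilon> - 1))" using \<epsilon> by (simp add: field_simps)
        also have "\<dots> \<le> \<epsilon> * (real J - 12)" using Jb(1) \<epsilon> by (intro mult_left_mono) auto
        finally show ?thesis using J13 by (simp add: divide_le_eq)
      qed
      finally have 1: "(1 - \<epsilon>) * ((1 + (real w + 2) / J) / Lo - 1) \<le> \<epsilon>" .
      have "(1 - \<epsilon>) * (\<epsilon> * \<delta> / 2) \<le> 1 * (\<epsilon> * \<delta> / 2)" using \<epsilon> \<epsilon>\<delta> by (intro mult_right_mono) auto
      then have "(1 - \<epsilon>) * ((1 + (real w + 2) / J) / Lo - 1 + \<epsilon> * \<delta> / 2) \<le> \<epsilon> + \<epsilon> * \<delta> / 2"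
        unfolding distrib_left using 1 by linarith
      then have "(1 - \<epsilon>) * ((1 + (real w + 2) / J) / Lo - 1 + \<epsilon> * \<delta> / 2) / (1 + a * \<epsilon> - 1 + \<epsilon>) \<le> (\<epsilon> + \<epsilon> * \<delta> / 2) / (1 + a * \<epsilon> - 1 + \<epsilon>)"
        using a \<epsilon> by (intro divide_right_mono) auto
      \<comment> \<open>The bound on the mean excess and Markov's threshold are both multiples of
        \<open>\<epsilon>\<close>, which therefore cancels.\<close>
      also have "\<dots> = (1 + \<delta> / 2) / (a + 1)"
      proof -
        have "\<epsilon> + \<epsilon> * \<delta> / 2 = \<epsilon> * (1 + \<delta> / 2)" "1 + a * \<epsilon> - 1 + \<epsilon> = \<epsilon> * (a + 1)" by (auto simp: algebra_simps)
        then show ?thesis using \<epsilon> by simp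
      qed
      also have "\<dots> = 1 / (a + 1) + (\<delta> / 2) / (a + 1)" by (simp add: add_divide_distrib)
      also have "\<dots> \<le> 1 / a + \<delta> / 2"
        using a \<delta> by (intro add_mono) (auto simp: frac_le divide_le_eq)
      finally have "(1 - \<epsilon>) * ((1 + (real w + 2) / J) / Lo - 1 + \<epsilon> * \<delta> / 2) / (1 + a * \<epsilon> - 1 + \<epsilon>) \<le> 1 / a + \<delta> / 2" .
      moreover have "\<epsilon> * \<delta> / 2 \<le> \<delta> / 2" using \<epsilon> \<delta> by simp
      ultimately show ?thesis by linarith
    qed
    ultimately show ?thesis by linarith
  qed
  have \<nu>: "(1 - \<epsilon>) / Lo > 0" using Lo0 \<epsilon> by simp
  show ?thesis
  proof (intro exI conjI ballI allI impI)
    show "real (N0 + N1) \<le> b" by (rule size)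
    show "sketch_distribution (N0 + N1) n (sketch_pmf n 1 ((1 - \<epsilon>) / Lo))" by (rule sketch_pmf_distribution[OF \<nu>])
    show "case Sw of (S, w) \<Rightarrow> stream_computes sketch_update S m 23" if "Sw \<in> set_pmf (sketch_pmf n 1 ((1 - \<epsilon>) / Lo))" for Sw
      using that sketch_pmf_computes[of "fst Sw" "snd Sw" n 1 "(1 - \<epsilon>) / Lo" 23 m] by (cases Sw) simp
  qed (rule success)
qed

section \<open>Sketches of nearly linear size\<close>

lemma ln_le_self: "0 < x \<Longrightarrow> ln x \<le> (x :: real)"
  using ln_le_minus_one[of x] by simp

text \<open>Here \<open>R * K0 = 1\<close>, so no entry is heavy. The mean excess is about
  \<open>(1 - e / 2) / c\<close> and Markov's threshold is \<open>1 / c + e\<close>, which leaves a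
  success probability of order \<open>e\<close>. The hypothesis on \<open>\<eta>\<close> is
  circular, since \<open>B\<close> contains \<open>\<eta>\<close>;
  \<open>constant_factor_sketch\<close> supplies a solution.\<close>

lemma constant_factor_sketch_large:
  fixes n d :: nat and c e \<eta> :: real
  defines "s \<equiv> e / 64"
  defines "B \<equiv> 784 / s\<^sup>2 * \<eta>"
  assumes c: "0 < c" "c \<le> 1" and e: "0 < e" "e \<le> 1 / 2"
    and \<eta>: "1 \<le> \<eta>" "1 / s + 29 / 2 + 3 / 2 * ln B \<le> \<eta>"
    and d: "1 \<le> d" "d \<le> n" and n: "29 / s ^ 3 \<le> n"
  shows "\<exists>r D. real r \<le> (9 + 5 * \<eta>) * (49 / s) * (2 powr (1 / s + 10) * B) * (real d powr (1 + c) * ln n powr (2 + 2 * c)) \<and>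
    sketch_distribution r n D \<and>
    (\<forall>(S, w)\<in>set_pmf D. stream_computes sketch_update S m (900 / s\<^sup>2 * (real d * ln n))) \<and>
    (\<forall>X\<in>carrier_mat n d. \<forall>Y\<in>carrier_vec n. \<forall>\<beta>opt. l1_minimizer X Y \<beta>opt \<longrightarrow>
      measure_pmf.prob D {(S, w). weak_weighted_sketch X Y \<beta>opt (1 + 1 / c) e (S * append_col X Y) w} \<ge> e / 4)"
proof -
  have s: "0 < s" "s \<le> 1 / 128" using e by (auto simp: s_def)
  have s1: "128 \<le> 1 / s" using s by (simp add: le_divide_eq)
  have sp: "s ^ k \<le> 1" for k using s by (intro power_le_one) auto
  have s2: "0 < s\<^sup>2" "s\<^sup>2 \<le> 1" using s sp by auto
  have e_s: "e = 64 * s" by (simp add: s_def)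
  have n29: "29 \<le> real n"
  proof -
    have "29 \<le> 29 / s ^ 3" using s sp by (simp add: le_divide_eq)
    then show ?thesis using n by linarith
  qed
  define L where "L = ln (real n)"
  have expL: "exp L = n" using n29 by (simp add: L_def)
  have d1: "real d \<ge> 1" using d by simp
  have L1: "L \<ge> 1"
  proof -
    have "exp 1 \<le> real n" using e_less_272 n29 by linarith
    then show ?thesis unfolding L_def using n29 by (subst ln_ge_iff) auto
  qed
  have L_n: "L \<le> n" unfolding L_def using n29 by (intro ln_le_self) auto
  have dL: "1 \<le> real d * L" using mult_mono[of 1 "real d" 1 L] d1 L1 by simp
  \<comment> \<open>48 makes \<open>s^2 * R / 4\<close> at least \<open>12 * d * L\<close>. A point
    of the net then fails with probability about \<open>1 / n ^ (12 * d)\<close>, against at most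
    \<open>n ^ (3 * (d + 1))\<close> points.\<close>
  define R where "R = nat \<lceil>48 * (real d * L) / s\<^sup>2\<rceil>"
  have R_ge: "48 * (real d * L) / s\<^sup>2 \<le> R" unfolding R_def by (rule real_nat_ceiling_ge)
  have dLs: "1 \<le> real d * L / s\<^sup>2" using dL s2 by (simp add: le_divide_eq)
  have R_le: "real R \<le> 49 * (real d * L) / s\<^sup>2"
  proof -
    have "real R \<le> 48 * (real d * L) / s\<^sup>2 + 1" unfolding R_def using dL s2 by (intro real_nat_ceiling_le) auto
    also have "\<dots> \<le> 48 * (real d * L) / s\<^sup>2 + real d * L / s\<^sup>2" using dLs by (rule add_left_mono)
    also have "\<dots> = 49 * (real d * L) / s\<^sup>2" by (simp flip: add_divide_distrib)
    finally show ?thesis .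
  qed
  have R1: "1 \<le> real R" using R_ge dLs by simp
  have Rs: "1 \<le> real R * s"
  proof -
    have "1 * 1 \<le> 48 * (real d * L) * (1 / s)" using dL s1 by (intro mult_mono) auto
    also have "\<dots> = 48 * (real d * L) / s\<^sup>2 * s" using s by (simp add: power2_eq_square)
    also have "\<dots> \<le> R * s" using R_ge s by (intro mult_right_mono) auto
    finally show ?thesis by simp
  qed
  define K0 where "K0 = 1 / real R"
  define K where "K = K0 / s"
  have pos: "K0 > 0" "K > 0" using R1 s by (auto simp: K0_def K_def)
  have K_inv: "1 / K = R * s" using R1 s by (simp add: K_def K0_def)
  have B1: "2 \<le> B"
  proof -
    have "2 \<le> 784 / s\<^sup>2" using s2 by (simp add: le_divide_eq)
    then have "2 * 1 \<le> 784 / s\<^sup>2 * \<eta>" using \<eta> by (intro mult_mono) auto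
    then show ?thesis by (simp add: B_def)
  qed
  define X' where "X' = \<eta> * L"
  have X1: "1 \<le> X'" using mult_mono[of 1 \<eta> 1 L] \<eta> L1 by (simp add: X'_def)
  define D0 where "D0 = real d * L\<^sup>2"
  have D0: "1 \<le> D0" using mult_mono[of 1 "real d" 1 "L\<^sup>2"] d1 L1 by (simp add: D0_def)
  have BD: "1 \<le> B / 2 * D0" using mult_mono[of 1 "B / 2" 1 D0] B1 D0 by simp
  \<comment> \<open>\<open>B / 2 * D0\<close> bounds \<open>16 * X' * A * (R * s)\<close>, from
    which both conditions of \<open>kept_le\<close> follow; \<open>784 = 2 * 8 * 49\<close>, where
    49 is the constant of \<open>R_le\<close>.\<close>
  obtain w' where w': "2 ^ w' \<le> B / 2 * D0" "B / 2 * D0 < 2 ^ Suc w'"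
    using dyadic_bracket[OF BD] by blast
  define w where "w = Suc w'"
  have w: "B / 2 * D0 < 2 ^ w" "2 ^ w \<le> B * D0" using w' by (auto simp: w_def)
  \<comment> \<open>\<open>c * w\<close> is responsible for the factor \<open>1 + 1 / c\<close>. The
    summands \<open>1 / s\<close> and 8 outweigh the losses and the noise and cost only a constant
    factor in \<open>2 ^ J\<close>.\<close>
  define J where "J = nat \<lceil>c * real w\<rceil> + nat \<lceil>1 / s\<rceil> + 8"
  have J_eq: "real J = real (nat \<lceil>c * real w\<rceil>) + real (nat \<lceil>1 / s\<rceil>) + 8"
    by (simp only: J_def of_nat_add of_nat_numeral)
  have cw: "0 \<le> c * real w" "c * real w \<le> real w" using c by (auto simp: mult_left_le_one_le)
  have J_ge: "c * real w + 1 / s + 8 \<le> real J"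
    unfolding J_eq by (intro add_mono real_nat_ceiling_ge order_refl)
  have J_le: "real J \<le> c * real w + (1 / s + 10)"
    using real_nat_ceiling_le[OF cw(1)] real_nat_ceiling_le[of "1 / s"] s1 unfolding J_eq by linarith
  have J136: "real J \<ge> 136" using J_ge cw s1 by linarith
  have J_X: "real J \<le> X'"
  proof -
    have "real w \<le> 3 / 2 * ln (B * D0)" using w(2) by (rule exponent_le_ln)
    also have "ln (B * D0) = ln B + (ln (real d) + 2 * ln L)"
      using B1 d1 L1 by (simp add: D0_def ln_mult ln_realpow)
    also have "\<dots> \<le> ln B + (L + 2 * L)"
    proof -
      have "ln (real d) \<le> L" unfolding L_def using d by simp
      moreover have "ln L \<le> L" using L1 by (intro ln_le_self) auto
      ultimately show ?thesis by simp
    qed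
    finally have "real J \<le> 9 / 2 * L + (1 / s + 10 + 3 / 2 * ln B)" using J_le cw by simp
    also have "\<dots> \<le> 9 / 2 * L + (\<eta> - 9 / 2) * 1" using \<eta>(2) by simp
    also have "\<dots> \<le> 9 / 2 * L + (\<eta> - 9 / 2) * L"
    proof (intro add_left_mono mult_left_mono)
      have "ln B \<ge> 0" using B1 by simp
      then show "0 \<le> \<eta> - 9 / 2" using \<eta>(2) s1 by linarith
    qed (rule L1)
    finally show ?thesis by (simp add: X'_def algebra_simps)
  qed
  define n0 where "n0 = nat \<lceil>8 * (R * s)\<rceil>"
  define N1 where "N1 = nat \<lceil>4 * X' * 2 ^ J * (R * s)\<rceil>"
  have n0_ge: "8 * (R * s) \<le> n0" unfolding n0_def by (rule real_nat_ceiling_ge)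
  have n0_le: "real n0 \<le> 9 * (R * s)"
  proof -
    have "0 \<le> 8 * (R * s)" using Rs by linarith
    from real_nat_ceiling_le[OF this] show ?thesis using Rs unfolding n0_def[symmetric] by linarith
  qed
  have N1_ge: "4 * X' * 2 ^ J * (R * s) \<le> N1" unfolding N1_def by (rule real_nat_ceiling_ge)
  have J2: "(1::real) \<le> 2 ^ J" by simp
  have XJ: "1 \<le> X' * 2 ^ J * (R * s)"
  proof -
    have "1 * 1 * 1 \<le> X' * 2 ^ J * (R * s)" using X1 J2 Rs by (intro mult_mono) auto
    then show ?thesis by simp
  qed
  have N1_le: "real N1 \<le> 5 * (X' * 2 ^ J * (R * s))"
  proof -
    have eq: "4 * X' * 2 ^ J * (R * s) = 4 * (X' * 2 ^ J * (R * s))" by (simp only: mult.assoc)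
    have "real N1 \<le> 4 * (X' * 2 ^ J * (R * s)) + 1"
      unfolding N1_def eq
    proof (rule real_nat_ceiling_le)
      show "0 \<le> 4 * (X' * 2 ^ J * (R * s))" using XJ by linarith
    qed
    then show ?thesis using XJ by linarith
  qed
  have KRs: "K * (R * s) = 1" using R1 s by (simp add: K_def K0_def)
  have n0K: "8 \<le> n0 * K"
  proof -
    have "8 * (R * s) * K \<le> n0 * K" using n0_ge pos by (intro mult_right_mono) auto
    moreover have "8 * (R * s) * K = 8 * (K * (R * s))" by (simp only: mult_ac)
    ultimately show ?thesis unfolding KRs by simp
  qed
  have N1K: "4 * X' * 2 ^ J \<le> N1 * K"
  proof -
    have "4 * X' * 2 ^ J * (R * s) * K \<le> N1 * K" using N1_ge pos by (intro mult_right_mono) auto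
    moreover have "4 * X' * 2 ^ J * (R * s) * K = 4 * X' * 2 ^ J * (K * (R * s))" by (simp only: mult_ac)
    ultimately show ?thesis unfolding KRs by simp
  qed
  have KJn0: "8 * 136 \<le> K * J * n0"
  proof -
    have "8 * 136 \<le> (n0 * K) * J" using n0K J136 by (intro mult_mono) auto
    then show ?thesis by (simp only: mult_ac)
  qed
  obtain x0 where x0b: "2 ^ x0 \<le> K * J * n0 / 4" "K * J * n0 / 4 < 2 ^ Suc x0"
    using dyadic_bracket[of "K * J * n0 / 4"] KJn0 by auto
  have x0_1: "x0 \<ge> 1"
  proof (rule ccontr)
    assume "\<not> 1 \<le> x0"
    then have "x0 = 0" by simp
    then show False using x0b(2) KJn0 by simp
  qed
  have Jn: "1 \<le> J * (n / s\<^sup>2)"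
  proof -
    have "1 \<le> n / s\<^sup>2" using n29 s2 by (simp add: le_divide_eq)
    then have "1 * 1 \<le> J * (n / s\<^sup>2)" using J136 by (intro mult_mono) auto
    then show ?thesis by simp
  qed
  obtain x1 where x1: "2 ^ x1 \<le> J * (n / s\<^sup>2)" "J * (n / s\<^sup>2) < 2 ^ Suc x1"
    using dyadic_bracket[OF Jn] by blast
  have x1_X: "real x1 \<le> X'"
  proof -
    have "real x1 \<le> 3 / 2 * ln (J * (n / s\<^sup>2))" using x1(1) by (rule exponent_le_ln)
    also have "ln (J * (n / s\<^sup>2)) \<le> ln (B * (L * n))"
    proof (subst ln_le_cancel_iff)
      have "J * (n / s\<^sup>2) \<le> \<eta> * L * (n / s\<^sup>2)" using J_X by (intro mult_right_mono) (auto simp: X'_def)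
      also have "\<dots> = (1 * \<eta> * L * n) / s\<^sup>2" by simp
      also have "\<dots> \<le> (784 * \<eta> * L * n) / s\<^sup>2"
        using \<eta> L1 s2 by (intro divide_right_mono mult_right_mono) auto
      finally show "J * (n / s\<^sup>2) \<le> B * (L * n)" by (simp add: B_def)
    qed (use J136 n29 s2 B1 L1 in auto)
    also have "\<dots> = ln B + (ln L + L)" using B1 L1 n29 by (simp add: ln_mult L_def)
    also have "\<dots> \<le> ln B + (L + L)" using ln_le_self[of L] L1 by simp
    finally have "real x1 \<le> 3 * L + 3 / 2 * ln B" by simp
    also have "\<dots> \<le> 3 * L + (\<eta> - 3) * 1" using \<eta>(2) s1 by simp
    also have "\<dots> \<le> 3 * L + (\<eta> - 3) * L"
    proof (intro add_left_mono mult_left_mono)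
      have "ln B \<ge> 0" using B1 by simp
      then show "0 \<le> \<eta> - 3" using \<eta>(2) s1 by linarith
    qed (rule L1)
    finally show ?thesis by (simp add: X'_def algebra_simps)
  qed
  interpret sketching_scheme J n0 N1 x0 x1
  proof
    show "0 < J" using J136 by linarith
    show "0 < n0" using n0K by (cases n0) auto
    have "0 < 4 * X' * 2 ^ J * (R * s)" using X1 Rs by simp
    then show "0 < N1" using N1_ge by (cases N1) auto
  qed (rule x0_1)
  define q where "q = nat \<lceil>(real d + 1) * (2 + 2 ^ x1 / J) / s\<rceil>"
  define Lo where "Lo = 1 - 6 / real J - 6 * s"
  have Lo: "Lo = (J * (1 - 6 * s) - 6) / J" using J136 by (simp add: Lo_def field_simps)
  have Lo0: "Lo > 0"
  proof -
    have "6 / real J \<le> 6 / 136" using J136 by (intro frac_le) auto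
    then show ?thesis using s by (simp add: Lo_def)
  qed
  have size: "real (N0 + N1) \<le> (9 + 5 * \<eta>) * (49 / s) * (2 powr (1 / s + 10) * B) * (real d powr (1 + c) * L powr (2 + 2 * c))"
  proof -
    have "real N0 \<le> real n0 * 2 ^ J" by (simp add: N0_def mult_left_mono of_nat_diff)
    also have "\<dots> \<le> 9 * (R * s) * 2 ^ J" using n0_le by (intro mult_right_mono) auto
    also have "\<dots> \<le> 9 * (R * s) * 2 ^ J * L" using mult_left_mono[of 1 L "9 * (R * s) * 2 ^ J"] L1 Rs s by simp
    finally have "real (N0 + N1) \<le> (9 + 5 * \<eta>) * (L * (R * s) * 2 ^ J)"
      using N1_le by (simp add: X'_def algebra_simps)
    also have "\<dots> \<le> (9 + 5 * \<eta>) * ((49 / s * (d * L\<^sup>2)) * (2 powr (1 / s + 10) * B * (d powr c * L powr (2 * c))))"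
    proof (rule mult_left_mono[OF mult_mono])
      have "L * (R * s) \<le> L * (49 * (real d * L) / s\<^sup>2 * s)"
        using R_le L1 s by (intro mult_left_mono mult_right_mono) auto
      also have "\<dots> = 49 / s * (d * L\<^sup>2)" using s by (simp add: power2_eq_square)
      finally show "L * (R * s) \<le> 49 / s * (d * L\<^sup>2)" .
      have "(2::real) ^ J = 2 powr real J" by (simp add: powr_realpow)
      also have "\<dots> \<le> 2 powr (c * real w + (1 / s + 10))" using J_le by simp
      also have "\<dots> = 2 powr (1 / s + 10) * (2 powr real w) powr c"
        unfolding powr_add powr_powr by (simp only: mult.commute)
      also have "2 powr real w = (2 :: real) ^ w" by (rule powr_realpow) simp
      also have "2 powr (1 / s + 10) * (2 ^ w) powr c \<le> 2 powr (1 / s + 10) * (B * D0) powr c"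
        using w(2) c by (intro mult_left_mono powr_mono2) auto
      also have "(B * D0) powr c = B powr c * (d powr c * L powr (2 * c))"
      proof -
        have "L\<^sup>2 = L powr 2" using L1 by simp
        then have "D0 powr c = d powr c * L powr (2 * c)" unfolding D0_def by (simp only: powr_mult powr_powr)
        then show ?thesis by (simp only: powr_mult)
      qed
      also have "2 powr (1 / s + 10) * (B powr c * (d powr c * L powr (2 * c)))
          \<le> 2 powr (1 / s + 10) * (B powr 1 * (d powr c * L powr (2 * c)))"
        using B1 c by (intro mult_left_mono mult_right_mono powr_mono) auto
      finally show "2 ^ J \<le> 2 powr (1 / s + 10) * B * (d powr c * L powr (2 * c))"
        using B1 by (simp add: mult.assoc)
    qed (use \<eta> L1 s in auto)
    also have "\<dots> = (9 + 5 * \<eta>) * (49 / s) * (2 powr (1 / s + 10) * B) * ((d * d powr c) * (L\<^sup>2 * L powr (2 * c)))"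
      by (simp only: mult_ac)
    also have "real d * d powr c = d powr (1 + c)" using d1 by (simp add: powr_add)
    also have "L\<^sup>2 * L powr (2 * c) = L powr (2 + 2 * c)" using L1 by (simp add: powr_add)
    finally show ?thesis .
  qed
  have net: "real ((4 * q + 1) ^ (d + 1)) * ((1 + 4 * real (n * R)) * exp (- (s\<^sup>2 / (4 * K0)))) \<le> e / 16"
  proof -
    have n1: "real n \<ge> 1" using n29 by simp
    have q1: "real (4 * q + 1) \<le> real n ^ 3"
    proof -
      have xJ: "2 + 2 ^ x1 / J \<le> 3 * (n / s\<^sup>2)"
      proof -
        have "2 ^ x1 / real J \<le> n / s\<^sup>2" using x1(1) J136 by (simp add: divide_le_eq mult.commute)
        moreover have "1 \<le> n / s\<^sup>2" using n29 s2 by (simp add: le_divide_eq)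
        ultimately show ?thesis by linarith
      qed
      have "real q \<le> (real d + 1) * (2 + 2 ^ x1 / J) / s + 1"
        unfolding q_def using J136 s by (intro real_nat_ceiling_le) auto
      also have "(real d + 1) * (2 + 2 ^ x1 / J) / s \<le> (2 * real d) * (3 * (n / s\<^sup>2)) / s"
        using d1 xJ s by (intro divide_right_mono mult_mono) auto
      also have "\<dots> = 6 * (d * n / s ^ 3)" by (simp add: power2_eq_square power3_eq_cube)
      finally have "real (4 * q + 1) \<le> 24 * (d * n / s ^ 3) + 5" by simp
      also have "\<dots> \<le> 29 * (d * n / s ^ 3)"
      proof -
        have "s ^ 3 \<le> 1 * 1" using sp by simp
        also have "\<dots> \<le> real d * n" using d1 n1 by (intro mult_mono) auto
        finally have "1 \<le> d * n / s ^ 3" using s by (simp add: le_divide_eq)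
        then show ?thesis by simp
      qed
      also have "\<dots> = (29 / s ^ 3) * (real d * n)" by simp
      also have "\<dots> \<le> n * (real n * n)" using n d by (intro mult_mono) auto
      finally show ?thesis by (simp add: power3_eq_cube)
    qed
    have nR: "1 + 4 * real (n * R) \<le> real n ^ 5"
    proof -
      have "1 * 1 \<le> real n * R" using n1 R1 by (intro mult_mono) auto
      then have "1 + 4 * real (n * R) \<le> 5 * (real n * R)" unfolding of_nat_mult by linarith
      also have "\<dots> \<le> n * (real n * real n ^ 3)"
      proof (intro mult_mono)
        have "real R \<le> (49 / s\<^sup>2) * (real d * L)" using R_le by simp
        also have "\<dots> \<le> n * (real n * n)"
        proof (intro mult_mono)
          have "49 * s \<le> 29" using s by simp
          then have "49 * s / s ^ 3 \<le> 29 / s ^ 3" using s by (intro divide_right_mono) auto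
          moreover have "49 * s / s ^ 3 = 49 / s\<^sup>2" by (simp add: power2_eq_square power3_eq_cube)
          ultimately show "49 / s\<^sup>2 \<le> n" using n by linarith
        qed (use d L_n L1 in auto)
        finally show "real R \<le> real n ^ 3" by (simp add: power3_eq_cube)
      qed (use n29 in auto)
      finally show ?thesis by (simp add: power_Suc[symmetric] del: power_Suc)
    qed
    have "s\<^sup>2 / (4 * K0) = s\<^sup>2 * R / 4" using R1 by (simp add: K0_def)
    moreover have "12 * d * L \<le> s\<^sup>2 * R / 4"
    proof -
      have "s\<^sup>2 * (48 * (real d * L) / s\<^sup>2) \<le> s\<^sup>2 * R" using R_ge s2 by (intro mult_left_mono) auto
      then show ?thesis using s by simp
    qed
    ultimately have "exp (- (s\<^sup>2 / (4 * K0))) \<le> exp (- (real (12 * d) * L))" by simp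
    also have "\<dots> = 1 / real n ^ (12 * d)"
      unfolding exp_minus exp_of_nat_mult expL by (simp add: inverse_eq_divide)
    finally have ex: "exp (- (s\<^sup>2 / (4 * K0))) \<le> 1 / real n ^ (12 * d)" .
    have ne: "16 / e \<le> n"
    proof -
      have "s\<^sup>2 / 4 / s ^ 3 \<le> 29 / s ^ 3" using s s2 by (intro divide_right_mono) auto
      moreover have "s\<^sup>2 / 4 / s ^ 3 = 1 / (4 * s)" by (simp add: power2_eq_square power3_eq_cube)
      ultimately show ?thesis using n by (simp add: e_s)
    qed
    define Z where "Z = real ((4 * q + 1) ^ (d + 1)) * (1 + 4 * real (n * R))"
    have Z0: "0 \<le> Z" by (simp add: Z_def)
    have "Z * (16 / e) \<le> ((real n ^ 3) ^ (d + 1) * real n ^ 5) * n"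
      unfolding Z_def
    proof (rule mult_mono[OF mult_mono])
      show "real ((4 * q + 1) ^ (d + 1)) \<le> (real n ^ 3) ^ (d + 1)"
        unfolding of_nat_power using q1 by (intro power_mono) auto
      show "0 \<le> 16 / e" using e by simp
    qed (rule nR | rule ne | simp)+
    also have "\<dots> = real n ^ (3 * (d + 1) + 5 + 1)" by (simp only: power_mult power_add power_one_right)
    also have "\<dots> \<le> real n ^ (12 * d)" using n1 d by (intro power_increasing) auto
    finally have "Z * (16 / e) * (e / 16) \<le> real n ^ (12 * d) * (e / 16)" using e by (intro mult_right_mono) auto
    then have p: "Z \<le> real n ^ (12 * d) * (e / 16)" using e by simp
    have "Z * exp (- (s\<^sup>2 / (4 * K0))) \<le> real n ^ (12 * d) * (e / 16) * (1 / real n ^ (12 * d))"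
      using e by (intro mult_mono[OF p ex]) auto
    also have "\<dots> = e / 16" using n1 by simp
    finally show ?thesis unfolding Z_def by (simp only: mult.assoc)
  qed
  \<comment> \<open>As \<open>e = 64 * s\<close>, the outliers have probability at most
    \<open>2 / A = e / 16\<close>.\<close>
  define A where "A = 1 / (2 * s)"
  have A0: "A > 0" using s by (simp add: A_def)
  have Aw: "16 * X' * A * (R * s) < 2 ^ w"
  proof -
    have "16 * X' * A * (R * s) = 8 * \<eta> * L * R" using s(1) unfolding A_def X'_def by simp
    also have "\<dots> \<le> 8 * \<eta> * L * (49 * (real d * L) / s\<^sup>2)" using R_le \<eta> L1 by (intro mult_left_mono) auto
    also have "\<dots> = B / 2 * D0" unfolding B_def D0_def by (simp add: power2_eq_square)
    also note w(1)
    finally show ?thesis .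
  qed
  have low: "2 * (real J)\<^sup>2 * A * n0 < 2 ^ (x0 + w)"
  proof -
    have "2 * (real J)\<^sup>2 * A * n0 = (2 * (real J)\<^sup>2 * A * n0) * (K * (R * s))" unfolding KRs by simp
    also have "\<dots> = (16 * J * A * (R * s)) * (K * J * n0 / 8)" by (simp add: power2_eq_square mult_ac)
    also have "\<dots> \<le> (16 * X' * A * (R * s)) * (K * J * n0 / 8)"
      using J_X A0 Rs pos by (intro mult_right_mono mult_left_mono) auto
    also have "\<dots> \<le> 2 ^ w * (K * J * n0 / 8)" using Aw pos by (intro mult_right_mono) auto
    also have "\<dots> < 2 ^ w * 2 ^ x0" using x0b(2) by (intro mult_strict_left_mono) auto
    finally show ?thesis by (simp add: power_add mult_ac)
  qed
  have high: "2 * A * N1 < 2 ^ (J + w)"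
  proof -
    have "2 * A * N1 \<le> 2 * A * (5 * (X' * 2 ^ J * (R * s)))" using N1_le A0 by (intro mult_left_mono) auto
    also have "\<dots> = (10 * (X' * A * (R * s))) * 2 ^ J" by simp
    also have "\<dots> \<le> (16 * (X' * A * (R * s))) * 2 ^ J" using X1 A0 Rs by (intro mult_right_mono) auto
    also have "\<dots> < 2 ^ w * 2 ^ J" using Aw by (intro mult_strict_right_mono) auto
    finally show ?thesis by (simp add: power_add mult_ac)
  qed
  have success: "measure_pmf.prob (sketch_pmf n R ((1 - e) / Lo))
      {(S, w). weak_weighted_sketch X Y \<beta>opt (1 + 1 / c) e (S * append_col X Y) w} \<ge> e / 4"
    if X: "X \<in> carrier_mat n d" and Y: "Y \<in> carrier_vec n" and opt: "l1_minimizer X Y \<beta>opt" for X Y \<beta>opt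
  proof -
    have "1 - (e / 8 + (1 - e) * ((1 + (real w + 2) / J) / Lo - 1 + e / 8) / (1 + 1 / c - 1 + e)) \<le>
      measure_pmf.prob (sketch_pmf n R ((1 - e) / Lo))
        {(S, w). weak_weighted_sketch X Y \<beta>opt (1 + 1 / c) e (S * append_col X Y) w}"
      unfolding Lo_def
    proof (rule sketch_success[OF X Y opt _ _ _ _ _ _ K_def, where A = A and q = q and \<delta>H = 0 and \<delta>N = "e / 16"])
      show "1 \<le> R" using R1 by simp
      show "1 / s \<le> J" using J_ge cw by linarith
      show "6 / real J + 2 * s \<le> 1"
      proof -
        have "6 / real J \<le> 6 / 136" using J136 by (intro frac_le) auto
        then show ?thesis using s by simp
      qed
      have "4 * 1 * 2 ^ J \<le> 4 * X' * 2 ^ J" using X1 by (intro mult_right_mono) auto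
      then show "4 * 2 ^ J \<le> real N1 * K" using N1K by linarith
      have "real (Suc x1 - x0) \<le> X'" using x0_1 x1_X by (simp add: of_nat_diff)
      then have "4 * real (Suc x1 - x0) \<le> 4 * X' * 1" by simp
      also have "\<dots> \<le> 4 * X' * 2 ^ J" using X1 J2 by (intro mult_left_mono) auto
      finally show "4 * real (Suc x1 - x0) \<le> real N1 * K" using N1K by linarith
      show "4 * 2 ^ x0 \<le> K * J * n0" using x0b(1) by simp
      show "K * J < 2 ^ Suc x1 * (s / (real n * real R))"
      proof -
        have "K * J = J * (n / s\<^sup>2) * (s / (real n * real R))"
          using n29 s by (simp add: K_def K0_def power2_eq_square)
        also have "\<dots> < 2 ^ Suc x1 * (s / (real n * real R))"
          using x1(2) s n29 R1 by (intro mult_strict_right_mono) auto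
        finally show ?thesis .
      qed
      show "1 \<le> real R * K0 \<or> R = 1 \<and> (2 * (real d + 1))\<^sup>2 \<le> 0 * (K0 * n0 * s)" using R1 by (simp add: K0_def)
      have "(real d + 1) * (2 + 2 ^ x1 / J) / s \<le> q" unfolding q_def by (rule real_nat_ceiling_ge)
      then show "(real d + 1) * (2 + 2 ^ x1 / J) \<le> s * real q" using s by (simp add: divide_le_eq mult.commute)
      show "0 < 1 - 6 / real J - 6 * s" using Lo0 by (simp add: Lo_def)
      show "e / 8 = 0 + e / 16 + 2 / A" using s by (simp add: A_def e_s)
      show "1 < 1 + 1 / c" using c by simp
    qed (use n29 s pos low high e net n0K A0 in auto)
    moreover have "e / 8 + (1 - e) * ((1 + (real w + 2) / J) / Lo - 1 + e / 8) / (1 + 1 / c - 1 + e) \<le> 1 - e / 4"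
    proof -
      define W where "W = J * (1 - 6 * s) - 6"
      have W0: "W > 0" using Lo0 J136 unfolding Lo W_def by (simp add: zero_less_divide_iff)
      have "1 + (real w + 2) / J = (J + real w + 2) / J" using J136 by (simp add: field_simps)
      then have "(1 + (real w + 2) / J) / Lo = (J + real w + 2) / W"
        unfolding Lo W_def[symmetric] using J136 by simp
      also have "\<dots> - 1 = (real w + 8 + 6 * s * J) / W" using W0 by (simp add: field_simps W_def)
      also have "\<dots> \<le> (1 + e / 2) / c"
      proof -
        have "c * (8 + 6 * s * J) \<le> 1 * (8 + 6 * s * J)" using c s by (intro mult_right_mono) auto
        then have "c * (real w + 8 + 6 * s * J) \<le> J - 1 / s + 6 * s * J" using J_ge by (simp add: algebra_simps)
        also have "\<dots> \<le> (1 + e / 2) * W"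
        proof -
          have "192 * s\<^sup>2 \<le> 20 * s" using s by (simp add: power2_eq_square)
          then have "192 * s\<^sup>2 * J \<le> 20 * s * J" by (intro mult_right_mono) auto
          moreover have "(1 + e / 2) * W = J + 26 * s * J - 192 * s\<^sup>2 * J - 6 - 192 * s"
            by (simp add: W_def e_s algebra_simps power2_eq_square)
          moreover have "26 * s * J = 20 * s * J + 6 * s * J" by simp
          ultimately show ?thesis using s s1 by linarith
        qed
        finally show ?thesis using c W0 by (simp add: field_simps)
      qed
      finally have "(1 - e) * ((1 + (real w + 2) / J) / Lo - 1 + e / 8) \<le> (1 - e) * ((1 + e / 2) / c + e / 8)"
        using e by (intro mult_left_mono) auto
      also have "\<dots> = ((1 - e) * (1 + e / 2)) / c + (1 - e) * (e / 8)" by (simp add: distrib_left)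
      also have "\<dots> \<le> (1 - e / 2) / c + e / 8"
        using c e by (intro add_mono divide_right_mono) (auto simp: algebra_simps)
      \<comment> \<open>\<open>c \<le> 1\<close> turns the additive \<open>e / 8\<close> into a
        multiple of \<open>1 / c\<close>.\<close>
      also have "\<dots> \<le> ((1 - e / 2) + e / 8) * (1 / c + e)"
      proof -
        have "1 \<le> 1 / c" using c by simp
        then have "e / 8 * 1 \<le> e / 8 * (1 / c)" using e by (intro mult_left_mono) auto
        moreover have "0 \<le> ((1 - e / 2) + e / 8) * e" using e by simp
        moreover have "((1 - e / 2) + e / 8) * (1 / c + e) = (1 - e / 2) / c + e / 8 * (1 / c) + ((1 - e / 2) + e / 8) * e"
          by (simp only: distrib_left distrib_right add_divide_distrib times_divide_eq_right mult_1_right)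
        ultimately show ?thesis by linarith
      qed
      finally have "(1 - e) * ((1 + (real w + 2) / J) / Lo - 1 + e / 8) / (1 + 1 / c - 1 + e) \<le> (1 - e / 2) + e / 8"
        using c e by (simp add: divide_le_eq add_pos_pos)
      then show ?thesis by linarith
    qed
    ultimately show ?thesis by linarith
  qed
  have \<nu>: "(1 - e) / Lo > 0" using Lo0 e by simp
  have time: "18 * real R + 5 \<le> 900 / s\<^sup>2 * (real d * L)"
  proof -
    have "18 * real R + 5 \<le> 18 * (49 * (real d * L) / s\<^sup>2) + 5 * (real d * L / s\<^sup>2)" using R_le dLs by linarith
    also have "\<dots> = 887 / s\<^sup>2 * (real d * L)" by simp
    also have "\<dots> \<le> 900 / s\<^sup>2 * (real d * L)" using dL by (intro mult_right_mono divide_right_mono) auto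
    finally show ?thesis .
  qed
  show ?thesis
  proof (intro exI conjI ballI allI impI)
    show "real (N0 + N1) \<le> (9 + 5 * \<eta>) * (49 / s) * (2 powr (1 / s + 10) * B) * (real d powr (1 + c) * ln n powr (2 + 2 * c))"
      using size by (simp add: L_def)
    show "sketch_distribution (N0 + N1) n (sketch_pmf n R ((1 - e) / Lo))" by (rule sketch_pmf_distribution[OF \<nu>])
    show "case Sw of (S, w) \<Rightarrow> stream_computes sketch_update S m (900 / s\<^sup>2 * (real d * ln n))"
      if "Sw \<in> set_pmf (sketch_pmf n R ((1 - e) / Lo))" for Sw
      using that sketch_pmf_computes[OF _ time, of "fst Sw" "snd Sw" n "(1 - e) / Lo" m] by (cases Sw) (simp add: L_def)
  qed (rule success)
qed

section \<open>Monotonicity and small instances\<close>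

lemma weak_weighted_sketch_mono:
  assumes "weak_weighted_sketch X Y \<beta>opt \<alpha> \<epsilon> X' w" "\<epsilon> \<le> \<epsilon>'"
  shows "weak_weighted_sketch X Y \<beta>opt \<alpha> \<epsilon>' X' w"
proof -
  have "(1 - \<epsilon>') * l1_loss X Y \<beta> \<le> (1 - \<epsilon>) * l1_loss X Y \<beta>" for \<beta>
    using assms(2) by (intro mult_right_mono l1_loss_nonneg) simp
  then show ?thesis using assms(1) unfolding weak_weighted_sketch_def by (blast intro: order_trans)
qed

lemma stream_computes_mono:
  assumes "stream_computes prog S m \<tau>" "\<tau> \<le> \<tau>'"
  shows "stream_computes prog S m \<tau>'"
proof -
  have le: "t \<le> \<tau>' * real k" if "t \<le> \<tau> * real k" for t k
    using that mult_right_mono[OF assms(2), of "real k"] by simp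
  obtain s0 p where s0: "\<And>us. turnstile_stream (dim_col S) m us \<Longrightarrow>
      \<exists>t s. one_pass prog us s0 t s \<and> stored_at p (S * stream_mat (dim_col S) m us) s \<and>
        real t \<le> \<tau> * real (nnz (stream_mat (dim_col S) m us) + excess_updates (dim_col S) m us)"
    using assms(1) unfolding stream_computes_def Let_def by blast
  show ?thesis
    unfolding stream_computes_def Let_def
  proof (rule exI[of _ s0], rule exI[of _ p], intro allI impI)
    fix us assume "turnstile_stream (dim_col S) m us"
    from s0[OF this] obtain t s where "one_pass prog us s0 t s"
      "stored_at p (S * stream_mat (dim_col S) m us) s"
      "real t \<le> \<tau> * real (nnz (stream_mat (dim_col S) m us) + excess_updates (dim_col S) m us)"
      by blast
    then show "\<exists>t s. one_pass prog us s0 t s \<and> stored_at p (S * stream_mat (dim_col S) m us) s \<and>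
        real t \<le> \<tau>' * real (nnz (stream_mat (dim_col S) m us) + excess_updates (dim_col S) m us)"
      using le by blast
  qed
qed

lemma identity_stream_computes:
  "14 \<le> \<tau> \<Longrightarrow> stream_computes sketch_update (column_matrix n n 1 (\<lambda>i _. i) (\<lambda>_ _. 1)) m \<tau>"
  by (rule stream_computes_column_matrix) auto

lemma column_matrix_distribution:
  "sketch_distribution r n (return_pmf (column_matrix r n q h v, vec r (\<lambda>_. 1)))"
  by (simp add: sketch_distribution_def column_matrix_def)

lemma constant_factor_sketch:
  fixes c e :: real
  assumes c: "0 < c" "c \<le> 1" and e: "0 < e" "e \<le> 1 / 2"
  shows "\<exists>C>0. \<forall>n d :: nat. n \<ge> 2 \<and> d \<ge> 1 \<longrightarrow> (\<exists>r D.
    real r \<le> C * (real d powr (1 + c) * ln (real n) powr (3 + 5 * c)) \<and> sketch_distribution r n D \<and>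
    (\<forall>(S, w)\<in>set_pmf D. stream_computes sketch_update S (d + 1) (C * (real d * ln (real n)))) \<and>
    (\<forall>X\<in>carrier_mat n d. \<forall>Y\<in>carrier_vec n. \<forall>\<beta>opt. l1_minimizer X Y \<beta>opt \<longrightarrow>
      measure_pmf.prob D {(S, w). weak_weighted_sketch X Y \<beta>opt (1 + 1 / c) e (S * append_col X Y) w} \<ge> e / 4))"
proof -
  define s where "s = e / 64"
  have s: "0 < s" "s \<le> 1" using e by (auto simp: s_def)
  \<comment> \<open>With the factor 4 moved into the constant,
    \<open>ln (\<eta> / 4) \<le> \<eta> / 4\<close> gives a total of at most
    \<open>\<eta> / 2 + 3 / 8 * \<eta>\<close>, which solves the circular condition.\<close>
  define \<eta> where "\<eta> = 2 * (1 / s + 29 / 2 + 3 / 2 * ln (4 * (784 / s\<^sup>2)))"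
  have \<eta>: "\<eta> \<ge> 1" "1 / s + 29 / 2 + 3 / 2 * ln (784 / s\<^sup>2 * \<eta>) \<le> \<eta>"
  proof -
    have "s\<^sup>2 \<le> 1" using s by (intro power_le_one) auto
    then have "1 \<le> 4 * (784 / s\<^sup>2)" using s by (simp add: le_divide_eq)
    then have "0 \<le> ln (4 * (784 / s\<^sup>2))" by simp
    moreover have "0 < 1 / s" using s by simp
    ultimately show 1: "\<eta> \<ge> 1" by (simp add: \<eta>_def)
    have "ln (784 / s\<^sup>2 * \<eta>) = ln ((4 * (784 / s\<^sup>2)) * (\<eta> / 4))" by simp
    also have "\<dots> = ln (4 * (784 / s\<^sup>2)) + ln (\<eta> / 4)" using 1 s by (intro ln_mult_pos) auto
    also have "\<dots> \<le> ln (4 * (784 / s\<^sup>2)) + \<eta> / 4" using 1 ln_le_self[of "\<eta> / 4"] by simp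
    finally have "3 / 2 * ln (784 / s\<^sup>2 * \<eta>) \<le> 3 / 2 * (ln (4 * (784 / s\<^sup>2)) + \<eta> / 4)"
      by (rule mult_left_mono) simp
    then have "1 / s + 29 / 2 + 3 / 2 * ln (784 / s\<^sup>2 * \<eta>) \<le> 1 / s + 29 / 2 + 3 / 2 * (ln (4 * (784 / s\<^sup>2)) + \<eta> / 4)"
      by (rule add_left_mono)
    also have "\<dots> = \<eta> / 2 + 3 / 8 * \<eta>"
    proof -
      have "\<eta> / 2 = 1 / s + 29 / 2 + 3 / 2 * ln (4 * (784 / s\<^sup>2))" unfolding \<eta>_def by (rule nonzero_mult_div_cancel_left) simp
      then show ?thesis unfolding distrib_left by simp
    qed
    also have "\<dots> \<le> \<eta>" using 1 by simp
    finally show "1 / s + 29 / 2 + 3 / 2 * ln (784 / s\<^sup>2 * \<eta>) \<le> \<eta>" .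
  qed
  define C1 where "C1 = (9 + 5 * \<eta>) * (49 / s) * (2 powr (1 / s + 10) * (784 / s\<^sup>2 * \<eta>))"
  define C where "C = max C1 (900 / s ^ 3)"
  have C: "C > 0" "C1 \<le> C" "900 / s ^ 3 \<le> C" using s by (auto simp: C_def less_max_iff_disj)
  have C900: "900 \<le> 900 / s ^ 3" "900 / s\<^sup>2 \<le> 900 / s ^ 3"
  proof -
    have "s ^ 3 \<le> 1" "s ^ 3 \<le> s\<^sup>2" using s by (auto intro: power_le_one power_decreasing)
    then show "900 \<le> 900 / s ^ 3" "900 / s\<^sup>2 \<le> 900 / s ^ 3"
      using s frac_le[of 900 900 "s ^ 3" "s\<^sup>2"] by (auto simp: le_divide_eq)
  qed
  have "\<exists>r D. real r \<le> C * (real d powr (1 + c) * ln (real n) powr (3 + 5 * c)) \<and> sketch_distribution r n D \<and>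
    (\<forall>(S, w)\<in>set_pmf D. stream_computes sketch_update S (d + 1) (C * (real d * ln (real n)))) \<and>
    (\<forall>X\<in>carrier_mat n d. \<forall>Y\<in>carrier_vec n. \<forall>\<beta>opt. l1_minimizer X Y \<beta>opt \<longrightarrow>
      measure_pmf.prob D {(S, w). weak_weighted_sketch X Y \<beta>opt (1 + 1 / c) e (S * append_col X Y) w} \<ge> e / 4)"
    if n: "n \<ge> 2" and d: "d \<ge> 1" for n d :: nat
  proof -
    define L where "L = ln (real n)"
    have L23: "2 / 3 \<le> L"
    proof -
      have "ln 2 \<le> L" unfolding L_def using n by simp
      then show ?thesis using ln2_ge_two_thirds by linarith
    qed
    have d1: "1 \<le> real d" using d by simp
    show ?thesis
    proof (cases "real n \<le> C * (real d powr (1 + c) * L powr (3 + 5 * c))")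
      case True
      show ?thesis
      proof (intro exI conjI ballI allI impI)
        show "real n \<le> C * (real d powr (1 + c) * ln (real n) powr (3 + 5 * c))" using True by (simp add: L_def)
        show "sketch_distribution n n (return_pmf (column_matrix n n 1 (\<lambda>i _. i) (\<lambda>_ _. 1), vec n (\<lambda>_. 1)))"
          by (rule column_matrix_distribution)
        have "900 * (1 * (2 / 3)) \<le> C * (real d * L)"
          using C C900 d1 L23 by (intro mult_mono) auto
        then have "14 \<le> C * (real d * ln (real n))" by (simp add: L_def)
        then show "case Sw of (S, w) \<Rightarrow> stream_computes sketch_update S (d + 1) (C * (real d * ln (real n)))"
          if "Sw \<in> set_pmf (return_pmf (column_matrix n n 1 (\<lambda>i _. i) (\<lambda>_ _. 1), vec n (\<lambda>_. 1)))" for Sw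
          using that identity_stream_computes by simp
        show "e / 4 \<le> measure_pmf.prob (return_pmf (column_matrix n n 1 (\<lambda>i _. i) (\<lambda>_ _. 1), vec n (\<lambda>_. 1)))
          {(S, w). weak_weighted_sketch X Y \<beta>opt (1 + 1 / c) e (S * append_col X Y) w}"
          if "X \<in> carrier_mat n d" "Y \<in> carrier_vec n" "l1_minimizer X Y \<beta>opt" for X Y \<beta>opt
          using identity_sketch[OF _ _ that, of e "1 + 1 / c"] c e by simp
      qed
    next
      case False
      \<comment> \<open>Now \<open>n\<close> exceeds a multiple of \<open>d\<close>. The constant
        \<open>900 / s ^ 3\<close> in \<open>C\<close> makes this imply both
        \<open>d \<le> n\<close> and \<open>29 / s ^ 3 \<le> n\<close>, as \<open>29 / 900\<close>
        is below the power of the logarithm even for \<open>n = 2\<close>.\<close>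
      have dp: "real d \<le> real d powr (1 + c)" using powr_mono[of 1 "1 + c" "real d"] d1 c by simp
      have Lp: "29 / 900 \<le> L powr (3 + 5 * c)"
      proof (cases "L \<le> 1")
        case True
        have "(29 / 900 :: real) \<le> (2 / 3) powr 8" by (simp add: power_divide)
        also have "\<dots> \<le> L powr 8" using L23 by (intro powr_mono2) auto
        also have "\<dots> \<le> L powr (3 + 5 * c)" using True L23 c by (intro powr_mono') auto
        finally show ?thesis .
      next
        case False
        then have "1 \<le> L powr (3 + 5 * c)" using c by (intro ge_one_powr_ge_zero) auto
        then show ?thesis by simp
      qed
      have "29 / s ^ 3 * real d = 900 / s ^ 3 * (real d * (29 / 900))" by simp
      also have "\<dots> \<le> C * (real d powr (1 + c) * L powr (3 + 5 * c))"
        using C dp Lp s by (intro mult_mono) auto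
      finally have nd: "29 / s ^ 3 * real d < n" using False by linarith
      have "29 / s ^ 3 * 1 \<le> 29 / s ^ 3 * real d" using d1 s by (intro mult_left_mono) auto
      then have n29: "29 / s ^ 3 \<le> n" using nd by linarith
      have s29: "29 \<le> 29 / s ^ 3" using C900 by simp
      have "1 * real d \<le> 29 / s ^ 3 * real d" using s29 by (intro mult_right_mono) auto
      then have dn: "d \<le> n" using nd by simp
      have L1: "L \<ge> 1"
      proof -
        have "exp 1 \<le> real n" using e_less_272 n29 s29 by linarith
        then show ?thesis unfolding L_def using n by (subst ln_ge_iff) auto
      qed
      from constant_factor_sketch_large[OF c e \<eta>[unfolded s_def] d dn n29[unfolded s_def], of "d + 1", folded s_def, folded C1_def]
      obtain r D where r: "real r \<le> C1 * (real d powr (1 + c) * ln n powr (2 + 2 * c))"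
        and D: "sketch_distribution r n D"
        and time: "\<forall>(S, w)\<in>set_pmf D. stream_computes sketch_update S (d + 1) (900 / s\<^sup>2 * (real d * ln n))"
        and prob: "\<forall>X\<in>carrier_mat n d. \<forall>Y\<in>carrier_vec n. \<forall>\<beta>opt. l1_minimizer X Y \<beta>opt \<longrightarrow>
          measure_pmf.prob D {(S, w). weak_weighted_sketch X Y \<beta>opt (1 + 1 / c) e (S * append_col X Y) w} \<ge> e / 4"
        by blast
      show ?thesis
      proof (intro exI conjI)
        have "C1 * (real d powr (1 + c) * ln n powr (2 + 2 * c)) \<le> C * (real d powr (1 + c) * ln (real n) powr (3 + 5 * c))"
        proof (rule mult_mono[OF C(2)])
          have "ln n powr (2 + 2 * c) \<le> ln n powr (3 + 5 * c)" using L1 c by (intro powr_mono) (auto simp: L_def)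
          then show "real d powr (1 + c) * ln n powr (2 + 2 * c) \<le> real d powr (1 + c) * ln n powr (3 + 5 * c)"
            by (intro mult_left_mono) auto
        qed (use C in auto)
        then show "real r \<le> C * (real d powr (1 + c) * ln (real n) powr (3 + 5 * c))" using r by linarith
        have "900 / s\<^sup>2 * (real d * ln n) \<le> C * (real d * ln (real n))"
          using C C900 L1 by (intro mult_right_mono) (auto simp: L_def)
        then show "\<forall>(S, w)\<in>set_pmf D. stream_computes sketch_update S (d + 1) (C * (real d * ln (real n)))"
          using time stream_computes_mono by blast
      qed (rule D, rule prob)
    qed
  qed
  then show ?thesis using C(1) by blast
qed

theorem theorem1:
  shows "(\<forall>c \<epsilon> :: real. 0 < c \<and> c \<le> 1 \<and> \<epsilon> > 0 \<longrightarrow>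
      (\<exists>(P :: real) (C :: real) prog. 0 < P \<and> P < 1 \<and> C > 0 \<and>
        (\<forall>n d :: nat. n \<ge> 2 \<and> d \<ge> 1 \<longrightarrow>
          (\<exists>(r :: nat) D.
            real r \<le> C * (real d powr (1 + c) * ln (real n) powr (3 + 5 * c)) \<and>
            sketch_distribution r n D \<and>
            (\<forall>(S, w)\<in>set_pmf D. stream_computes prog S (d + 1) (C * (real d * ln (real n)))) \<and>
            (\<forall>X\<in>carrier_mat n d. \<forall>Y\<in>carrier_vec n. \<forall>\<beta>opt. l1_minimizer X Y \<beta>opt \<longrightarrow>
              measure_pmf.prob D
                {(S, w). weak_weighted_sketch X Y \<beta>opt (1 + 1 / c) \<epsilon> (S * append_col X Y) w}
              \<ge> 1 - P)))))
    \<and> (\<exists>(C :: real) prog. C > 0 \<and>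
        (\<forall>(n :: nat) (d :: nat) (\<epsilon> :: real) (\<delta> :: real) (a :: real).
          n \<ge> 2 \<and> d \<ge> 1 \<and> \<epsilon> > 0 \<and> \<delta> > 0 \<and> a > 1 \<longrightarrow>
          (\<exists>(r :: nat) D.
            real r \<le> C * (real d ^ 4 * ln (real n) ^ 5 / (\<delta> * \<epsilon> ^ 7))
              + 32 * real d * ln (real n) ^ 3 / \<epsilon> ^ 5
                * (64 * real d * ln (real n) ^ 5 / (\<epsilon> ^ 6 * \<delta>)) powr (1 + 1 / \<epsilon>) \<and>
            sketch_distribution r n D \<and>
            (\<forall>(S, w)\<in>set_pmf D. stream_computes prog S (d + 1) C) \<and>
            (\<forall>X\<in>carrier_mat n d. \<forall>Y\<in>carrier_vec n. \<forall>\<beta>opt. l1_minimizer X Y \<beta>opt \<longrightarrow>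
              measure_pmf.prob D
                {(S, w). weak_weighted_sketch X Y \<beta>opt (1 + a * \<epsilon>) \<epsilon> (S * append_col X Y) w}
              \<ge> 1 - (\<delta> + 1 / a)))))"
proof (intro conjI allI impI)
  fix c \<epsilon> :: real assume "0 < c \<and> c \<le> 1 \<and> \<epsilon> > 0"
  then have c: "0 < c" "c \<le> 1" and \<epsilon>: "\<epsilon> > 0" by auto
  \<comment> \<open>The construction works for errors up to 1/2, and a smaller error only
    strengthens the lower bound.\<close>
  define e where "e = min \<epsilon> (1 / 2)"
  have e: "0 < e" "e \<le> 1 / 2" "e \<le> \<epsilon>" using \<epsilon> by (auto simp: e_def)
  have mono: "1 - (1 - e / 4) \<le> measure_pmf.prob D {(S, w). weak_weighted_sketch X Y \<beta>opt \<alpha> \<epsilon> (S * append_col X Y) w}"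
    if "e / 4 \<le> measure_pmf.prob D {(S, w). weak_weighted_sketch X Y \<beta>opt \<alpha> e (S * append_col X Y) w}"
    for D X Y \<beta>opt \<alpha>
  proof -
    have "measure_pmf.prob D {(S, w). weak_weighted_sketch X Y \<beta>opt \<alpha> e (S * append_col X Y) w}
      \<le> measure_pmf.prob D {(S, w). weak_weighted_sketch X Y \<beta>opt \<alpha> \<epsilon> (S * append_col X Y) w}"
      using weak_weighted_sketch_mono[OF _ e(3)] by (intro measure_pmf.finite_measure_mono) auto
    then show ?thesis using that by simp
  qed
  obtain C where C: "C > 0" and sketch: "\<And>n d :: nat. n \<ge> 2 \<and> d \<ge> 1 \<Longrightarrow> \<exists>r D.
    real r \<le> C * (real d powr (1 + c) * ln (real n) powr (3 + 5 * c)) \<and> sketch_distribution r n D \<and>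
    (\<forall>(S, w)\<in>set_pmf D. stream_computes sketch_update S (d + 1) (C * (real d * ln (real n)))) \<and>
    (\<forall>X\<in>carrier_mat n d. \<forall>Y\<in>carrier_vec n. \<forall>\<beta>opt. l1_minimizer X Y \<beta>opt \<longrightarrow>
      measure_pmf.prob D {(S, w). weak_weighted_sketch X Y \<beta>opt (1 + 1 / c) e (S * append_col X Y) w} \<ge> e / 4)"
    using constant_factor_sketch[OF c e(1,2)] by blast
  show "\<exists>(P :: real) (C :: real) prog. 0 < P \<and> P < 1 \<and> C > 0 \<and>
        (\<forall>n d :: nat. n \<ge> 2 \<and> d \<ge> 1 \<longrightarrow>
          (\<exists>(r :: nat) D.
            real r \<le> C * (real d powr (1 + c) * ln (real n) powr (3 + 5 * c)) \<and>
            sketch_distribution r n D \<and>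
            (\<forall>(S, w)\<in>set_pmf D. stream_computes prog S (d + 1) (C * (real d * ln (real n)))) \<and>
            (\<forall>X\<in>carrier_mat n d. \<forall>Y\<in>carrier_vec n. \<forall>\<beta>opt. l1_minimizer X Y \<beta>opt \<longrightarrow>
              measure_pmf.prob D
                {(S, w). weak_weighted_sketch X Y \<beta>opt (1 + 1 / c) \<epsilon> (S * append_col X Y) w}
              \<ge> 1 - P)))"
  proof (rule exI[of _ "1 - e / 4"], rule exI[of _ C], rule exI[of _ sketch_update], intro conjI allI impI)
    fix n d :: nat assume "2 \<le> n \<and> 1 \<le> d"
    from sketch[OF this] obtain r D where D:
      "real r \<le> C * (real d powr (1 + c) * ln (real n) powr (3 + 5 * c))" "sketch_distribution r n D"
      "\<forall>(S, w)\<in>set_pmf D. stream_computes sketch_update S (d + 1) (C * (real d * ln (real n)))"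
      and prob: "\<forall>X\<in>carrier_mat n d. \<forall>Y\<in>carrier_vec n. \<forall>\<beta>opt. l1_minimizer X Y \<beta>opt \<longrightarrow>
        measure_pmf.prob D {(S, w). weak_weighted_sketch X Y \<beta>opt (1 + 1 / c) e (S * append_col X Y) w} \<ge> e / 4"
      by blast
    show "\<exists>r D. real r \<le> C * (real d powr (1 + c) * ln (real n) powr (3 + 5 * c)) \<and>
        sketch_distribution r n D \<and>
        (\<forall>(S, w)\<in>set_pmf D. stream_computes sketch_update S (d + 1) (C * (real d * ln (real n)))) \<and>
        (\<forall>X\<in>carrier_mat n d. \<forall>Y\<in>carrier_vec n. \<forall>\<beta>opt. l1_minimizer X Y \<beta>opt \<longrightarrow>
          measure_pmf.prob D
            {(S, w). weak_weighted_sketch X Y \<beta>opt (1 + 1 / c) \<epsilon> (S * append_col X Y) w}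
          \<ge> 1 - (1 - e / 4))"
    proof (intro exI conjI ballI allI impI)
      fix X Y \<beta>opt assume "X \<in> carrier_mat n d" "Y \<in> carrier_vec n" "l1_minimizer X Y \<beta>opt"
      with prob show "1 - (1 - e / 4) \<le> measure_pmf.prob D
          {(S, w). weak_weighted_sketch X Y \<beta>opt (1 + 1 / c) \<epsilon> (S * append_col X Y) w}"
        by (intro mono) blast
    qed (use D in auto)
  qed (use C e in auto)
next
  have precise: "\<exists>r D. real r \<le> 23 * (real d ^ 4 * ln (real n) ^ 5 / (\<delta> * \<epsilon> ^ 7))
              + 32 * real d * ln (real n) ^ 3 / \<epsilon> ^ 5
                * (64 * real d * ln (real n) ^ 5 / (\<epsilon> ^ 6 * \<delta>)) powr (1 + 1 / \<epsilon>) \<and>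
            sketch_distribution r n D \<and>
            (\<forall>(S, w)\<in>set_pmf D. stream_computes sketch_update S (d + 1) 23) \<and>
            (\<forall>X\<in>carrier_mat n d. \<forall>Y\<in>carrier_vec n. \<forall>\<beta>opt. l1_minimizer X Y \<beta>opt \<longrightarrow>
              measure_pmf.prob D
                {(S, w). weak_weighted_sketch X Y \<beta>opt (1 + a * \<epsilon>) \<epsilon> (S * append_col X Y) w}
              \<ge> 1 - (\<delta> + 1 / a))" (is "\<exists>r D. real r \<le> ?a + ?b \<and> ?S r D")
    if n: "n \<ge> 2" and d: "d \<ge> 1" and \<epsilon>: "\<epsilon> > 0" and \<delta>: "\<delta> > 0" and a: "a > 1" for n d :: nat and \<epsilon> \<delta> a :: real
  proof -
    have a0: "0 \<le> ?a" using n \<epsilon> \<delta> by simp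
    have b0: "0 \<le> ?b" using n \<epsilon> by simp
    have pos: "0 \<le> \<delta> + 1 / a" "0 \<le> 1 + a * \<epsilon>" "1 \<le> 1 + a * \<epsilon>" using a \<delta> \<epsilon> by auto
    \<comment> \<open>For \<open>\<epsilon> \<ge> 1\<close> the lower bound is trivial, and for
      \<open>\<delta> \<ge> 1\<close> the required probability is negative; a matrix without rows
      serves both. If the size bound allows \<open>n\<close> rows, the identity does.\<close>
    consider "\<epsilon> \<ge> 1 \<or> \<delta> \<ge> 1" | "real n \<le> ?b" | "\<epsilon> < 1" "\<delta> < 1" "?b < real n" by linarith
    then show ?thesis
    proof cases
      case 1
      let ?D = "return_pmf (column_matrix 0 n 0 (\<lambda>_ _. 0) (\<lambda>_ _. 0), vec 0 (\<lambda>_. 1)) :: (real mat \<times> real vec) pmf"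
      have "?S 0 ?D"
      proof (intro conjI ballI allI impI)
        show "sketch_distribution 0 n ?D" by (rule column_matrix_distribution)
        show "case Sw of (S, w) \<Rightarrow> stream_computes sketch_update S (d + 1) 23" if "Sw \<in> set_pmf ?D" for Sw
          using that by (auto intro!: stream_computes_column_matrix)
        show "1 - (\<delta> + 1 / a) \<le> measure_pmf.prob ?D
            {(S, w). weak_weighted_sketch X Y \<beta>opt (1 + a * \<epsilon>) \<epsilon> (S * append_col X Y) w}"
          if opt: "l1_minimizer X Y \<beta>opt" for X Y \<beta>opt
        proof (cases "\<epsilon> \<ge> 1")
          case True
          then show ?thesis using empty_sketch[OF True pos(2) opt] pos by simp
        next
          case False
          moreover have "0 < 1 / a" using a by simp
          ultimately have "1 - (\<delta> + 1 / a) \<le> 0" using 1 by linarith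
          then show ?thesis by (rule order_trans) (rule measure_nonneg)
        qed
      qed
      then show ?thesis using a0 b0 by (intro exI[of _ 0] exI[of _ ?D]) auto
    next
      case 2
      let ?D = "return_pmf (column_matrix n n 1 (\<lambda>i _. i) (\<lambda>_ _. 1), vec n (\<lambda>_. 1)) :: (real mat \<times> real vec) pmf"
      have "?S n ?D"
      proof (intro conjI ballI allI impI)
        show "sketch_distribution n n ?D" by (rule column_matrix_distribution)
        show "case Sw of (S, w) \<Rightarrow> stream_computes sketch_update S (d + 1) 23" if "Sw \<in> set_pmf ?D" for Sw
          using that identity_stream_computes[of 23 n "d + 1"] by simp
        show "1 - (\<delta> + 1 / a) \<le> measure_pmf.prob ?D
            {(S, w). weak_weighted_sketch X Y \<beta>opt (1 + a * \<epsilon>) \<epsilon> (S * append_col X Y) w}"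
          if "X \<in> carrier_mat n d" "Y \<in> carrier_vec n" "l1_minimizer X Y \<beta>opt" for X Y \<beta>opt
          using identity_sketch[OF less_imp_le[OF \<epsilon>] pos(3) that] pos by simp
      qed
      moreover have "real n \<le> ?a + ?b" using 2 a0 by linarith
      ultimately show ?thesis by blast
    next
      case 3
      obtain r D where "real r \<le> ?b" "?S r D"
        using precise_sketch[OF n d \<epsilon> 3(1) \<delta> 3(2) a 3(3), of "d + 1"] by blast
      moreover from this have "real r \<le> ?a + ?b" using a0 by linarith
      ultimately show ?thesis by blast
    qed
  qed
  show "\<exists>(C :: real) prog. C > 0 \<and>
        (\<forall>(n :: nat) (d :: nat) (\<epsilon> :: real) (\<delta> :: real) (a :: real).
          n \<ge> 2 \<and> d \<ge> 1 \<and> \<epsilon> > 0 \<and> \<delta> > 0 \<and> a > 1 \<longrightarrow>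
          (\<exists>(r :: nat) D.
            real r \<le> C * (real d ^ 4 * ln (real n) ^ 5 / (\<delta> * \<epsilon> ^ 7))
              + 32 * real d * ln (real n) ^ 3 / \<epsilon> ^ 5
                * (64 * real d * ln (real n) ^ 5 / (\<epsilon> ^ 6 * \<delta>)) powr (1 + 1 / \<epsilon>) \<and>
            sketch_distribution r n D \<and>
            (\<forall>(S, w)\<in>set_pmf D. stream_computes prog S (d + 1) C) \<and>
            (\<forall>X\<in>carrier_mat n d. \<forall>Y\<in>carrier_vec n. \<forall>\<beta>opt. l1_minimizer X Y \<beta>opt \<longrightarrow>
              measure_pmf.prob D
                {(S, w). weak_weighted_sketch X Y \<beta>opt (1 + a * \<epsilon>) \<epsilon> (S * append_col X Y) w}
              \<ge> 1 - (\<delta> + 1 / a))))"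
    by (rule exI[of _ "23 :: real"], rule exI[of _ sketch_update], intro conjI allI impI, simp)
       (elim conjE, rule precise)
qed

end
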